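(* There is a unique bilinear pairing $\langle\cdot,\cdot\rangle:{}_{D'}\mathbf W\times{}_D\mathbf W\to\mathbb C$ such that $\langle\mathbf 1',\mathbf 1\rangle=1$ and such that for all $\chi\in{}_D\mathbf W$, $\chi'\in{}_{D'}\mathbf W$: (i) for $z\in D$, as sections of $K$ on $D$, $\langle\chi',e(z)\chi\rangle=-\langle i'(z)\chi',\chi\rangle$; (ii) for $z'\in D'$, as sections of $K$ on $D'$, $\langle e'(z')\chi',\chi\rangle=-\langle\chi',i(z')\chi\rangle$; (iii) for every regular vector field $X$ on $\mathbb P$ and every natural number $N$, for $z\in D$ and $z'\in D'$, $$\langle\chi',\boldsymbol{\mathcal L}_X^Ne(z)\chi\rangle=\mathcal L_X^N\langle\chi',e(z)\chi\rangle=-\mathcal L_X^N\langle i'(z)\chi',\chi\rangle=-\langle\boldsymbol{\mathcal L}_X^Ni'(z)\chi',\chi\rangle,$$ $$\langle\boldsymbol{\mathcal L}_X^Ne'(z')\chi',\chi\rangle=\mathcal L_X^N\langle e'(z')\chi',\chi\rangle=-\mathcal L_X^N\langle\chi',i(z')\chi\rangle=-\langle\chi',\boldsymbol{\mathcal L}_X^Ni(z')\chi\rangle .$$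
   Context: $\mathbb P$ is a complex projective line, $K$ its canonical bundle. $\gamma\subset\mathbb P$ is a smooth simple closed curve separating $\mathbb P$ into two domains $D$ and $D'$ (each biholomorphic to a disc). ${}_D\mathbf K$ (resp. ${}_{D'}\mathbf K$) is the space of meromorphic 1-forms on $\mathbb P$ with all residues zero and all poles in $D$ (resp. $D'$); ${}_D\mathbf W=S^*({}_D\mathbf K)$, ${}_{D'}\mathbf W=S^*({}_{D'}\mathbf K)$, with vacuum vectors $\mathbf 1$ and $\mathbf 1'$ (the element $1\in\mathbb C$ of each). For $z\in D$, $e(z):{}_D\mathbf W\to{}_D\mathbf W\otimes K_z$ is multiplication by $e_z=-\frac{du}{(u-u(z))^2}\otimes du_z$, where $u$ is any coordinate (meromorphic function with exactly one, simple, pole) regular at $z$; $e_z$ does not depend on $u$. For $z\notin D$, $i(z):{}_D\mathbf W\to{}_D\mathbf W\otimes K_z$ is the derivation with $i(z)\mathbf 1=0$ and $i(z)\alpha=-\alpha(z)$ for $\alpha\in{}_D\mathbf K$. Likewise, with the roles of $D$ and $D'$ exchanged, $e'(z')$ (for $z'\in D'$) and $i'(z)$ (for $z\notin D'$) act on ${}_{D'}\mathbf W$ by the same formulas. $\boldsymbol{\mathcal L}_X$ denotes the derivative (Lie derivative in the variable $z$) of an operator-valued section of $K$ along a regular vector field $X$; $\mathcal L_X$ is the Lie derivative of scalar-valued sections of $K$. *)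

theory Defs
  imports
    "HOL-Complex_Analysis.Complex_Analysis"
    "HOL-Algebra.QuotRing"
    "HOL-Library.Poly_Mapping"
    "HOL-Library.Multiset"
begin

section \<open>The projective line\<close>

text \<open>
  \<open>Some a\<close> is the point with affine coordinate \<open>a\<close> and \<open>None\<close> is the point at infinity.
  The local coordinate centred at a point \<open>p\<close> is \<open>t = u - a\<close> if \<open>p = Some a\<close> and \<open>t = 1/u\<close> if
  \<open>p = None\<close>; \<open>param p\<close> is its inverse.
\<close>

type_synonym proj_line = "complex option"

definition proj_top :: "proj_line topology" where
  "proj_top = Alexandroff_compactification euclidean"

definition param :: "proj_line \<Rightarrow> complex \<Rightarrow> proj_line" where
  "param p t = (case p of Some a \<Rightarrow> Some (a + t)
                        | None \<Rightarrow> if t = 0 then None else Some (1 / t))"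

text \<open>
  A 1-periodic parametrization, infinitely differentiable and immersive in the local coordinates;
  \<open>F k\<close> is the \<open>k\<close>-th derivative of the coordinate expression of \<open>\<gamma>\<close> near \<open>s\<close>.
\<close>

definition smooth_simple_closed_curve :: "(real \<Rightarrow> proj_line) \<Rightarrow> bool" where
  "smooth_simple_closed_curve \<gamma> \<longleftrightarrow>
     continuous_map euclideanreal proj_top \<gamma> \<and>
     (\<forall>s t. \<gamma> s = \<gamma> t \<longleftrightarrow> s - t \<in> \<int>) \<and>
     (\<forall>s. \<exists>\<epsilon>>0. \<exists>F :: nat \<Rightarrow> real \<Rightarrow> complex.
        (\<forall>r\<in>{s-\<epsilon><..<s+\<epsilon>}. F 0 r = inv_into UNIV (param (\<gamma> s)) (\<gamma> r)) \<and>
        (\<forall>k. \<forall>r\<in>{s-\<epsilon><..<s+\<epsilon>}. (F k has_vector_derivative F (Suc k) r) (at r)) \<and>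
        F 1 s \<noteq> 0)"

text \<open>
  The two domains are the connected components of the complement of the curve; that each of them is
  biholomorphic to a disc is automatic and not part of the definition.
\<close>

definition separates_into :: "(real \<Rightarrow> proj_line) \<Rightarrow> proj_line set \<Rightarrow> proj_line set \<Rightarrow> bool" where
  "separates_into \<gamma> D D' \<longleftrightarrow>
     D \<noteq> D' \<and> connected_components_of (subtopology proj_top (- range \<gamma>)) = {D, D'}"

section \<open>Meromorphic functions, 1-forms and vector fields\<close>

text \<open>
  The fibre \<open>K\<^sub>p\<close> is identified with the complex numbers by the basis \<open>dt\<close>, \<open>t\<close> the local coordinate
  centred at \<open>p\<close> (so \<open>du\<close> at finite points and \<open>d(1/u)\<close> at infinity), and the tangent space by the
  dual basis. A section of \<open>K\<close> is thus a function on the projective line, but this frame is not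
  continuous at infinity: regularity, poles, residues and derivatives have to be read off from the
  coefficient in a single chart. \<open>jac p t\<close> is the factor in \<open>du = -(1/t\<^sup>2) dt\<close>.
\<close>

definition jac :: "proj_line \<Rightarrow> complex \<Rightarrow> complex" where
  "jac p t = (case p of Some a \<Rightarrow> 1 | None \<Rightarrow> if t = 0 then 1 else - 1 / t\<^sup>2)"

definition loc_fun :: "(proj_line \<Rightarrow> complex) \<Rightarrow> proj_line \<Rightarrow> complex \<Rightarrow> complex" where
  "loc_fun u p t = u (param p t)"

definition loc_form :: "(proj_line \<Rightarrow> complex) \<Rightarrow> proj_line \<Rightarrow> complex \<Rightarrow> complex" where
  "loc_form \<alpha> p t = jac p t * \<alpha> (param p t)"

definition loc_field :: "(proj_line \<Rightarrow> complex) \<Rightarrow> proj_line \<Rightarrow> complex \<Rightarrow> complex" where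
  "loc_field X p t = X (param p t) / jac p t"

definition regular_field :: "(proj_line \<Rightarrow> complex) \<Rightarrow> bool" where
  "regular_field X \<longleftrightarrow> (\<forall>p. loc_field X p analytic_on {0})"

text \<open>
  Meromorphic functions and 1-forms take the value 0 at their poles and their limit elsewhere, so
  that each of them is represented by exactly one function. A pointwise sum need not respect this
  when poles cancel; \<open>normal_form\<close> restores it.
\<close>

definition mero_fun :: "(proj_line \<Rightarrow> complex) \<Rightarrow> bool" where
  "mero_fun u \<longleftrightarrow> (\<forall>p. loc_fun u p nicely_meromorphic_on {0})"

definition mero_form :: "(proj_line \<Rightarrow> complex) \<Rightarrow> bool" where
  "mero_form \<alpha> \<longleftrightarrow> (\<forall>p. loc_form \<alpha> p nicely_meromorphic_on {0})"

definition normal_form :: "(proj_line \<Rightarrow> complex) \<Rightarrow> proj_line \<Rightarrow> complex" where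
  "normal_form \<alpha> p = remove_sings (loc_form \<alpha> p) 0"

definition form_add ::
  "(proj_line \<Rightarrow> complex) \<Rightarrow> (proj_line \<Rightarrow> complex) \<Rightarrow> proj_line \<Rightarrow> complex" where
  "form_add \<alpha> \<beta> = normal_form (\<lambda>p. \<alpha> p + \<beta> p)"

definition form_scale :: "complex \<Rightarrow> (proj_line \<Rightarrow> complex) \<Rightarrow> proj_line \<Rightarrow> complex" where
  "form_scale c \<alpha> = (\<lambda>p. c * \<alpha> p)"

text \<open>The space \<open>\<^sub>D\<^bold>K\<close>.\<close>

definition forms_in :: "proj_line set \<Rightarrow> (proj_line \<Rightarrow> complex) set" where
  "forms_in D = {\<alpha>. mero_form \<alpha> \<and>
                     (\<forall>p. residue (loc_form \<alpha> p) 0 = 0) \<and>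
                     (\<forall>p. is_pole (loc_form \<alpha> p) 0 \<longrightarrow> p \<in> D)}"

definition coordinate :: "(proj_line \<Rightarrow> complex) \<Rightarrow> bool" where
  "coordinate u \<longleftrightarrow> mero_fun u \<and>
     (\<exists>p. is_pole (loc_fun u p) 0 \<and> zorder (loc_fun u p) 0 = -1 \<and>
          (\<forall>q. is_pole (loc_fun u q) 0 \<longrightarrow> q = p))"

definition differential :: "(proj_line \<Rightarrow> complex) \<Rightarrow> proj_line \<Rightarrow> complex" where
  "differential u p = deriv (loc_fun u p) 0"

text \<open>
  The value of \<open>e\<^sub>z\<close> in the basis of \<open>K\<^sub>z\<close>. The formula is literally meaningful away from \<open>z\<close> and from the
  pole of \<open>u\<close>; \<open>normal_form\<close> takes care of these two points.
\<close>

definition e_form :: "proj_line \<Rightarrow> proj_line \<Rightarrow> complex" where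
  "e_form z = (THE \<alpha>. \<forall>u. coordinate u \<and> \<not> is_pole (loc_fun u z) 0 \<longrightarrow>
     \<alpha> = normal_form (\<lambda>v. - differential u v / (u v - u z)\<^sup>2 * differential u z))"

text \<open>In the chart with coordinate \<open>t\<close>, the Lie derivative of \<open>f dt\<close> along \<open>X \<partial>\<^sub>t\<close> is \<open>(X f' + X' f) dt\<close>.\<close>

definition lie :: "(proj_line \<Rightarrow> complex) \<Rightarrow> (proj_line \<Rightarrow> complex) \<Rightarrow> proj_line \<Rightarrow> complex" where
  "lie X s p = loc_field X p 0 * deriv (loc_form s p) 0 + deriv (loc_field X p) 0 * loc_form s p 0"

section \<open>Symmetric algebras\<close>

text \<open>
  The symmetric algebra of a complex vector space with carrier \<open>U\<close>, addition \<open>ad\<close> and scalar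
  multiplication \<open>sc\<close>: the polynomial algebra on the set \<open>U\<close> (a monomial is a multiset over \<open>U\<close>,
  with \<open>0\<close> the empty one) modulo the ideal generated by the linear relations that hold in \<open>U\<close>.
\<close>

definition gen :: "'v \<Rightarrow> 'v multiset \<Rightarrow>\<^sub>0 complex" where
  "gen v = Poly_Mapping.single {#v#} 1"

definition const :: "complex \<Rightarrow> 'v multiset \<Rightarrow>\<^sub>0 complex" where
  "const c = Poly_Mapping.single {#} c"

definition poly_alg :: "'v set \<Rightarrow> ('v multiset \<Rightarrow>\<^sub>0 complex) ring" where
  "poly_alg U = \<lparr>carrier = {p. \<forall>m\<in>Poly_Mapping.keys p. set_mset m \<subseteq> U},
                 mult = (*), one = 1, zero = 0, add = (+)\<rparr>"

definition lin_rels ::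
  "('v \<Rightarrow> 'v \<Rightarrow> 'v) \<Rightarrow> (complex \<Rightarrow> 'v \<Rightarrow> 'v) \<Rightarrow> 'v set \<Rightarrow> ('v multiset \<Rightarrow>\<^sub>0 complex) set" where
  "lin_rels ad sc U =
     {gen (ad v w) - gen v - gen w | v w. v \<in> U \<and> w \<in> U} \<union>
     {gen (sc c v) - const c * gen v | c v. v \<in> U}"

definition sym_ideal ::
  "('v \<Rightarrow> 'v \<Rightarrow> 'v) \<Rightarrow> (complex \<Rightarrow> 'v \<Rightarrow> 'v) \<Rightarrow> 'v set \<Rightarrow> ('v multiset \<Rightarrow>\<^sub>0 complex) set" where
  "sym_ideal ad sc U = genideal (poly_alg U) (lin_rels ad sc U)"

definition sym_alg ::
  "('v \<Rightarrow> 'v \<Rightarrow> 'v) \<Rightarrow> (complex \<Rightarrow> 'v \<Rightarrow> 'v) \<Rightarrow> 'v set \<Rightarrow> ('v multiset \<Rightarrow>\<^sub>0 complex) set ring" where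
  "sym_alg ad sc U = poly_alg U Quot sym_ideal ad sc U"

section \<open>The spaces \<open>\<^sub>D\<^bold>W\<close> and the operators on them\<close>

type_synonym fock_vec = "((proj_line \<Rightarrow> complex) multiset \<Rightarrow>\<^sub>0 complex) set"

definition W :: "proj_line set \<Rightarrow> fock_vec ring" where
  "W D = sym_alg form_add form_scale (forms_in D)"

definition cls :: "proj_line set \<Rightarrow> ((proj_line \<Rightarrow> complex) multiset \<Rightarrow>\<^sub>0 complex) \<Rightarrow> fock_vec" where
  "cls D p = sym_ideal form_add form_scale (forms_in D) +>\<^bsub>poly_alg (forms_in D)\<^esub> p"

definition emb :: "proj_line set \<Rightarrow> (proj_line \<Rightarrow> complex) \<Rightarrow> fock_vec" where
  "emb D \<alpha> = cls D (gen \<alpha>)"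

definition scalar :: "proj_line set \<Rightarrow> complex \<Rightarrow> fock_vec" where
  "scalar D c = cls D (const c)"

definition vacuum :: "proj_line set \<Rightarrow> fock_vec" where
  "vacuum D = \<one>\<^bsub>W D\<^esub>"

definition linear_op :: "proj_line set \<Rightarrow> (fock_vec \<Rightarrow> fock_vec) \<Rightarrow> bool" where
  "linear_op D T \<longleftrightarrow>
     (\<forall>x\<in>carrier (W D). \<forall>y\<in>carrier (W D). T (x \<oplus>\<^bsub>W D\<^esub> y) = T x \<oplus>\<^bsub>W D\<^esub> T y) \<and>
     (\<forall>c. \<forall>x\<in>carrier (W D). T (scalar D c \<otimes>\<^bsub>W D\<^esub> x) = scalar D c \<otimes>\<^bsub>W D\<^esub> T x)"

definition derivation_op :: "proj_line set \<Rightarrow> (fock_vec \<Rightarrow> fock_vec) \<Rightarrow> bool" where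
  "derivation_op D T \<longleftrightarrow> linear_op D T \<and>
     (\<forall>x\<in>carrier (W D). \<forall>y\<in>carrier (W D).
        T (x \<otimes>\<^bsub>W D\<^esub> y) = (T x \<otimes>\<^bsub>W D\<^esub> y) \<oplus>\<^bsub>W D\<^esub> (x \<otimes>\<^bsub>W D\<^esub> T y))"

text \<open>
  Values of the operator-valued sections \<open>e\<close> (for \<open>z \<in> D\<close>) and \<open>i\<close> (for \<open>z \<notin> D\<close>) in the basis of \<open>K\<^sub>z\<close>.
\<close>

definition e_op :: "proj_line set \<Rightarrow> proj_line \<Rightarrow> fock_vec \<Rightarrow> fock_vec" where
  "e_op D z \<psi> = emb D (e_form z) \<otimes>\<^bsub>W D\<^esub> \<psi>"

definition i_op :: "proj_line set \<Rightarrow> proj_line \<Rightarrow> fock_vec \<Rightarrow> fock_vec" where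
  "i_op D z = (THE T. T \<in> carrier (W D) \<rightarrow>\<^sub>E carrier (W D) \<and> derivation_op D T \<and>
                      T (vacuum D) = \<zero>\<^bsub>W D\<^esub> \<and>
                      (\<forall>\<alpha>\<in>forms_in D. T (emb D \<alpha>) = scalar D (- \<alpha> z)))"

text \<open>
  The Lie derivative of an operator-valued section \<open>A\<close> of \<open>K\<close> is taken pointwise on vectors, and on
  \<open>W D\<close>-valued sections it is taken with respect to pointwise values: \<open>S\<^sup>n(\<^sub>D\<^bold>K)\<close> consists of symmetric
  forms in \<open>n\<close> points outside \<open>D\<close>, the values of these at \<open>zs\<close> being, up to a constant, the functionals
  \<open>value_at D zs\<close>, and these functionals separate the points of \<open>W D\<close>. For instance \<open>L\<^sub>X e(z)\<close> is
  multiplication by the form \<open>v \<mapsto> L\<^sub>X e\<^sub>z(v)\<close>, with \<open>L\<^sub>X\<close> acting in \<open>z\<close> for fixed \<open>v\<close>, and \<open>L\<^sub>X i(z)\<close> is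
  the derivation with \<open>\<alpha> \<mapsto> -(L\<^sub>X \<alpha>)(z)\<close>.
\<close>

definition vacuum_coeff :: "fock_vec \<Rightarrow> complex" where
  "vacuum_coeff x = (THE c. \<forall>p\<in>x. Poly_Mapping.lookup p {#} = c)"

definition value_at :: "proj_line set \<Rightarrow> proj_line list \<Rightarrow> fock_vec \<Rightarrow> complex" where
  "value_at D zs x = vacuum_coeff (foldr (i_op D) zs x)"

definition lie_op :: "proj_line set \<Rightarrow> (proj_line \<Rightarrow> complex) \<Rightarrow>
    (proj_line \<Rightarrow> fock_vec \<Rightarrow> fock_vec) \<Rightarrow> proj_line \<Rightarrow> fock_vec \<Rightarrow> fock_vec" where
  "lie_op D X A p \<psi> = (THE y. y \<in> carrier (W D) \<and>
     (\<forall>zs. set zs \<subseteq> - D \<longrightarrow>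
        loc_form (\<lambda>q. value_at D zs (A q \<psi>)) p field_differentiable at 0 \<and>
        value_at D zs y = lie X (\<lambda>q. value_at D zs (A q \<psi>)) p))"

section \<open>Pairings\<close>

text \<open>Pairings are extensional functions, so that uniqueness refers to their values on the spaces.\<close>

definition bilinear_pairing ::
  "proj_line set \<Rightarrow> proj_line set \<Rightarrow> (fock_vec \<Rightarrow> fock_vec \<Rightarrow> complex) \<Rightarrow> bool" where
  "bilinear_pairing D' D B \<longleftrightarrow>
     B \<in> carrier (W D') \<rightarrow>\<^sub>E (carrier (W D) \<rightarrow>\<^sub>E UNIV) \<and>
     (\<forall>x\<in>carrier (W D'). \<forall>y\<in>carrier (W D'). \<forall>z\<in>carrier (W D).
        B (x \<oplus>\<^bsub>W D'\<^esub> y) z = B x z + B y z) \<and>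
     (\<forall>c. \<forall>x\<in>carrier (W D'). \<forall>z\<in>carrier (W D). B (scalar D' c \<otimes>\<^bsub>W D'\<^esub> x) z = c * B x z) \<and>
     (\<forall>x\<in>carrier (W D'). \<forall>y\<in>carrier (W D). \<forall>z\<in>carrier (W D).
        B x (y \<oplus>\<^bsub>W D\<^esub> z) = B x y + B x z) \<and>
     (\<forall>c. \<forall>x\<in>carrier (W D'). \<forall>z\<in>carrier (W D). B x (scalar D c \<otimes>\<^bsub>W D\<^esub> z) = c * B x z)"

end

theory Submission
  imports Defs
begin

text \<open>
  The form \<open>e\<^sub>z(v) = - dv dz / (v - z)\<^sup>2\<close> is symmetric in \<open>z\<close> and \<open>v\<close>, and the whole statement is a
  consequence of this symmetry. Let \<open>b\<^sub>z\<^sub>,\<^sub>n\<close> be the \<open>n\<close>-th derivative of \<open>e\<^sub>z\<close> in \<open>z\<close>, taken in the chart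
  centred at \<open>z\<close>. It has a single pole, at \<open>z\<close> and of order \<open>n + 2\<close>, and by partial fractions the
  \<open>b\<^sub>z\<^sub>,\<^sub>n\<close> with \<open>z \<in> D\<close> span the forms without residues and with poles in \<open>D\<close> (\<open>partial_fractions\<close>).

  At a point \<open>z\<close>, the iterated Lie derivative \<open>L\<^sub>X\<^sup>N\<close> of a section is a combination of its derivatives
  of order at most \<open>N\<close> in the chart, with coefficients that depend on \<open>X\<close>, \<open>z\<close> and \<open>N\<close> only (\<open>lie_iter_jets\<close>), and
  for the field \<open>\<partial>\<^sub>t\<close> of the chart it is the \<open>N\<close>-th derivative. So the pairing of a form \<open>\<alpha>'\<close> with
  \<open>b\<^sub>z\<^sub>,\<^sub>n\<close> has to be the \<open>n\<close>-th derivative of \<open>\<alpha>'\<close> at \<open>z\<close>. This prescription respects the linear relations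
  among the \<open>b\<^sub>z\<^sub>,\<^sub>n\<close>: the form \<open>\<alpha>'\<close> is itself a combination of forms \<open>b\<^sub>w\<^sub>,\<^sub>m\<close> with \<open>w \<in> D'\<close>, and the
  \<open>n\<close>-th derivative of \<open>b\<^sub>w\<^sub>,\<^sub>m\<close> at \<open>z\<close> is a mixed derivative of the kernel, hence equal to the \<open>m\<close>-th
  derivative of \<open>b\<^sub>z\<^sub>,\<^sub>n\<close> at \<open>w\<close> (\<open>jet_bform_sym\<close>). Summation gives \<open>form_rep_symmetry\<close>, which is both the
  well-definedness and the symmetry of the pairing of forms.

  To pass to symmetric algebras, let a form \<open>\<alpha>'\<close> with poles in \<open>D'\<close> act on \<open>\<^sub>D\<^bold>W\<close> as the derivation
  \<open>\<alpha> \<mapsto> \<langle>\<alpha>', \<alpha>\<rangle>\<close>. These derivations commute, so \<open>\<^sub>D\<^sub>'\<^bold>W\<close> acts on \<open>\<^sub>D\<^bold>W\<close>, and \<open>\<langle>\<psi>', \<psi>\<rangle>\<close> is the constant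
  coefficient of \<open>\<psi>'\<close> acting on \<open>\<psi>\<close>. Multiplication by a form is adjoint to the derivation that the
  form defines on the other side (\<open>poly_pair_gen_mult\<close>, \<open>poly_pair_gen_mult'\<close>); for \<open>e\<^sub>z\<close> this
  derivation is \<open>- i'(z)\<close>, which is (i) and (ii). In (iii) every term is, up to sign, a finite sum
  \<open>\<Sum> k\<^sub>v (L\<^sub>X\<^sup>N v)(z)\<close> over the forms \<open>v\<close> that occur in one of the two arguments (\<open>lie_chain\<close>).

  The Lie derivatives of operators are defined by values, and identifying them requires that an element of
  a symmetric algebra is zero if all its iterated values vanish (\<open>separation\<close>); this is seen in a basis
  that is dual to finitely many of the values.

  For uniqueness, (iii) with the fields \<open>\<partial>\<^sub>t\<close> moves any factor \<open>b\<^sub>z\<^sub>,\<^sub>n\<close> of an argument to the other side,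
  where it lowers the degree; since these factors span, the value at the two vacua determines everything.
\<close>

section \<open>The polynomial algebra on a set\<close>

text \<open>
  Polynomials in the variables \<open>v :: 'v\<close>; those in the variables from \<open>U\<close> form the carrier of \<open>poly_alg U\<close>.
\<close>

type_synonym 'v pol = "'v multiset \<Rightarrow>\<^sub>0 complex"

abbreviation polys :: "'v set \<Rightarrow> 'v pol set" where
  "polys U \<equiv> carrier (poly_alg U)"

lemma polys_iff: "p \<in> polys U \<longleftrightarrow> (\<forall>m\<in>Poly_Mapping.keys p. set_mset m \<subseteq> U)"
  by (simp add: poly_alg_def)

lemma polys_single [simp]: "set_mset m \<subseteq> U \<Longrightarrow> Poly_Mapping.single m c \<in> polys U"
  by (simp add: polys_iff)

lemma polys_const [simp]: "const c \<in> polys U"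
  by (simp add: const_def)

lemma polys_gen [simp]: "v \<in> U \<Longrightarrow> gen v \<in> polys U"
  by (simp add: gen_def)

lemma polys_zero [simp]: "0 \<in> polys U"
  by (simp add: polys_iff)

lemma polys_one [simp]: "1 \<in> polys U"
  by (simp add: polys_iff)

lemma polys_add [simp]: "p \<in> polys U \<Longrightarrow> q \<in> polys U \<Longrightarrow> p + q \<in> polys U"
  using keys_add[of p q] by (auto simp: polys_iff)

lemma polys_uminus [simp]: "p \<in> polys U \<Longrightarrow> - p \<in> polys U"
  by (simp add: polys_iff in_keys_iff)

lemma polys_diff [simp]: "p \<in> polys U \<Longrightarrow> q \<in> polys U \<Longrightarrow> p - q \<in> polys U"
  using polys_add[of p U "- q"] by simp

lemma polys_mult [simp]: "p \<in> polys U \<Longrightarrow> q \<in> polys U \<Longrightarrow> p * q \<in> polys U"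
  using keys_mult[of p q] by (fastforce simp: polys_iff)

lemma polys_sum [simp]: "(\<And>i. i \<in> A \<Longrightarrow> f i \<in> polys U) \<Longrightarrow> (\<Sum>i\<in>A. f i) \<in> polys U"
  by (induction A rule: infinite_finite_induct) auto

lemma poly_alg_simps [simp]:
  "mult (poly_alg U) = (*)" "one (poly_alg U) = 1" "zero (poly_alg U) = 0" "add (poly_alg U) = (+)"
  by (simp_all add: poly_alg_def)

lemma poly_alg_cring: "cring (poly_alg U)"
proof (rule cringI)
  show "abelian_group (poly_alg U)"
    by (rule abelian_groupI) (auto simp: algebra_simps intro: bexI[of _ "- _"] polys_uminus)
  show "Group.comm_monoid (poly_alg U)"
    by (rule comm_monoidI) (auto simp: algebra_simps)
qed (auto simp: algebra_simps)

lemma const_add: "const (a + b) = const a + const b"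
  by (simp add: const_def single_add)

lemma const_mult: "const (a * b) = const a * const b"
  by (simp add: const_def mult_single)

lemma const_0 [simp]: "const 0 = 0" and const_1 [simp]: "const 1 = 1"
  by (simp_all add: const_def flip: zero_multiset_def)

lemma const_uminus: "const (- a) = - const a"
  by (simp add: const_def single_uminus)

lemma const_sum: "const (\<Sum>i\<in>A. f i) = (\<Sum>i\<in>A. const (f i))"
  by (induction A rule: infinite_finite_induct) (auto simp: const_add)

lemma const_mult_single: "const a * Poly_Mapping.single m b = Poly_Mapping.single m (a * b)"
  by (simp add: const_def mult_single)

lemma single_add_mset: "Poly_Mapping.single (add_mset v m) c = gen v * Poly_Mapping.single m c"
  by (simp add: gen_def mult_single)

lemma pol_eq_sum_single: "p = (\<Sum>m\<in>Poly_Mapping.keys p. Poly_Mapping.single m (Poly_Mapping.lookup p m))"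
  by (rule poly_mapping_eqI) (simp add: lookup_sum lookup_single when_def in_keys_iff)

lemma polys_induct [consumes 1, case_names const gen add]:
  assumes "p \<in> polys U"
    and const: "\<And>c. Q (const c)"
    and gen: "\<And>v p. v \<in> U \<Longrightarrow> p \<in> polys U \<Longrightarrow> Q p \<Longrightarrow> Q (gen v * p)"
    and add: "\<And>p q. p \<in> polys U \<Longrightarrow> q \<in> polys U \<Longrightarrow> Q p \<Longrightarrow> Q q \<Longrightarrow> Q (p + q)"
  shows "Q p"
proof -
  have single: "Q (Poly_Mapping.single m c)" if "set_mset m \<subseteq> U" for m c
    using that
  proof (induction m)
    case empty
    then show ?case using const[of c] by (simp add: const_def)
  next
    case (add v m)
    then show ?case by (auto simp: single_add_mset intro!: gen)
  qed
  have "Q (\<Sum>m\<in>A. Poly_Mapping.single m (Poly_Mapping.lookup p m))" if "A \<subseteq> Poly_Mapping.keys p" for A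
    using finite_subset[OF that finite_keys] that
  proof (induction A rule: finite_induct)
    case empty
    then show ?case using const[of 0] by simp
  next
    case (insert m A)
    then show ?case
      using assms(1) by (auto simp: polys_iff intro!: add single polys_sum)
  qed
  from this[of "Poly_Mapping.keys p"] show ?thesis
    by (simp flip: pol_eq_sum_single)
qed

section \<open>The constant coefficient\<close>

definition ccoeff :: "'v pol \<Rightarrow> complex" where
  "ccoeff p = Poly_Mapping.lookup p {#}"

lemma ccoeff_add: "ccoeff (p + q) = ccoeff p + ccoeff q"
  by (simp add: ccoeff_def lookup_add)

lemma ccoeff_diff: "ccoeff (p - q) = ccoeff p - ccoeff q"
  by (simp add: ccoeff_def lookup_minus)

lemma ccoeff_0 [simp]: "ccoeff 0 = 0" and ccoeff_1 [simp]: "ccoeff 1 = 1"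
  by (simp_all add: ccoeff_def lookup_one)

lemma ccoeff_const [simp]: "ccoeff (const c) = c"
  by (simp add: ccoeff_def const_def)

lemma ccoeff_gen [simp]: "ccoeff (gen v) = 0"
  by (simp add: ccoeff_def gen_def lookup_single)

lemma ccoeff_sum: "ccoeff (\<Sum>i\<in>A. f i) = (\<Sum>i\<in>A. ccoeff (f i))"
  by (simp add: ccoeff_def lookup_sum)

lemma ccoeff_mult: "ccoeff (p * q) = ccoeff p * ccoeff q"
proof -
  have single: "ccoeff (Poly_Mapping.single m c * q) = ccoeff (Poly_Mapping.single m c) * ccoeff q" for m c
  proof -
    have "ccoeff (Poly_Mapping.single m c * (\<Sum>n\<in>A. Poly_Mapping.single n (f n)))
        = ccoeff (Poly_Mapping.single m c) * ccoeff (\<Sum>n\<in>A. Poly_Mapping.single n (f n))" for A f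
      by (auto simp: sum_distrib_left lookup_sum mult_single ccoeff_def lookup_single when_def
               intro!: sum.cong)
    from this[of "Poly_Mapping.lookup q" "Poly_Mapping.keys q"] show ?thesis
      by (simp flip: pol_eq_sum_single)
  qed
  have "ccoeff ((\<Sum>m\<in>A. Poly_Mapping.single m (f m)) * q)
      = ccoeff (\<Sum>m\<in>A. Poly_Mapping.single m (f m)) * ccoeff q" for A f
    by (simp add: sum_distrib_right ccoeff_sum single)
  from this[of "Poly_Mapping.lookup p" "Poly_Mapping.keys p"] show ?thesis
    by (simp flip: pol_eq_sum_single)
qed

section \<open>Derivations of the polynomial algebra\<close>

text \<open>
  The linear map that sends the monomial \<open>m\<close> to \<open>F m\<close>.
\<close>

definition lin_ext :: "('k \<Rightarrow> 'v pol) \<Rightarrow> ('k \<Rightarrow>\<^sub>0 complex) \<Rightarrow> 'v pol" where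
  "lin_ext F p = (\<Sum>m\<in>Poly_Mapping.keys p. const (Poly_Mapping.lookup p m) * F m)"

lemma lin_ext_add: "lin_ext F (p + q) = lin_ext F p + lin_ext F q"
  unfolding lin_ext_def
  by (rule setsum_keys_plus_distrib) (simp_all add: const_add algebra_simps)

lemma lin_ext_single: "lin_ext F (Poly_Mapping.single m c) = const c * F m"
  by (simp add: lin_ext_def)

lemma lin_ext_0 [simp]: "lin_ext F 0 = 0"
  by (simp add: lin_ext_def)

lemma lin_ext_sum: "lin_ext F (\<Sum>i\<in>A. f i) = (\<Sum>i\<in>A. lin_ext F (f i))"
  by (induction A rule: infinite_finite_induct) (auto simp: lin_ext_add)

text \<open>
  The derivation with \<open>v \<mapsto> l v\<close>; \<open>l\<close> is an arbitrary function on the variables, not required to respect any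
  linear relation among them.
\<close>

definition der :: "('v \<Rightarrow> complex) \<Rightarrow> 'v pol \<Rightarrow> 'v pol" where
  "der l = lin_ext (\<lambda>m. \<Sum>v\<in>#m. Poly_Mapping.single (m - {#v#}) (l v))"

lemma der_add: "der l (p + q) = der l p + der l q"
  by (simp add: der_def lin_ext_add)

lemma der_0 [simp]: "der l 0 = 0"
  by (simp add: der_def)

lemma der_uminus: "der l (- p) = - der l p"
  using der_add[of l p "- p"] by (simp add: eq_neg_iff_add_eq_0 add.commute)

lemma der_diff: "der l (p - q) = der l p - der l q"
  using der_add[of l p "- q"] by (simp add: der_uminus)

lemma der_sum: "der l (\<Sum>i\<in>A. f i) = (\<Sum>i\<in>A. der l (f i))"
  by (simp add: der_def lin_ext_sum)

lemma der_const [simp]: "der l (const c) = 0"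
  by (simp add: der_def const_def lin_ext_single)

lemma der_1 [simp]: "der l 1 = 0"
  using der_const[of l 1] by simp

lemma der_gen [simp]: "der l (gen v) = const (l v)"
  by (simp add: der_def gen_def lin_ext_single const_def)

lemma der_single: "der l (Poly_Mapping.single m c) = (\<Sum>v\<in>#m. Poly_Mapping.single (m - {#v#}) (c * l v))"
  by (simp add: der_def lin_ext_single sum_mset_distrib_left const_mult_single image_mset.compositionality comp_def)

lemma der_single_mult:
  "der l (Poly_Mapping.single m a * Poly_Mapping.single n b) =
   der l (Poly_Mapping.single m a) * Poly_Mapping.single n b +
   Poly_Mapping.single m a * der l (Poly_Mapping.single n b)"
proof -
  have 1: "(\<Sum>v\<in>#m. Poly_Mapping.single (m + n - {#v#}) (a * b * l v))
      = (\<Sum>v\<in>#m. Poly_Mapping.single (m - {#v#}) (a * l v)) * Poly_Mapping.single n b"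
    unfolding sum_mset_distrib_right
  proof (intro arg_cong[of _ _ sum_mset] image_mset_cong)
    fix v assume "v \<in># m"
    then obtain A where A: "m = add_mset v A" by (blast dest: multi_member_split)
    have ab: "a * b * l v = a * l v * b" by (simp only: mult_ac)
    show "Poly_Mapping.single (m + n - {#v#}) (a * b * l v)
        = Poly_Mapping.single (m - {#v#}) (a * l v) * Poly_Mapping.single n b"
      unfolding mult_single A ab by simp
  qed
  have 2: "(\<Sum>v\<in>#n. Poly_Mapping.single (m + n - {#v#}) (a * b * l v))
      = Poly_Mapping.single m a * (\<Sum>v\<in>#n. Poly_Mapping.single (n - {#v#}) (b * l v))"
    unfolding sum_mset_distrib_left
  proof (intro arg_cong[of _ _ sum_mset] image_mset_cong)
    fix v assume "v \<in># n"
    then obtain A where A: "n = add_mset v A" by (blast dest: multi_member_split)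
    show "Poly_Mapping.single (m + n - {#v#}) (a * b * l v)
        = Poly_Mapping.single m a * Poly_Mapping.single (n - {#v#}) (b * l v)"
      unfolding mult_single A mult.assoc by simp
  qed
  have "der l (Poly_Mapping.single (m + n) (a * b)) = der l (Poly_Mapping.single m a) * Poly_Mapping.single n b +
      Poly_Mapping.single m a * der l (Poly_Mapping.single n b)"
    unfolding der_single image_mset_union sum_mset.union 1 2 ..
  then show ?thesis
    by (simp only: mult_single)
qed

lemma der_mult: "der l (p * q) = der l p * q + p * der l q"
proof -
  have "der l ((\<Sum>m\<in>A. Poly_Mapping.single m (f m)) * (\<Sum>n\<in>B. Poly_Mapping.single n (g n))) =
    der l (\<Sum>m\<in>A. Poly_Mapping.single m (f m)) * (\<Sum>n\<in>B. Poly_Mapping.single n (g n)) +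
    (\<Sum>m\<in>A. Poly_Mapping.single m (f m)) * der l (\<Sum>n\<in>B. Poly_Mapping.single n (g n))" for A B f g
    by (simp add: sum_product der_sum der_single_mult sum.distrib)
  from this[of "Poly_Mapping.lookup p" "Poly_Mapping.keys p" "Poly_Mapping.lookup q" "Poly_Mapping.keys q"]
  show ?thesis by (simp flip: pol_eq_sum_single)
qed

lemma der_const_mult: "der l (const c * p) = const c * der l p"
  by (simp add: der_mult)

lemma der_polys [simp]: "p \<in> polys U \<Longrightarrow> der l p \<in> polys U"
  by (induction rule: polys_induct) (simp_all add: der_mult der_add)

lemma polys_UNIV [simp]: "p \<in> polys UNIV"
  by (simp add: polys_iff)

lemma der_commute: "der k (der l p) = der l (der k p)"
proof -
  have "p \<in> polys UNIV" by simp
  then show ?thesis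
    by (induction rule: polys_induct) (simp_all add: der_mult der_add algebra_simps)
qed

lemma der_cong:
  assumes "p \<in> polys U" "\<And>v. v \<in> U \<Longrightarrow> k v = l v"
  shows "der k p = der l p"
  using assms by (induction rule: polys_induct) (simp_all add: der_mult der_add)

lemma der_lin_comb:
  assumes "p \<in> polys U" "\<And>v. v \<in> U \<Longrightarrow> l v = (\<Sum>i\<in>A. c i * k i v)"
  shows "der l p = (\<Sum>i\<in>A. const (c i) * der (k i) p)"
  using assms
  by (induction rule: polys_induct)
    (simp_all add: der_mult der_add const_sum const_mult sum.distrib sum_distrib_left algebra_simps)

text \<open>
  A derivation depends linearly on the finitely many values of the functional on the generators that
  occur.
\<close>

lemma der_expand:
  assumes "p \<in> polys U"
  obtains S where "finite S" "S \<subseteq> U"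
    "\<And>l. der l p = (\<Sum>v\<in>S. const (l v) * der (\<lambda>w. if w = v then 1 else 0) p)"
proof -
  \<comment> \<open>the variables that occur in \<open>p\<close>\<close>
  define S where "S = (\<Union>m\<in>Poly_Mapping.keys p. set_mset m)"
  have S: "finite S" "S \<subseteq> U" "p \<in> polys S"
    using assms by (auto simp: S_def polys_iff)
  show thesis
    by (rule that[OF S(1,2)], rule der_lin_comb[OF S(3)])
       (use S(1) in \<open>simp add: if_distrib[of "\<lambda>x. _ * x"] cong: if_cong\<close>)
qed

text \<open>
  The composition of the derivations given by a list of functions.
\<close>

fun ders :: "('v \<Rightarrow> complex) list \<Rightarrow> 'v pol \<Rightarrow> 'v pol" where
  "ders [] p = p" |
  "ders (l # ls) p = der l (ders ls p)"

lemma ders_add: "ders ls (p + q) = ders ls p + ders ls q"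
  by (induction ls) (simp_all add: der_add)

lemma ders_0 [simp]: "ders ls 0 = 0"
  by (induction ls) simp_all

lemma ders_diff: "ders ls (p - q) = ders ls p - ders ls q"
  by (induction ls) (simp_all add: der_diff)

lemma ders_const_mult: "ders ls (const c * p) = const c * ders ls p"
  by (induction ls) (simp_all add: der_const_mult)

lemma ders_sum: "ders ls (\<Sum>i\<in>A. f i) = (\<Sum>i\<in>A. ders ls (f i))"
  by (induction A rule: infinite_finite_induct) (simp_all add: ders_add)

lemma ders_polys [simp]: "p \<in> polys U \<Longrightarrow> ders ls p \<in> polys U"
  by (induction ls) simp_all

lemma ders_append: "ders (ks @ ls) p = ders ks (ders ls p)"
  by (induction ks) simp_all

text \<open>The values of \<open>gen v * p\<close> depend linearly on the values of \<open>v\<close>.\<close>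

lemma ders_gen_mult:
  obtains q where "\<And>v. ders ls (gen v * p) = gen v * ders ls p + (\<Sum>i<length ls. const ((ls ! i) v) * q i)"
proof (induction ls arbitrary: thesis)
  case Nil
  show ?case by (rule Nil[of "\<lambda>_. 0"]) simp
next
  case (Cons l ls)
  obtain q where q: "\<And>v. ders ls (gen v * p) = gen v * ders ls p + (\<Sum>i<length ls. const ((ls ! i) v) * q i)"
    using Cons.IH by blast
  show ?case
    by (rule Cons.prems[of "\<lambda>i. case i of 0 \<Rightarrow> ders ls p | Suc j \<Rightarrow> der l (q j)"])
      (simp add: q der_add der_mult der_sum sum.lessThan_Suc_shift del: sum.lessThan_Suc)
qed

section \<open>The ideal of linear relations\<close>

text \<open>
  A set \<open>U\<close> closed under an addition and a scalar multiplication. The vector space axioms are not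
  required: they hold automatically modulo the ideal \<open>I\<close> of linear relations.
\<close>

locale sym_base =
  fixes U :: "'v set" and ad :: "'v \<Rightarrow> 'v \<Rightarrow> 'v" and sc :: "complex \<Rightarrow> 'v \<Rightarrow> 'v"
  assumes ad_closed: "v \<in> U \<Longrightarrow> w \<in> U \<Longrightarrow> ad v w \<in> U"
    and sc_closed: "v \<in> U \<Longrightarrow> sc c v \<in> U"
begin

abbreviation "I \<equiv> sym_ideal ad sc U"

text \<open>
  Functions on \<open>U\<close> that respect the linear relations; their derivations preserve the ideal.
\<close>

definition functional :: "('v \<Rightarrow> complex) \<Rightarrow> bool" where
  "functional l \<longleftrightarrow> (\<forall>v\<in>U. \<forall>w\<in>U. l (ad v w) = l v + l w) \<and> (\<forall>c. \<forall>v\<in>U. l (sc c v) = c * l v)"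

lemma lin_rels_subset: "lin_rels ad sc U \<subseteq> polys U"
  by (auto simp: lin_rels_def ad_closed sc_closed)

lemma ideal_I: "ideal I (poly_alg U)"
  unfolding sym_ideal_def
  by (rule ring.genideal_ideal[OF cring.axioms(1)[OF poly_alg_cring] lin_rels_subset])

lemma lin_rels_I: "lin_rels ad sc U \<subseteq> I"
  unfolding sym_ideal_def
  by (rule ring.genideal_self[OF cring.axioms(1)[OF poly_alg_cring] lin_rels_subset])

lemma I_ad: "v \<in> U \<Longrightarrow> w \<in> U \<Longrightarrow> gen (ad v w) - gen v - gen w \<in> I"
  and I_sc: "v \<in> U \<Longrightarrow> gen (sc c v) - const c * gen v \<in> I"
  using lin_rels_I unfolding lin_rels_def by blast+

lemma I_polys: "p \<in> I \<Longrightarrow> p \<in> polys U"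
  by (rule ideal.Icarr[OF ideal_I])

lemma I_zero [simp]: "0 \<in> I"
  using additive_subgroup.zero_closed[OF ideal.axioms(1)[OF ideal_I]] by simp

lemma I_add: "p \<in> I \<Longrightarrow> q \<in> I \<Longrightarrow> p + q \<in> I"
  using additive_subgroup.a_closed[OF ideal.axioms(1)[OF ideal_I]] by simp

lemma I_mult: "p \<in> I \<Longrightarrow> q \<in> polys U \<Longrightarrow> q * p \<in> I"
  using ideal.I_l_closed[OF ideal_I] by simp

lemma I_uminus: "p \<in> I \<Longrightarrow> - p \<in> I"
  using I_mult[of p "const (- 1)"] by (simp add: const_uminus)

lemma I_diff: "p \<in> I \<Longrightarrow> q \<in> I \<Longrightarrow> p - q \<in> I"
  using I_add[of p "- q"] I_uminus[of q] by simp

text \<open>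
  The induction principle which says that \<open>I\<close> is the smallest ideal that contains the linear relations.
\<close>

lemma I_induct [consumes 1, case_names zero ad sc add mult]:
  assumes "p \<in> I"
    and zero: "Q 0"
    and "\<And>v w. v \<in> U \<Longrightarrow> w \<in> U \<Longrightarrow> Q (gen (ad v w) - gen v - gen w)"
    and "\<And>c v. v \<in> U \<Longrightarrow> Q (gen (sc c v) - const c * gen v)"
    and add: "\<And>p q. p \<in> I \<Longrightarrow> q \<in> I \<Longrightarrow> Q p \<Longrightarrow> Q q \<Longrightarrow> Q (p + q)"
    and mult: "\<And>p q. p \<in> I \<Longrightarrow> q \<in> polys U \<Longrightarrow> Q p \<Longrightarrow> Q (q * p)"
  shows "Q p"
proof -
  let ?J = "{p \<in> I. Q p}"
  have sub: "lin_rels ad sc U \<subseteq> ?J"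
    using assms(3,4) by (auto simp: lin_rels_def I_ad I_sc)
  have J_mult: "x * a \<in> ?J \<and> a * x \<in> ?J" if "a \<in> ?J" "x \<in> polys U" for a x
    using that I_mult[of a x] mult[of a x] by (simp add: mult.commute)
  have "ideal ?J (poly_alg U)"
    proof (rule idealI)
      show "ring (poly_alg U)" by (rule cring.axioms(1)[OF poly_alg_cring])
      show "subgroup ?J (add_monoid (poly_alg U))"
      proof (rule group.subgroupI)
        show "Group.group (add_monoid (poly_alg U))"
          using abelian_group.a_group[OF ring.is_abelian_group[OF cring.axioms(1)[OF poly_alg_cring]]] .
        show "?J \<noteq> {}" using zero I_zero by blast
        fix a assume a: "a \<in> ?J"
        have "a + (- a) = 0" "- a \<in> ?J" using a mult[of a "const (- 1)"]
          by (auto simp: const_uminus I_uminus)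
        moreover have "inv\<^bsub>add_monoid (poly_alg U)\<^esub> a = - a"
          using group.inv_equality[OF \<open>Group.group (add_monoid (poly_alg U))\<close>, of "- a" a] a
          by (simp add: I_polys)
        ultimately show "inv\<^bsub>add_monoid (poly_alg U)\<^esub> a \<in> ?J" by simp
      qed (auto simp: I_add add I_polys)
    qed (use J_mult in auto)
    then have "I \<subseteq> ?J"
      unfolding sym_ideal_def[of ad sc U]
      by (intro ring.genideal_minimal[OF cring.axioms(1)[OF poly_alg_cring]])
         (use sub in \<open>auto simp: sym_ideal_def\<close>)
    then show ?thesis using assms(1) by blast
qed

lemma I_der:
  assumes "functional l" "p \<in> I"
  shows "der l p \<in> I"
  using assms(2)
proof (induction rule: I_induct)
  case (mult p q)
  then show ?case
    using I_add[OF I_mult[of p "der l q"] I_mult[of "der l p" q]] by (simp add: der_mult)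
qed (use assms(1) in \<open>simp_all add: functional_def der_diff der_add der_const_mult const_add const_mult I_add der_mult\<close>)

lemma I_ders: "(\<And>l. l \<in> set ls \<Longrightarrow> functional l) \<Longrightarrow> p \<in> I \<Longrightarrow> ders ls p \<in> I"
  by (induction ls) (auto simp: I_der)

lemma I_ccoeff: "p \<in> I \<Longrightarrow> ccoeff p = 0"
  by (induction rule: I_induct) (simp_all add: ccoeff_diff ccoeff_mult ccoeff_add)

end

section \<open>Congruence modulo the linear relations\<close>

lemma der_fun_add: "der (\<lambda>v. k v + l v) p = der k p + der l p"
proof -
  have "p \<in> polys UNIV" by simp
  then show ?thesis
    by (induction rule: polys_induct) (simp_all add: der_mult der_add const_add algebra_simps)
qed

lemma der_fun_scale: "der (\<lambda>v. c * l v) p = const c * der l p"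
proof -
  have "p \<in> polys UNIV" by simp
  then show ?thesis
    by (induction rule: polys_induct) (simp_all add: der_mult der_add const_mult algebra_simps)
qed

context sym_base
begin

text \<open>
  Congruence of two elements of the polynomial algebra modulo the ideal of linear relations.
\<close>

definition eqv :: "'v pol \<Rightarrow> 'v pol \<Rightarrow> bool" where
  "eqv p q \<longleftrightarrow> p \<in> polys U \<and> q \<in> polys U \<and> p - q \<in> I"

lemma eqv_refl [simp]: "p \<in> polys U \<Longrightarrow> eqv p p"
  by (simp add: eqv_def)

lemma eqv_sym: "eqv p q \<Longrightarrow> eqv q p"
  using I_uminus[of "p - q"] by (auto simp: eqv_def)

lemma eqv_trans [trans]: "eqv p q \<Longrightarrow> eqv q r \<Longrightarrow> eqv p r"
  using I_add[of "p - q" "q - r"] by (auto simp: eqv_def)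

lemma eqv_add: "eqv p q \<Longrightarrow> eqv p' q' \<Longrightarrow> eqv (p + p') (q + q')"
  using I_add[of "p - q" "p' - q'"] by (auto simp: eqv_def algebra_simps)

lemma eqv_mult:
  assumes "eqv p q" "eqv p' q'"
  shows "eqv (p * p') (q * q')"
proof -
  have "p' * (p - q) + q * (p' - q') \<in> I"
    using assms by (intro I_add I_mult) (auto simp: eqv_def)
  then show ?thesis
    using assms by (auto simp: eqv_def algebra_simps)
qed

lemma eqv_sum: "(\<And>i. i \<in> A \<Longrightarrow> eqv (f i) (g i)) \<Longrightarrow> eqv (\<Sum>i\<in>A. f i) (\<Sum>i\<in>A. g i)"
  by (induction A rule: infinite_finite_induct) (auto simp: eqv_add)

lemma eqv_const_mult: "eqv p q \<Longrightarrow> eqv (const c * p) (const c * q)"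
  by (rule eqv_mult) simp_all

lemma eqv_functional:
  assumes "functional l" "eqv p q"
  shows "ccoeff (der l p) = ccoeff (der l q)"
  using I_ccoeff[OF I_der[OF assms(1), of "p - q"]] assms(2)
  by (simp add: eqv_def der_diff ccoeff_diff)

lemma eqv_sc: "v \<in> U \<Longrightarrow> eqv (gen (sc c v)) (const c * gen v)"
  by (simp add: eqv_def I_sc sc_closed)

text \<open>
  Linear combinations of generators are congruent to a single generator.
\<close>

lemma gen_lin_comb:
  assumes "finite A" "v \<in> U" "\<And>x. x \<in> A \<Longrightarrow> b x \<in> U"
  obtains r where "r \<in> U" "eqv (gen r) (gen v - (\<Sum>x\<in>A. const (c x) * gen (b x)))"
  using assms
proof (induction A arbitrary: thesis rule: finite_induct)
  case empty
  show ?case by (rule empty(1)[of v]) (use empty in simp_all)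
next
  case (insert x A)
  obtain r where r: "r \<in> U" "eqv (gen r) (gen v - (\<Sum>x\<in>A. const (c x) * gen (b x)))"
    using insert by blast
  have b: "b x \<in> U" using insert by blast
  let ?s = "sc (- c x) (b x)"
  have "eqv (gen (ad r ?s)) (gen r + gen ?s)"
    using I_ad[OF r(1) sc_closed[OF b, of "- c x"]] r(1) b
    by (simp add: eqv_def ad_closed sc_closed algebra_simps)
  also have "eqv \<dots> (gen v - (\<Sum>x\<in>A. const (c x) * gen (b x)) + const (- c x) * gen (b x))"
    by (intro eqv_add r eqv_sc b)
  also have "\<dots> = gen v - (\<Sum>x\<in>insert x A. const (c x) * gen (b x))"
    using insert.hyps by (simp add: algebra_simps const_uminus)
  finally show ?case
    by (intro insert.prems(1)[of "ad r ?s"] ad_closed sc_closed r b)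
qed

end

section \<open>Separation by functionals\<close>

lemma sum_mset_single_value:
  "(\<And>v. v \<in># M \<Longrightarrow> v \<noteq> b \<Longrightarrow> f v = 0) \<Longrightarrow> (\<Sum>v\<in>#M. f v) = of_nat (count M b) * (f b :: complex)"
  by (induction M) (auto simp: algebra_simps)

lemma lookup_sum_mset:
  "Poly_Mapping.lookup (\<Sum>v\<in>#M. f v) m = (\<Sum>v\<in>#M. Poly_Mapping.lookup (f v) m)"
  by (induction M) (auto simp: lookup_add)

text \<open>
  If \<open>l\<close> is the coordinate of \<open>b\<close> among the variables \<open>B\<close>, then \<open>der l\<close> is \<open>\<partial>/\<partial>b\<close> on polynomials in \<open>B\<close>.
\<close>

lemma lookup_der:
  assumes "p \<in> polys B" "l b = 1" "\<And>v. v \<in> B \<Longrightarrow> v \<noteq> b \<Longrightarrow> l v = 0"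
  shows "Poly_Mapping.lookup (der l p) m = of_nat (Suc (count m b)) * Poly_Mapping.lookup p (add_mset b m)"
proof -
  have single: "Poly_Mapping.lookup (der l (Poly_Mapping.single n c)) m
      = (if n = add_mset b m then of_nat (Suc (count m b)) * c else 0)" if "set_mset n \<subseteq> B" for n c
  proof -
    have "Poly_Mapping.lookup (der l (Poly_Mapping.single n c)) m
        = (\<Sum>v\<in>#n. Poly_Mapping.lookup (Poly_Mapping.single (n - {#v#}) (c * l v)) m)"
      by (simp add: der_single lookup_sum_mset)
    also have "\<dots> = of_nat (count n b) * Poly_Mapping.lookup (Poly_Mapping.single (n - {#b#}) (c * l b)) m"
      by (rule sum_mset_single_value) (use assms(3) that in auto)
    also have "\<dots> = (if n = add_mset b m then of_nat (Suc (count m b)) * c else 0)"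
    proof (cases "b \<in># n")
      case True
      then obtain n' where "n = add_mset b n'" by (blast dest: multi_member_split)
      then show ?thesis using assms(2) by (auto simp: lookup_single when_def)
    next
      case False
      then show ?thesis by (auto simp: not_in_iff)
    qed
    finally show ?thesis .
  qed
  let ?K = "Poly_Mapping.keys p" and ?c = "Poly_Mapping.lookup p"
  have "Poly_Mapping.lookup (der l p) m
      = Poly_Mapping.lookup (der l (\<Sum>n\<in>?K. Poly_Mapping.single n (?c n))) m"
    by (simp flip: pol_eq_sum_single)
  also have "\<dots> = (\<Sum>n\<in>?K. if n = add_mset b m then of_nat (Suc (count m b)) * ?c n else 0)"
    unfolding der_sum lookup_sum
    by (intro sum.cong single refl) (use assms(1) in \<open>auto simp: polys_iff\<close>)
  also have "\<dots> = of_nat (Suc (count m b)) * ?c (add_mset b m)"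
    by (simp add: in_keys_iff)
  finally show ?thesis .
qed

text \<open>
  A set \<open>Z\<close> of linear functionals that separates the points of \<open>U\<close>. A vector
  \<open>v\<close> is zero if \<open>sc 0 v = v\<close>.
\<close>

locale sym_sep = sym_base +
  fixes Z :: "('a \<Rightarrow> complex) set"
  assumes Z_functional: "l \<in> Z \<Longrightarrow> functional l"
    and Z_separates: "v \<in> U \<Longrightarrow> (\<And>l. l \<in> Z \<Longrightarrow> l v = 0) \<Longrightarrow> sc 0 v = v"
begin

text \<open>
  A finite set \<open>S\<close> of vectors lies in the span of vectors \<open>b\<^sub>0, \<dots>, b\<^sub>k\<^sub>-\<^sub>1\<close> that are dual to functionals from
  \<open>Z\<close>. The induction over \<open>S\<close> is interpolation: the error of a new vector is either zero or detected by a
  further functional \<open>m\<close>, and then becomes, after scaling, the new vector \<open>b0\<close>.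
\<close>

lemma dual_family:
  assumes "finite S" "S \<subseteq> U"
  shows "\<exists>(k::nat) b l. (\<forall>i<k. b i \<in> U \<and> l i \<in> Z) \<and> (\<forall>i<k. \<forall>j<k. l i (b j) = (if i = j then 1 else 0)) \<and>
    (\<forall>v\<in>S. eqv (gen v) (\<Sum>i<k. const (l i v) * gen (b i)))"
  using assms
proof (induction S rule: finite_induct)
  case empty
  then show ?case by (intro exI[of _ 0]) auto
next
  case (insert v S)
  then have "\<exists>(k::nat) b l. (\<forall>i<k. b i \<in> U \<and> l i \<in> Z) \<and> (\<forall>i<k. \<forall>j<k. l i (b j) = (if i = j then 1 else 0)) \<and>
    (\<forall>v\<in>S. eqv (gen v) (\<Sum>i<k. const (l i v) * gen (b i)))" by simp
  then obtain k :: nat and b l where *: "(\<forall>i<k. b i \<in> U \<and> l i \<in> Z) \<and>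
      (\<forall>i<k. \<forall>j<k. l i (b j) = (if i = j then 1 else 0)) \<and>
      (\<forall>v\<in>S. eqv (gen v) (\<Sum>i<k. const (l i v) * gen (b i)))"
    by blast
  have bl: "b i \<in> U" "l i \<in> Z" if "i < k" for i
    using * that by blast+
  have dual: "l i (b j) = (if i = j then 1 else 0)" if "i < k" "j < k" for i j
    using * that by blast
  have S: "eqv (gen v) (\<Sum>i<k. const (l i v) * gen (b i))" if "v \<in> S" for v
    using * that by blast
  have v: "v \<in> U" using insert by simp
  obtain r where r: "r \<in> U" "eqv (gen r) (gen v - (\<Sum>i<k. const (l i v) * gen (b i)))"
    using gen_lin_comb[of "{..<k}" v b "\<lambda>i. l i v"] v bl by blast
  have val_r: "m r = m v - (\<Sum>i<k. l i v * m (b i))" if "m \<in> Z" for m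
    using eqv_functional[OF Z_functional[OF that] r(2)]
    by (simp add: der_diff der_sum der_const_mult ccoeff_diff ccoeff_sum ccoeff_mult)
  show ?case
  proof (cases "\<forall>m\<in>Z. m r = 0")
    case True
    then have "sc 0 r = r" using Z_separates r by blast
    then have r0: "eqv (gen r) 0" using eqv_sc[OF r(1), of 0] by simp
    have "eqv (gen v - (\<Sum>i<k. const (l i v) * gen (b i))) 0"
      using eqv_trans[OF eqv_sym[OF r(2)] r0] .
    then have "eqv (gen v) (\<Sum>i<k. const (l i v) * gen (b i))"
      using v bl by (auto simp: eqv_def intro!: polys_sum)
    then show ?thesis
      using bl dual S by (intro exI[of _ k] exI[of _ b] exI[of _ l]) auto
  next
    case False
    then obtain m where m: "m \<in> Z" "m r \<noteq> 0" by blast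
    define b0 where "b0 = sc (1 / m r) r"
    have b0: "b0 \<in> U" "eqv (gen b0) (const (1 / m r) * gen r)"
      using r by (simp_all add: b0_def sc_closed eqv_sc)
    have val_b0: "n b0 = n r / m r" if "n \<in> Z" for n
      using eqv_functional[OF Z_functional[OF that] b0(2)] by (simp add: der_const_mult ccoeff_mult)
    have "\<forall>i. \<exists>y. i < k \<longrightarrow> y \<in> U \<and> eqv (gen y) (gen (b i) - const (m (b i)) * gen b0)"
    proof
      fix i
      show "\<exists>y. i < k \<longrightarrow> y \<in> U \<and> eqv (gen y) (gen (b i) - const (m (b i)) * gen b0)"
      proof (cases "i < k")
        case True
        show ?thesis
          by (rule gen_lin_comb[of "{()}" "b i" "\<lambda>_. b0" "\<lambda>_. m (b i)"]) (use True bl b0 in auto)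
      qed simp
    qed
    then obtain c where c: "\<And>i. i < k \<Longrightarrow> c i \<in> U"
      "\<And>i. i < k \<Longrightarrow> eqv (gen (c i)) (gen (b i) - const (m (b i)) * gen b0)"
      by metis
    have val_c: "n (c i) = n (b i) - m (b i) * n b0" if "n \<in> Z" "i < k" for n i
      using eqv_functional[OF Z_functional[OF that(1)] c(2)[OF that(2)]]
      by (simp add: der_diff der_const_mult ccoeff_diff ccoeff_mult)
    have l_r: "l i r = 0" if "i < k" for i
      using val_r[OF bl(2)[OF that]] dual that
      by (simp add: if_distrib[of "\<lambda>x. _ * x"] cong: if_cong)
    have gen_b: "eqv (gen (b i)) (gen (c i) + const (m (b i)) * gen b0)" if "i < k" for i
      using eqv_add[OF eqv_sym[OF c(2)[OF that]] eqv_refl[of "const (m (b i)) * gen b0"]] b0(1) by simp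
    have sum_b: "eqv (\<Sum>i<k. const (a i) * gen (b i))
        ((\<Sum>i<k. const (a i) * gen (c i)) + const (\<Sum>i<k. a i * m (b i)) * gen b0)" for a
    proof -
      have "eqv (\<Sum>i<k. const (a i) * gen (b i)) (\<Sum>i<k. const (a i) * (gen (c i) + const (m (b i)) * gen b0))"
        by (intro eqv_sum eqv_const_mult gen_b) simp
      then show ?thesis
        by (simp add: algebra_simps sum.distrib const_sum const_mult sum_distrib_left)
    qed
    define b' where "b' = (\<lambda>i. if i < k then c i else b0)"
    define l' where "l' = (\<lambda>i. if i < k then l i else m)"
    have sum': "(\<Sum>i<Suc k. const (l' i w) * gen (b' i))
        = (\<Sum>i<k. const (l i w) * gen (c i)) + const (m w) * gen b0" for w
      by (simp add: b'_def l'_def)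
    show ?thesis
    proof (rule exI[of _ "Suc k"], rule exI[of _ b'], rule exI[of _ l'], intro conjI allI impI ballI)
      fix i assume "i < Suc k"
      then show "b' i \<in> U" "l' i \<in> Z"
        using c b0 bl m by (auto simp: b'_def l'_def)
    next
      fix i j assume "i < Suc k" "j < Suc k"
      then show "l' i (b' j) = (if i = j then 1 else 0)"
        using m bl dual l_r by (auto simp: b'_def l'_def val_c val_b0)
    next
      fix w assume "w \<in> insert v S"
      then consider "w = v" | "w \<in> S" by blast
      then show "eqv (gen w) (\<Sum>i<Suc k. const (l' i w) * gen (b' i))"
      proof cases
        case 1
        have "eqv (gen r) (const (m r) * gen b0)"
          using eqv_const_mult[OF b0(2), of "m r"] m(2)
          by (simp add: mult.assoc[symmetric] const_mult[symmetric] eqv_sym)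
        from eqv_add[OF eqv_trans[OF eqv_sym[OF r(2)] this] sum_b[of "\<lambda>i. l i v"]]
        have "eqv (gen v) (const (m r) * gen b0 + ((\<Sum>i<k. const (l i v) * gen (c i)) +
            const (\<Sum>i<k. l i v * m (b i)) * gen b0))"
          by simp
        also have "\<dots> = (\<Sum>i<Suc k. const (l' i v) * gen (b' i))"
        proof -
          have mv: "const (m v) = const (m r) + const (\<Sum>i<k. l i v * m (b i))"
            using val_r[OF m(1)] by (simp flip: const_add)
          show ?thesis unfolding sum' mv by (simp add: algebra_simps)
        qed
        finally show ?thesis using 1 by simp
      next
        case 2
        have "m w = (\<Sum>i<k. l i w * m (b i))"
          using eqv_functional[OF Z_functional[OF m(1)] S[OF 2]]
          by (simp add: der_sum der_const_mult ccoeff_sum ccoeff_mult)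
        then show ?thesis
          using eqv_trans[OF S[OF 2] sum_b[of "\<lambda>i. l i w"]] unfolding sum' by simp
      qed
    qed
  qed
qed

text \<open>
  Rewritten in a dual family, a polynomial has as its coefficients, up to factorials, constant terms of
  iterated derivatives along functionals from \<open>Z\<close>.
\<close>

theorem separation:
  assumes "p \<in> polys U" "\<And>ls. set ls \<subseteq> Z \<Longrightarrow> ccoeff (ders ls p) = 0"
  shows "p \<in> I"
proof -
  define S where "S = (\<Union>m\<in>Poly_Mapping.keys p. set_mset m)"
  have S: "finite S" "S \<subseteq> U" "p \<in> polys S"
    using assms(1) by (auto simp: S_def polys_iff)
  obtain k :: nat and b l where *: "(\<forall>i<k. b i \<in> U \<and> l i \<in> Z) \<and>
      (\<forall>i<k. \<forall>j<k. l i (b j) = (if i = j then 1 else 0)) \<and>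
      (\<forall>v\<in>S. eqv (gen v) (\<Sum>i<k. const (l i v) * gen (b i)))"
    using dual_family[OF S(1,2)] by blast
  have bl: "b i \<in> U" "l i \<in> Z" if "i < k" for i
    using * that by blast+
  have dual: "l i (b j) = (if i = j then 1 else 0)" if "i < k" "j < k" for i j
    using * that by blast
  have gen_S: "eqv (gen v) (\<Sum>i<k. const (l i v) * gen (b i))" if "v \<in> S" for v
    using * that by blast
  define B where "B = b ` {..<k}"
  have BU: "q \<in> polys B \<Longrightarrow> q \<in> polys U" for q
    using bl by (fastforce simp: B_def polys_iff)
  have "\<exists>q\<in>polys B. eqv p q"
    using S(3)
  proof (induction rule: polys_induct)
    case (const c)
    then show ?case by (intro bexI[of _ "const c"]) simp_all
  next
    case (gen v p)
    then obtain q where "q \<in> polys B" "eqv p q" by blast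
    then show ?case
      using gen_S[OF \<open>v \<in> S\<close>]
      by (intro bexI[of _ "(\<Sum>i<k. const (l i v) * gen (b i)) * q"] eqv_mult)
        (auto simp: B_def intro!: polys_mult polys_sum)
  next
    case (add p p')
    then show ?case by (meson eqv_add polys_add)
  qed
  then obtain q where q: "q \<in> polys B" "eqv p q" by blast
  have q0: "ccoeff (ders ls q) = 0" if "set ls \<subseteq> Z" for ls
  proof -
    have "ders ls (p - q) \<in> I"
      using that q by (intro I_ders Z_functional) (auto simp: eqv_def)
    then show ?thesis
      using assms(2)[OF that] I_ccoeff by (fastforce simp: ders_diff ccoeff_diff)
  qed
  have "Poly_Mapping.lookup q m = 0" if "set_mset m \<subseteq> B" for m
    using that q(1) q0
  proof (induction m arbitrary: q)
    case empty
    from empty.prems(3)[of "[]"] show ?case by (simp add: ccoeff_def)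
  next
    case (add x m)
    then obtain i where i: "i < k" "x = b i" by (auto simp: B_def)
    have "Poly_Mapping.lookup (der (l i) q) m = 0"
    proof (rule add.IH)
      show "ccoeff (ders ls (der (l i) q)) = 0" if "set ls \<subseteq> Z" for ls
        using add.prems(3)[of "ls @ [l i]"] bl(2)[OF i(1)] that by (simp add: ders_append)
    qed (use add.prems in auto)
    moreover have "Poly_Mapping.lookup (der (l i) q) m
        = of_nat (Suc (count m x)) * Poly_Mapping.lookup q (add_mset x m)"
      using add.prems(2)
      by (rule lookup_der) (use dual i in \<open>auto simp: B_def\<close>)
    ultimately show ?case by (simp del: of_nat_Suc)
  qed
  then have "q = 0"
    using q(1) by (intro poly_mapping_eqI) (metis polys_iff in_keys_iff lookup_zero)
  then show ?thesis using q(2) by (simp add: eqv_def)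
qed

end

section \<open>The symmetric algebra as a quotient\<close>

context sym_base
begin

abbreviation "S \<equiv> sym_alg ad sc U"

text \<open>
  The class of a polynomial in the symmetric algebra.
\<close>

definition cl :: "'v pol \<Rightarrow> 'v pol set" where
  "cl p = I +>\<^bsub>poly_alg U\<^esub> p"

lemma mem_cl: "p \<in> polys U \<Longrightarrow> q \<in> cl p \<longleftrightarrow> eqv q p"
  unfolding cl_def a_r_coset_def' eqv_def
  by (auto simp: I_polys intro!: bexI[of _ "q - p"])

lemma cl_eq: "p \<in> polys U \<Longrightarrow> q \<in> polys U \<Longrightarrow> cl p = cl q \<longleftrightarrow> eqv p q"
  using mem_cl[of p] mem_cl[of q] eqv_refl eqv_sym eqv_trans by blast

lemma carrier_S: "carrier S = cl ` polys U"
  by (auto simp: sym_alg_def FactRing_def A_RCOSETS_def' cl_def)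

lemma cl_carrier [simp]: "p \<in> polys U \<Longrightarrow> cl p \<in> carrier S"
  by (simp add: carrier_S)

lemma cl_add: "p \<in> polys U \<Longrightarrow> q \<in> polys U \<Longrightarrow> cl p \<oplus>\<^bsub>S\<^esub> cl q = cl (p + q)"
  using ideal.a_rcos_sum[OF ideal_I] by (simp add: sym_alg_def FactRing_def cl_def)

lemma cl_mult: "p \<in> polys U \<Longrightarrow> q \<in> polys U \<Longrightarrow> cl p \<otimes>\<^bsub>S\<^esub> cl q = cl (p * q)"
  using ideal.rcoset_mult_add[OF ideal_I] by (simp add: sym_alg_def FactRing_def cl_def)

lemma cl_one: "\<one>\<^bsub>S\<^esub> = cl 1"
  by (simp add: sym_alg_def FactRing_def cl_def)

lemma cl_zero: "\<zero>\<^bsub>S\<^esub> = cl 0"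
  using ring.a_rcos_zero[OF cring.axioms(1)[OF poly_alg_cring] ideal_I I_zero]
  by (simp add: sym_alg_def FactRing_def cl_def)

lemma cl_eqI: "eqv p q \<Longrightarrow> cl p = cl q"
  using cl_eq by (auto simp: eqv_def)

end

section \<open>Pairing two polynomial algebras\<close>

text \<open>
  The action of polynomials in \<open>'u\<close> on polynomials in \<open>'v\<close>: the variable \<open>a\<close> acts as the derivation with
  \<open>v \<mapsto> pr a v\<close>. The fold over the monomial is well defined as derivations commute.
\<close>

definition act :: "('u \<Rightarrow> 'v \<Rightarrow> complex) \<Rightarrow> 'u pol \<Rightarrow> 'v pol \<Rightarrow> 'v pol" where
  "act pr p' p = lin_ext (\<lambda>m. fold_mset (\<lambda>a. der (pr a)) p m) p'"

lemma act_add_left: "act pr (p' + q') p = act pr p' p + act pr q' p"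
  by (simp add: act_def lin_ext_add)

lemma act_0_left [simp]: "act pr 0 p = 0"
  by (simp add: act_def)

lemma act_const: "act pr (const c) p = const c * p"
  by (simp add: act_def const_def lin_ext_single)

lemma act_gen_mult: "act pr (gen a * p') p = der (pr a) (act pr p' p)"
proof -
  interpret comp_fun_commute "\<lambda>a. der (pr a)"
    by standard (auto simp: der_commute)
  have "act pr (gen a * (\<Sum>m\<in>A. Poly_Mapping.single m (f m))) p
      = der (pr a) (act pr (\<Sum>m\<in>A. Poly_Mapping.single m (f m)) p)" for A f
    by (simp add: sum_distrib_left der_sum der_const_mult act_def lin_ext_sum lin_ext_single
             flip: single_add_mset)
  from this[of "Poly_Mapping.lookup p'" "Poly_Mapping.keys p'"] show ?thesis
    by (simp flip: pol_eq_sum_single)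
qed

lemma act_add: "act pr p' (p + q) = act pr p' p + act pr p' q"
proof -
  have "p' \<in> polys UNIV" by simp
  then show ?thesis
    by (induction rule: polys_induct)
       (simp_all add: act_const act_gen_mult act_add_left der_add ring_distribs)
qed

lemma act_const_mult: "act pr p' (const c * p) = const c * act pr p' p"
proof -
  have "p' \<in> polys UNIV" by simp
  then show ?thesis
    by (induction rule: polys_induct)
       (simp_all add: act_const act_gen_mult act_add_left der_const_mult ring_distribs mult.left_commute)
qed

lemma act_const_mult_left: "act pr (const c * p') p = const c * act pr p' p"
proof -
  have "p' \<in> polys UNIV" by simp
  then show ?thesis
  proof (induction rule: polys_induct)
    case (const d)
    then show ?case by (simp add: act_const mult.assoc flip: const_mult) (simp add: const_mult mult.assoc)
  next
    case (gen a p')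
    have "act pr (const c * (gen a * p')) p = act pr (gen a * (const c * p')) p"
      by (simp only: mult.left_commute)
    with gen show ?case by (simp add: act_gen_mult der_const_mult)
  qed (simp add: act_add_left ring_distribs)
qed

lemma act_mult: "act pr (p' * q') p = act pr p' (act pr q' p)"
proof -
  have "p' \<in> polys UNIV" by simp
  then show ?thesis
    by (induction rule: polys_induct)
       (simp_all add: act_const act_const_mult_left act_gen_mult act_add_left ring_distribs mult.assoc)
qed

lemma der_act: "der l (act pr p' p) = act pr p' (der l p)"
proof -
  have "p' \<in> polys UNIV" by simp
  then show ?thesis
    by (induction rule: polys_induct)
       (simp_all add: act_const act_gen_mult act_add_left der_const_mult der_add der_commute[of l])
qed

text \<open>Multiplication by \<open>v\<close> is adjoint to the derivation given by pairing with \<open>v\<close>.\<close>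

lemma ccoeff_act_gen_mult:
  "ccoeff (act pr p' (gen v * p)) = ccoeff (act pr (der (\<lambda>a. pr a v) p') p)"
proof -
  have "p' \<in> polys UNIV" by simp
  then show ?thesis
  proof (induction arbitrary: p rule: polys_induct)
    case (gen a p')
    then show ?case
      by (simp add: act_gen_mult der_act der_mult act_add act_add_left ccoeff_add
                    act_const_mult act_const_mult_left)
  qed (simp_all add: act_const act_add_left ccoeff_add ccoeff_mult der_add)
qed

text \<open>
  The extension of \<open>pr\<close> to polynomials. On monomials of the same degree it is the permanent of the
  matrix of the values of \<open>pr\<close>, and monomials of different degrees are orthogonal.
\<close>

definition poly_pair :: "('u \<Rightarrow> 'v \<Rightarrow> complex) \<Rightarrow> 'u pol \<Rightarrow> 'v pol \<Rightarrow> complex" where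
  "poly_pair pr p' p = ccoeff (act pr p' p)"

lemma poly_pair_add:
  "poly_pair pr p' (p + q) = poly_pair pr p' p + poly_pair pr p' q"
  "poly_pair pr (p' + q') p = poly_pair pr p' p + poly_pair pr q' p"
  by (simp_all add: poly_pair_def act_add act_add_left ccoeff_add)

lemma poly_pair_const_mult:
  "poly_pair pr p' (const c * p) = c * poly_pair pr p' p"
  "poly_pair pr (const c * p') p = c * poly_pair pr p' p"
  by (simp_all add: poly_pair_def act_const_mult act_const_mult_left ccoeff_mult)

lemma poly_pair_0 [simp]: "poly_pair pr p' 0 = 0"
  using poly_pair_const_mult(1)[of pr p' 0 0] by simp

lemma poly_pair_1 [simp]: "poly_pair pr 1 1 = 1"
  using act_const[of pr 1 1] by (simp add: poly_pair_def)

lemma poly_pair_gen_mult: "poly_pair pr p' (gen v * p) = poly_pair pr (der (\<lambda>a. pr a v) p') p"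
  by (simp add: poly_pair_def ccoeff_act_gen_mult)

lemma poly_pair_gen_mult': "poly_pair pr (gen a * p') p = poly_pair pr p' (der (pr a) p)"
  by (simp add: poly_pair_def act_gen_mult der_act)

text \<open>
  If \<open>pr\<close> is linear in both arguments, the pairing descends to the two symmetric algebras.
\<close>

locale sym_pair = dual: sym_base U' ad' sc' + sym_base U ad sc
  for U' :: "'u set" and ad' sc' and U :: "'v set" and ad sc +
  fixes pr :: "'u \<Rightarrow> 'v \<Rightarrow> complex"
  assumes pr_functional: "a \<in> U' \<Longrightarrow> functional (pr a)"
    and pr_functional': "v \<in> U \<Longrightarrow> dual.functional (\<lambda>a. pr a v)"
begin

lemma act_I: "p' \<in> polys U' \<Longrightarrow> p \<in> I \<Longrightarrow> act pr p' p \<in> I"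
  by (induction rule: polys_induct)
     (simp_all add: act_const act_gen_mult act_add_left I_mult I_add I_der pr_functional)

lemma act_I': "p' \<in> dual.I \<Longrightarrow> p \<in> polys U \<Longrightarrow> act pr p' p = 0"
proof (induction arbitrary: p rule: dual.I_induct)
  case (ad v w)
  have gen: "act pr (gen a) p = der (pr a) p" for a
    using act_gen_mult[of pr a 1 p] act_const[of pr 1 p] by simp
  have "der (pr (ad' v w)) p = der (\<lambda>x. pr v x + pr w x) p"
    using ad by (intro der_cong[OF ad(3)]) (use pr_functional' in \<open>auto simp: dual.functional_def\<close>)
  moreover have "act pr (gen (ad' v w) - gen v - gen w) p + act pr (gen v) p + act pr (gen w) p
      = act pr (gen (ad' v w)) p"
    by (simp flip: act_add_left)
  ultimately show ?case by (simp add: gen der_fun_add)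
next
  case (sc c v)
  have gen: "act pr (gen a) p = der (pr a) p" for a
    using act_gen_mult[of pr a 1 p] act_const[of pr 1 p] by simp
  have "der (pr (sc' c v)) p = der (\<lambda>x. c * pr v x) p"
    using sc by (intro der_cong[OF sc(2)]) (use pr_functional' in \<open>auto simp: dual.functional_def\<close>)
  moreover have "act pr (gen (sc' c v) - const c * gen v) p + act pr (const c * gen v) p
      = act pr (gen (sc' c v)) p"
    by (simp flip: act_add_left)
  ultimately show ?case by (simp add: gen der_fun_scale act_mult act_const)
next
  case (mult p' q')
  then show ?case using act_const_mult[of pr q' 0 0] by (simp add: act_mult)
qed (simp_all add: act_add_left)

lemma poly_pair_cong:
  assumes "dual.eqv p' q'" "eqv p q"
  shows "poly_pair pr p' p = poly_pair pr q' q"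
proof -
  have 0: "act pr (p' - q') p = 0" using assms by (intro act_I') (auto simp: eqv_def dual.eqv_def)
  have "act pr p' p = act pr (p' - q') p + act pr q' p"
    by (simp flip: act_add_left)
  with 0 have 1: "act pr p' p = act pr q' p" by simp
  have 2: "act pr q' (p - q) \<in> I"
    using assms by (intro act_I) (auto simp: eqv_def dual.eqv_def)
  have "act pr q' p = act pr q' (p - q) + act pr q' q"
    by (simp flip: act_add)
  then show ?thesis
    using 1 I_ccoeff[OF 2] by (simp add: poly_pair_def ccoeff_add)
qed

end

section \<open>Charts and sections\<close>

lemma analytic_eventually_analytic:
  assumes "f analytic_on {z :: complex}"
  shows "\<forall>\<^sub>F w in nhds z. f analytic_on {w}"
  using assms unfolding analytic_at eventually_nhds by blast

lemma jac_nonzero [simp]: "jac p t \<noteq> 0"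
  by (simp add: jac_def split: option.splits)

lemma jac_0 [simp]: "jac p 0 = 1"
  by (simp add: jac_def split: option.splits)

lemma param_0 [simp]: "param p 0 = p"
  by (simp add: param_def split: option.splits)

lemma loc_form_0 [simp]: "loc_form s p 0 = s p"
  by (simp add: loc_form_def)

text \<open>
  The change from the chart centred at \<open>param p t\<close> to the chart centred at \<open>p\<close>, and its derivative
  \<open>chart_trans'\<close>. The charts at finite points differ by translations; the point with coordinate \<open>t \<noteq> 0\<close> in
  the chart at infinity is finite, with affine coordinate \<open>1 / t\<close>.
\<close>

definition chart_trans :: "proj_line \<Rightarrow> complex \<Rightarrow> complex \<Rightarrow> complex" where
  "chart_trans p t r = (if p = None \<and> t \<noteq> 0 then t / (1 + r * t) else t + r)"

definition chart_trans' :: "proj_line \<Rightarrow> complex \<Rightarrow> complex \<Rightarrow> complex" where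
  "chart_trans' p t r = (if p = None \<and> t \<noteq> 0 then - (chart_trans p t r)\<^sup>2 else 1)"

lemma chart_trans_0 [simp]: "chart_trans p t 0 = t"
  by (simp add: chart_trans_def)

lemma eventually_trans_ok: "\<forall>\<^sub>F r in nhds 0. 1 + r * (t::complex) \<noteq> 0"
proof -
  have "((\<lambda>r. 1 + r * t) \<longlongrightarrow> 1 + 0 * t) (nhds 0)"
    by (intro tendsto_intros filterlim_ident)
  then show ?thesis
    by (rule tendsto_imp_eventually_ne) simp
qed

lemma param_trans: "1 + r * t \<noteq> 0 \<Longrightarrow> param (param p t) r = param p (chart_trans p t r)"
  by (auto simp: param_def chart_trans_def add_divide_distrib split: option.splits)

lemma jac_trans: "1 + r * t \<noteq> 0 \<Longrightarrow> jac (param p t) r = chart_trans' p t r * jac p (chart_trans p t r)"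
  by (auto simp: param_def jac_def chart_trans_def chart_trans'_def power_divide split: option.splits)

lemma chart_trans_deriv:
  assumes "1 + r * t \<noteq> 0"
  shows "(chart_trans p t has_field_derivative chart_trans' p t r) (at r)"
proof (cases "p = None \<and> t \<noteq> 0")
  case True
  have "((\<lambda>r. t / (1 + r * t)) has_field_derivative - (t / (1 + r * t))\<^sup>2) (at r)"
    by (rule derivative_eq_intros refl | use assms in \<open>simp add: power2_eq_square\<close>)+
  with True show ?thesis by (auto simp: chart_trans'_def chart_trans_def[abs_def])
next
  case False
  have "((\<lambda>r. t + r) has_field_derivative 1) (at r)"
    by (auto intro!: derivative_eq_intros)
  with False show ?thesis by (auto simp: chart_trans'_def chart_trans_def[abs_def])
qed

lemma chart_trans_analytic: "chart_trans p t analytic_on {0}"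
proof (cases "p = None \<and> t \<noteq> 0")
  case True
  have "(\<lambda>r. t / (1 + r * t)) analytic_on {0}"
    by (intro analytic_intros) auto
  with True show ?thesis by (auto simp: chart_trans_def[abs_def])
next
  case False
  have "(\<lambda>r. t + r) analytic_on {0}"
    by (intro analytic_intros)
  with False show ?thesis by (auto simp: chart_trans_def[abs_def])
qed

lemma chart_trans'_analytic: "chart_trans' p t analytic_on {0}"
  unfolding chart_trans'_def[abs_def]
  by (cases "p = None \<and> t \<noteq> 0") (auto intro!: analytic_intros chart_trans_analytic)

lemma chart_trans'_jac: "chart_trans' p t 0 * jac p t = 1"
  by (auto simp: chart_trans'_def jac_def split: option.splits)

lemma loc_form_param:
  "\<forall>\<^sub>F r in nhds 0. loc_form s (param p t) r = chart_trans' p t r * loc_form s p (chart_trans p t r)"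
  using eventually_trans_ok[of t]
  by eventually_elim (simp add: loc_form_def param_trans jac_trans mult.assoc)

lemma loc_fun_param:
  "\<forall>\<^sub>F r in nhds 0. loc_fun s (param p t) r = loc_fun s p (chart_trans p t r)"
  using eventually_trans_ok[of t]
  by eventually_elim (simp add: loc_fun_def param_trans)

lemma analytic_at_trans:
  assumes "f analytic_on {t}"
  shows "(\<lambda>r. f (chart_trans p t r)) analytic_on {0}"
  using analytic_on_compose[OF chart_trans_analytic[of p t], of f] assms by (simp add: o_def)

text \<open>
  A section of \<open>K\<close> is regular at \<open>p\<close>, hence in a neighbourhood of \<open>p\<close>.
\<close>

definition sec_analytic :: "(proj_line \<Rightarrow> complex) \<Rightarrow> proj_line \<Rightarrow> bool" where
  "sec_analytic s p \<longleftrightarrow> loc_form s p analytic_on {0}"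

lemma loc_form_analytic_param:
  "loc_form s p analytic_on {t} \<Longrightarrow> sec_analytic s (param p t)"
  unfolding sec_analytic_def
  by (subst analytic_at_cong[OF loc_form_param refl])
     (intro analytic_on_mult chart_trans'_analytic analytic_at_trans)

lemma sec_analytic_nearby:
  "sec_analytic s p \<Longrightarrow> \<forall>\<^sub>F t in nhds 0. sec_analytic s (param p t)"
  unfolding sec_analytic_def[of s p]
  by (drule analytic_eventually_analytic, erule eventually_mono) (rule loc_form_analytic_param)

lemma sec_analytic_cong:
  "\<forall>\<^sub>F t in nhds 0. s (param p t) = s' (param p t) \<Longrightarrow> sec_analytic s p \<longleftrightarrow> sec_analytic s' p"
  unfolding sec_analytic_def loc_form_def
  by (rule analytic_at_cong) (auto elim: eventually_mono)

lemma sec_analytic_add: "sec_analytic s p \<Longrightarrow> sec_analytic s' p \<Longrightarrow> sec_analytic (\<lambda>q. s q + s' q) p"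
  unfolding sec_analytic_def loc_form_def by (simp add: distrib_left analytic_on_add)

lemma sec_analytic_scale: "sec_analytic s p \<Longrightarrow> sec_analytic (\<lambda>q. c * s q) p"
  unfolding sec_analytic_def loc_form_def
  using analytic_on_mult[OF analytic_on_const[of c]] by (simp add: mult.left_commute)

lemma sec_analytic_0 [simp]: "sec_analytic (\<lambda>q. 0) p"
  by (simp add: sec_analytic_def loc_form_def[abs_def])

lemma sec_analytic_sum:
  "(\<And>i. i \<in> A \<Longrightarrow> sec_analytic (f i) p) \<Longrightarrow> sec_analytic (\<lambda>q. \<Sum>i\<in>A. c i * f i q) p"
  by (induction A rule: infinite_finite_induct) (auto intro!: sec_analytic_add sec_analytic_scale)

text \<open>
  The \<open>n\<close>-th derivative of a section at \<open>p\<close> in the chart centred at \<open>p\<close>.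
\<close>

definition jet :: "nat \<Rightarrow> proj_line \<Rightarrow> (proj_line \<Rightarrow> complex) \<Rightarrow> complex" where
  "jet n p s = (deriv ^^ n) (loc_form s p) 0"

lemma jet_0 [simp]: "jet 0 p s = s p"
  by (simp add: jet_def)

lemma jet_cong:
  "\<forall>\<^sub>F t in nhds 0. s (param p t) = s' (param p t) \<Longrightarrow> jet n p s = jet n p s'"
  unfolding jet_def loc_form_def
  by (rule higher_deriv_cong_ev) (auto elim: eventually_mono)

lemma analytic_at_higher_deriv:
  "f analytic_on {z::complex} \<Longrightarrow> (deriv ^^ n) f analytic_on {z}"
  by (induction n) (auto intro: analytic_deriv)

lemma jet_add:
  assumes "sec_analytic s p" "sec_analytic s' p"
  shows "jet n p (\<lambda>q. s q + s' q) = jet n p s + jet n p s'"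
  using higher_deriv_add_at[of "loc_form s p" 0 "loc_form s' p" n] assms
  by (simp add: jet_def sec_analytic_def loc_form_def[abs_def] distrib_left)

lemma jet_scale:
  assumes "sec_analytic s p"
  shows "jet n p (\<lambda>q. c * s q) = c * jet n p s"
  using higher_deriv_cmult'[of "loc_form s p" 0 n c] assms
  by (simp add: jet_def sec_analytic_def loc_form_def[abs_def] mult.left_commute)

lemma jet_zero [simp]: "jet n p (\<lambda>q. 0) = 0"
  using jet_scale[of "\<lambda>q. 0" p n 0] by simp

lemma jet_sum:
  assumes "\<And>i. i \<in> A \<Longrightarrow> sec_analytic (f i) p"
  shows "jet n p (\<lambda>q. \<Sum>i\<in>A. c i * f i q) = (\<Sum>i\<in>A. c i * jet n p (f i))"
  using assms
  by (induction A rule: infinite_finite_induct)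
     (auto simp: jet_add jet_scale sec_analytic_sum sec_analytic_scale)

section \<open>Lie derivatives of scalar sections\<close>

lemma lie_cong:
  assumes "\<forall>\<^sub>F t in nhds 0. s (param p t) = s' (param p t)"
  shows "lie X s p = lie X s' p"
proof -
  have *: "\<forall>\<^sub>F t in nhds 0. loc_form s p t = loc_form s' p t"
    using assms by eventually_elim (simp add: loc_form_def)
  show ?thesis
    unfolding lie_def deriv_cong_ev[OF * refl] eventually_nhds_x_imp_x[OF *] ..
qed

lemma eventually_param_eventually:
  assumes "\<forall>\<^sub>F t in nhds 0. P (param p t)"
  shows "\<forall>\<^sub>F t in nhds 0. \<forall>\<^sub>F r in nhds 0. P (param (param p t) r)"
proof -
  have "\<forall>\<^sub>F t in nhds 0. \<forall>\<^sub>F r in nhds t. P (param p r)"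
    using assms by (simp add: eventually_eventually)
  then show ?thesis
  proof eventually_elim
    case (elim t)
    have "(chart_trans p t \<longlongrightarrow> chart_trans p t 0) (nhds 0)"
      using analytic_at_imp_isCont[OF chart_trans_analytic[of p t]]
      unfolding isCont_def tendsto_at_iff_tendsto_nhds .
    then have "\<forall>\<^sub>F r in nhds 0. P (param p (chart_trans p t r))"
      using eventually_compose_filterlim[OF elim] by simp
    with eventually_trans_ok[of t] show ?case
      by eventually_elim (simp add: param_trans)
  qed
qed

lemma lie_iter_cong:
  assumes "\<forall>\<^sub>F t in nhds 0. s (param p t) = s' (param p t)"
  shows "(lie X ^^ N) s p = (lie X ^^ N) s' p"
  using assms
proof (induction N arbitrary: p)
  case 0
  then show ?case by (auto dest: eventually_nhds_x_imp_x)
next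
  case (Suc N)
  have "\<forall>\<^sub>F t in nhds 0. (lie X ^^ N) s (param p t) = (lie X ^^ N) s' (param p t)"
    using eventually_param_eventually[OF Suc.prems] by eventually_elim (rule Suc.IH)
  then show ?case by (simp add: lie_cong)
qed

lemma lie_eq_deriv:
  assumes "regular_field X" "sec_analytic s p"
  shows "lie X s p = deriv (\<lambda>t. loc_field X p t * loc_form s p t) 0"
proof -
  have "loc_field X p field_differentiable at 0" "loc_form s p field_differentiable at 0"
    using assms by (auto simp: regular_field_def sec_analytic_def intro: analytic_on_imp_differentiable_at)
  then show ?thesis
    by (simp add: lie_def deriv_mult)
qed

lemma field_times_form: "loc_field X p t * loc_form s p t = loc_fun (\<lambda>q. X q * s q) p t"
  by (simp add: loc_field_def loc_form_def loc_fun_def)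

text \<open>
  \<open>X s\<close> is a scalar function, and the Lie derivative of \<open>s\<close> along \<open>X\<close> is its differential; this makes
  the chart at \<open>p\<close> usable on a whole neighbourhood of \<open>p\<close>.
\<close>

lemma loc_form_lie:
  assumes "regular_field X" "sec_analytic s p"
  shows "\<forall>\<^sub>F t in nhds 0. loc_form (lie X s) p t = deriv (\<lambda>t. loc_field X p t * loc_form s p t) t"
proof -
  let ?h = "\<lambda>q. X q * s q"
  have an: "loc_fun ?h p analytic_on {0}"
    using assms unfolding field_times_form[abs_def, symmetric]
    by (auto simp: regular_field_def sec_analytic_def intro!: analytic_on_mult)
  have "\<forall>\<^sub>F t in nhds 0. loc_fun ?h p analytic_on {t} \<and> sec_analytic s (param p t)"
    using analytic_eventually_analytic[OF an] sec_analytic_nearby[OF assms(2)]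
    by (rule eventually_conj)
  then show ?thesis
  proof eventually_elim
    case (elim t)
    have "loc_form (lie X s) p t = jac p t * lie X s (param p t)"
      by (simp add: loc_form_def)
    also have "lie X s (param p t) = deriv (loc_fun ?h (param p t)) 0"
      using elim by (simp add: lie_eq_deriv[OF assms(1)] field_times_form)
    also have "\<dots> = deriv (\<lambda>r. loc_fun ?h p (chart_trans p t r)) 0"
      by (rule deriv_cong_ev[OF loc_fun_param refl])
    also have "\<dots> = deriv (loc_fun ?h p) t * chart_trans' p t 0"
    proof (rule DERIV_imp_deriv)
      have "(loc_fun ?h p has_field_derivative deriv (loc_fun ?h p) t) (at (chart_trans p t 0))"
        using elim by (auto intro!: DERIV_deriv_iff_field_differentiable[THEN iffD2] analytic_on_imp_differentiable_at)
      then show "((\<lambda>r. loc_fun ?h p (chart_trans p t r)) has_field_derivative deriv (loc_fun ?h p) t * chart_trans' p t 0) (at 0)"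
        by (rule DERIV_chain2) (rule chart_trans_deriv, simp)
    qed
    finally show ?case
      using chart_trans'_jac[of p t] by (simp add: field_times_form mult.left_commute[of "jac p t"] mult.commute[of "jac p t"])
  qed
qed

lemma sec_analytic_lie:
  assumes "regular_field X" "sec_analytic s p"
  shows "sec_analytic (lie X s) p"
  unfolding sec_analytic_def
  by (subst analytic_at_cong[OF loc_form_lie[OF assms] refl])
     (use assms in \<open>auto simp: regular_field_def sec_analytic_def intro!: analytic_deriv analytic_on_mult\<close>)

lemma sec_analytic_lie_iter:
  "regular_field X \<Longrightarrow> sec_analytic s p \<Longrightarrow> sec_analytic ((lie X ^^ N) s) p"
  by (induction N) (auto simp: sec_analytic_lie)

lemma deriv_eventually_eq:
  assumes "\<forall>\<^sub>F t in nhds z. f t = g (t::complex)"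
  shows "\<forall>\<^sub>F t in nhds z. deriv f t = deriv g t"
proof -
  have "\<forall>\<^sub>F t in nhds z. \<forall>\<^sub>F s in nhds t. f s = g s"
    using assms by (simp add: eventually_eventually)
  then show ?thesis
    by (rule eventually_mono) (rule deriv_cong_ev[OF _ refl])
qed

text \<open>
  At a point, the iterated Lie derivatives are universal linear combinations of the derivatives in the
  chart. The coefficients are kept as analytic functions near the point, so that one can differentiate
  once more.
\<close>

lemma lie_iter_jets_nearby:
  assumes X: "regular_field X"
  shows "\<exists>c. (\<forall>n. c n analytic_on {0}) \<and> (\<forall>s. sec_analytic s p \<longrightarrow>
    (\<forall>\<^sub>F t in nhds 0. loc_form ((lie X ^^ N) s) p t = (\<Sum>n\<le>N. c n t * (deriv ^^ n) (loc_form s p) t)))"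
proof (induction N)
  case 0
  show ?case by (intro exI[of _ "\<lambda>n t. 1"]) simp
next
  case (Suc N)
  then obtain c where c: "\<And>n. c n analytic_on {0}"
    and eq: "\<And>s. sec_analytic s p \<Longrightarrow> \<forall>\<^sub>F t in nhds 0.
      loc_form ((lie X ^^ N) s) p t = (\<Sum>n\<le>N. c n t * (deriv ^^ n) (loc_form s p) t)"
    by blast
  let ?x = "loc_field X p"
  have x: "?x analytic_on {0}" using X by (simp add: regular_field_def)
  \<comment> \<open>Leibniz's rule for \<open>(x c\<^sub>n f\<^sup>(\<^sup>n\<^sup>))'\<close>\<close>
  define d where "d = (\<lambda>n t. (if n \<le> N then deriv (\<lambda>t. ?x t * c n t) t else 0) + (if n = 0 then 0 else ?x t * c (n - 1) t))"
  have "d n analytic_on {0}" for n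
    unfolding d_def
    by (cases "n \<le> N"; cases "n = 0") (auto intro!: analytic_intros analytic_deriv x c)
  moreover have "\<forall>\<^sub>F t in nhds 0. loc_form ((lie X ^^ Suc N) s) p t = (\<Sum>n\<le>Suc N. d n t * (deriv ^^ n) (loc_form s p) t)"
    if s: "sec_analytic s p" for s
  proof -
    let ?f = "loc_form s p"
    have f: "?f analytic_on {0}" using s by (simp add: sec_analytic_def)
    have "\<forall>\<^sub>F t in nhds 0. loc_form ((lie X ^^ Suc N) s) p t
        = deriv (\<lambda>t. ?x t * loc_form ((lie X ^^ N) s) p t) t"
      using loc_form_lie[OF X sec_analytic_lie_iter[OF X s]] by simp
    moreover have "\<forall>\<^sub>F t in nhds 0. deriv (\<lambda>t. ?x t * loc_form ((lie X ^^ N) s) p t) t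
        = deriv (\<lambda>t. \<Sum>n\<le>N. (?x t * c n t) * (deriv ^^ n) ?f t) t"
      using eq[OF s] by (intro deriv_eventually_eq) (auto elim!: eventually_mono simp: sum_distrib_left mult.assoc)
    moreover have "\<forall>\<^sub>F t in nhds 0. \<forall>n\<in>{..N}. (\<lambda>t. ?x t * c n t) analytic_on {t} \<and> (deriv ^^ n) ?f analytic_on {t}"
      by (intro eventually_ball_finite ballI eventually_conj analytic_eventually_analytic
                analytic_on_mult x c analytic_at_higher_deriv f) simp
    ultimately show ?thesis
    proof eventually_elim
      case (elim t)
      have D: "((\<lambda>t. \<Sum>n\<le>N. (?x t * c n t) * (deriv ^^ n) ?f t) has_field_derivative
          (\<Sum>n\<le>N. (?x t * c n t) * deriv ((deriv ^^ n) ?f) t + deriv (\<lambda>t. ?x t * c n t) t * (deriv ^^ n) ?f t)) (at t)"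
        using elim(3)
        by (intro DERIV_sum DERIV_mult')
           (auto intro!: DERIV_deriv_iff_field_differentiable[THEN iffD2] analytic_on_imp_differentiable_at)
      have "(\<Sum>n\<le>Suc N. d n t * (deriv ^^ n) ?f t)
          = (\<Sum>n\<le>Suc N. (if n \<le> N then deriv (\<lambda>t. ?x t * c n t) t else 0) * (deriv ^^ n) ?f t)
            + (\<Sum>n\<le>Suc N. (if n = 0 then 0 else ?x t * c (n - 1) t) * (deriv ^^ n) ?f t)"
        by (simp only: d_def distrib_right sum.distrib)
      also have "(\<Sum>n\<le>Suc N. (if n \<le> N then deriv (\<lambda>t. ?x t * c n t) t else 0) * (deriv ^^ n) ?f t)
          = (\<Sum>n\<le>N. deriv (\<lambda>t. ?x t * c n t) t * (deriv ^^ n) ?f t)"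
        by (simp cong: sum.cong_simp)
      also have "(\<Sum>n\<le>Suc N. (if n = 0 then 0 else ?x t * c (n - 1) t) * (deriv ^^ n) ?f t)
          = (\<Sum>n\<le>N. ?x t * c n t * (deriv ^^ Suc n) ?f t)"
        by (subst sum.atMost_Suc_shift) simp
      finally show ?case
        using elim(1,2) DERIV_imp_deriv[OF D] by (simp add: sum.distrib)
    qed
  qed
  ultimately show ?case by blast
qed

text \<open>
  A choice of these coefficients.
\<close>

definition lie_coeff :: "(proj_line \<Rightarrow> complex) \<Rightarrow> proj_line \<Rightarrow> nat \<Rightarrow> nat \<Rightarrow> complex" where
  "lie_coeff X p N = (SOME c. \<forall>s. sec_analytic s p \<longrightarrow> (lie X ^^ N) s p = (\<Sum>n\<le>N. c n * jet n p s))"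

lemma lie_iter_jets:
  assumes "regular_field X" "sec_analytic s p"
  shows "(lie X ^^ N) s p = (\<Sum>n\<le>N. lie_coeff X p N n * jet n p s)"
proof -
  obtain c where c: "\<And>s. sec_analytic s p \<Longrightarrow> \<forall>\<^sub>F t in nhds 0.
      loc_form ((lie X ^^ N) s) p t = (\<Sum>n\<le>N. c n t * (deriv ^^ n) (loc_form s p) t)"
    using lie_iter_jets_nearby[OF assms(1)] by blast
  have "\<exists>c. \<forall>s. sec_analytic s p \<longrightarrow> (lie X ^^ N) s p = (\<Sum>n\<le>N. c n * jet n p s)"
    using eventually_nhds_x_imp_x[OF c] by (intro exI[of _ "\<lambda>n. c n 0"]) (auto simp: jet_def)
  from someI_ex[OF this] show ?thesis
    using assms(2) unfolding lie_coeff_def by blast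
qed

lemma lie_iter_unit_field:
  assumes "regular_field X" "\<forall>\<^sub>F t in nhds 0. loc_field X p t = 1" "sec_analytic s p"
  shows "(lie X ^^ N) s p = jet N p s"
proof -
  have "\<forall>\<^sub>F t in nhds 0. loc_form ((lie X ^^ N) s) p t = (deriv ^^ N) (loc_form s p) t"
  proof (induction N)
    case (Suc N)
    have "\<forall>\<^sub>F t in nhds 0. loc_field X p t * loc_form ((lie X ^^ N) s) p t = (deriv ^^ N) (loc_form s p) t"
      using Suc assms(2) by eventually_elim simp
    from deriv_eventually_eq[OF this] loc_form_lie[OF assms(1) sec_analytic_lie_iter[OF assms(1,3)], of N]
    show ?case by eventually_elim simp
  qed simp
  from eventually_nhds_x_imp_x[OF this] show ?thesis by (simp add: jet_def)
qed

text \<open>The field \<open>\<partial>\<^sub>t\<close> in the chart at a given point.\<close>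

definition unit_field :: "proj_line \<Rightarrow> proj_line \<Rightarrow> complex" where
  "unit_field p q = (case p of Some a \<Rightarrow> (case q of Some b \<Rightarrow> 1 | None \<Rightarrow> 0)
                       | None \<Rightarrow> (case q of Some b \<Rightarrow> - b\<^sup>2 | None \<Rightarrow> 1))"

lemma loc_field_unit_field: "loc_field (unit_field p) p t = 1"
  by (auto simp: loc_field_def unit_field_def param_def jac_def power_divide split: option.splits)

lemma regular_unit_field: "regular_field (unit_field p)"
  unfolding regular_field_def
proof
  fix q
  have "loc_field (unit_field p) q = (case p of
      Some a \<Rightarrow> (case q of Some b \<Rightarrow> (\<lambda>t. 1) | None \<Rightarrow> (\<lambda>t. - t\<^sup>2))
    | None \<Rightarrow> (case q of Some b \<Rightarrow> (\<lambda>t. - (b + t)\<^sup>2) | None \<Rightarrow> (\<lambda>t. 1)))"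
    by (auto simp: loc_field_def unit_field_def param_def jac_def fun_eq_iff power_divide split: option.splits)
  then show "loc_field (unit_field p) q analytic_on {0}"
    by (auto split: option.splits intro!: analytic_intros)
qed

section \<open>The kernel and its derivatives\<close>

text \<open>
  The value at \<open>v\<close> of \<open>e\<^sub>z\<close> in the chosen bases of the fibres of \<open>K\<close> at \<open>z\<close> and \<open>v\<close>; it is set to \<open>0\<close> on
  the diagonal, for finite points because division by zero yields zero.
\<close>

definition kern :: "proj_line \<Rightarrow> proj_line \<Rightarrow> complex" where
  "kern z v = (case z of
      Some a \<Rightarrow> (case v of Some b \<Rightarrow> - 1 / (b - a)\<^sup>2 | None \<Rightarrow> 1)
    | None \<Rightarrow> (case v of Some b \<Rightarrow> 1 | None \<Rightarrow> 0))"

text \<open>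
  The form \<open>b\<^sub>z\<^sub>,\<^sub>n\<close>, the \<open>n\<close>-th derivative of the kernel in its first argument (\<open>jet_kern\<close>). In the chart at
  \<open>z\<close> it is \<open>- (n + 1)! dt / t\<^sup>n\<^sup>+\<^sup>2\<close>, also for \<open>z = \<infinity>\<close>.
\<close>

definition bform :: "proj_line \<Rightarrow> nat \<Rightarrow> proj_line \<Rightarrow> complex" where
  "bform z n v = (case z of
      Some a \<Rightarrow> (case v of Some b \<Rightarrow> - fact (n + 1) / (b - a) ^ (n + 2) | None \<Rightarrow> if n = 0 then 1 else 0)
    | None \<Rightarrow> (case v of Some b \<Rightarrow> fact (n + 1) * b ^ n | None \<Rightarrow> 0))"

lemma bform_0: "bform z 0 = kern z"
  by (auto simp: bform_def kern_def fun_eq_iff power2_eq_square split: option.splits)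

lemma kern_sym: "kern z v = kern v z"
  by (simp add: kern_def power2_commute split: option.splits)

lemma loc_form_bform_self: "loc_form (bform z n) z t = - fact (n + 1) / t ^ (n + 2)"
  by (auto simp: loc_form_def bform_def param_def jac_def power_divide power2_eq_square split: option.splits)

lemma loc_form_bform_Some_Some:
  "loc_form (bform (Some a) n) (Some b) t = - fact (n + 1) / ((b - a) + t) ^ (n + 2)"
  by (simp add: loc_form_def bform_def param_def jac_def algebra_simps)

lemma loc_form_bform_Some_None:
  "loc_form (bform (Some a) n) None t = fact (n + 1) * (t ^ n / (1 - a * t) ^ (n + 2))"
proof (cases "t = 0")
  case False
  have "1 / t - a = (1 - a * t) / t" using False by (simp add: field_simps)
  then show ?thesis using False
    by (simp add: loc_form_def bform_def param_def jac_def power_divide power2_eq_square)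
qed (simp add: bform_def)

lemma loc_form_bform_None_Some:
  "loc_form (bform None n) (Some b) t = fact (n + 1) * (t + b) ^ n"
  by (simp add: loc_form_def bform_def param_def jac_def add.commute)

lemma sec_analytic_bform: "z \<noteq> v \<Longrightarrow> sec_analytic (bform z n) v"
  unfolding sec_analytic_def
  by (cases z; cases v)
     (auto simp: loc_form_bform_Some_Some[abs_def] loc_form_bform_Some_None[abs_def]
        loc_form_bform_None_Some[abs_def] intro!: analytic_intros)

lemma sec_analytic_kern: "z \<noteq> v \<Longrightarrow> sec_analytic (\<lambda>q. kern q v) z"
  using sec_analytic_bform[of v z 0] by (simp add: bform_0 kern_sym[of _ v])

text \<open>
  A sequence of functions in which each is the derivative of the preceding one.
\<close>

lemma higher_deriv_family:
  fixes F :: "nat \<Rightarrow> complex \<Rightarrow> complex"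
  assumes "open S" and F: "\<And>n t. t \<in> S \<Longrightarrow> (F n has_field_derivative F (Suc n) t) (at t)"
  shows "t \<in> S \<Longrightarrow> (deriv ^^ n) (F 0) t = F n t"
proof (induction n arbitrary: t)
  case (Suc n)
  have "\<forall>\<^sub>F t in nhds t. (deriv ^^ n) (F 0) t = F n t"
    using eventually_nhds_in_open[OF \<open>open S\<close> Suc.prems] by eventually_elim (rule Suc.IH)
  then have "deriv ((deriv ^^ n) (F 0)) t = deriv (F n) t"
    by (rule deriv_cong_ev) simp
  also have "\<dots> = F (Suc n) t"
    by (rule DERIV_imp_deriv[OF F[OF Suc.prems]])
  finally show ?case by simp
qed simp

lemma higher_deriv_inverse_power:
  assumes "c \<noteq> 0"
  shows "(deriv ^^ m) (\<lambda>t. fact k / (c + t) ^ (k + 1)) 0 = (-1) ^ m * fact (k + m) / (c::complex) ^ (k + 1 + m)"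
proof -
  let ?F = "\<lambda>m t. (-1) ^ m * fact (k + m) * inverse ((c + t) ^ (k + 1 + m))"
  have "(deriv ^^ m) (?F 0) 0 = ?F m 0"
  proof (rule higher_deriv_family)
    show "open {t. c + t \<noteq> 0}"
      by (intro open_Collect_neq continuous_intros)
    show "(?F n has_field_derivative ?F (Suc n) t) (at t)" if "t \<in> {t. c + t \<noteq> 0}" for n t
    proof -
      have nz: "c + t \<noteq> 0" using that by simp
      have "(?F n has_field_derivative (-1) ^ n * fact (k + n) *
          (- (inverse ((c + t) ^ (k + 1 + n)) * (of_nat (k + 1 + n) * (c + t) ^ (k + n)) * inverse ((c + t) ^ (k + 1 + n))))) (at t)"
        by (rule derivative_eq_intros refl | use nz in simp)+
      also have "(-1) ^ n * fact (k + n) *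
          (- (inverse ((c + t) ^ (k + 1 + n)) * (of_nat (k + 1 + n) * (c + t) ^ (k + n)) * inverse ((c + t) ^ (k + 1 + n))))
          = ?F (Suc n) t"
      proof -
        define w P where "w = c + t" and "P = (c + t) ^ (k + n)"
        have P: "(c + t) ^ (k + 1 + n) = w * P" "(c + t) ^ (k + 1 + Suc n) = w * (w * P)"
          by (simp_all add: w_def P_def)
        have "w \<noteq> 0" "P \<noteq> 0" using nz by (simp_all add: w_def P_def)
        then show ?thesis
          unfolding P P_def[symmetric] by (simp add: field_simps)
      qed
      finally show ?thesis .
    qed
  qed (use assms in simp)
  then show ?thesis by (simp add: field_simps)
qed

lemma higher_deriv_shifted_power:
  "(deriv ^^ n) (\<lambda>t. (t + a) ^ m) 0 = of_nat (fact n * (m choose n)) * (a::complex) ^ (m - n)"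
proof -
  let ?F = "\<lambda>n t. of_nat (fact n * (m choose n)) * (t + a) ^ (m - n)"
  have "(deriv ^^ n) (?F 0) 0 = ?F n 0"
  proof (rule higher_deriv_family[of UNIV])
    fix n t
    have "(m - n) * (m choose n) = Suc n * (m choose Suc n)"
      by (metis Suc_times_binomial_add binomial_absorb_comp binomial_absorption mult.commute)
    then have eq: "fact n * (m choose n) * (m - n) = fact (Suc n) * (m choose Suc n)"
      by (simp add: algebra_simps)
    have "(?F n has_field_derivative of_nat (fact n * (m choose n)) * (of_nat (m - n) * (t + a) ^ (m - n - 1))) (at t)"
      by (rule derivative_eq_intros refl | simp)+
    also have "of_nat (fact n * (m choose n)) * (of_nat (m - n) * (t + a) ^ (m - n - 1)) = ?F (Suc n) t"
      by (simp only: mult.assoc[symmetric] of_nat_mult[symmetric] eq) simp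
    finally show "(?F n has_field_derivative ?F (Suc n) t) (at t)" .
  qed auto
  then show ?thesis by simp
qed

lemma fps_mult_one_minus_nth:
  "fps_nth (F * (1 - fps_const a * fps_X)) m = fps_nth F m - (if m = 0 then 0 else a * fps_nth F (m - 1) :: complex)"
  by (simp add: right_diff_distrib mult.commute[of F] mult.assoc)

text \<open>
  The Taylor series \<open>G n\<close> of \<open>t\<^sup>n / (1 - a t)\<^sup>n\<^sup>+\<^sup>2\<close> at \<open>0\<close>; Pascal's rule is the recursion
  \<open>G (n + 1) (1 - a t) = t G n\<close>.
\<close>

lemma higher_deriv_mobius_power:
  "(deriv ^^ m) (\<lambda>t. t ^ n / (1 - a * t) ^ (n + 2)) 0
     = of_nat (fact m * (Suc m choose Suc n)) * (a::complex) ^ (m - n)"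
proof -
  define G where "G = (\<lambda>n. Abs_fps (\<lambda>m. of_nat (Suc m choose Suc n) * a ^ (m - n)))"
  let ?L = "1 - fps_const a * fps_X"
  have step: "G (Suc n) * ?L = fps_X * G n" for n
  proof (rule fps_ext)
    fix m
    show "fps_nth (G (Suc n) * ?L) m = fps_nth (fps_X * G n) m"
    proof (cases m)
      case (Suc k)
      have "of_nat (Suc k choose Suc (Suc n)) * (a * a ^ (k - Suc n)) = of_nat (Suc k choose Suc (Suc n)) * a ^ (k - n)"
      proof (cases "n < k")
        case True
        then have "k - n = Suc (k - Suc n)" by simp
        then show ?thesis by simp
      qed (simp add: binomial_eq_0)
      moreover have "fps_nth (G (Suc n) * ?L) m = of_nat (Suc (Suc k) choose Suc (Suc n)) * a ^ (k - n)
          - of_nat (Suc k choose Suc (Suc n)) * (a * a ^ (k - Suc n))"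
        unfolding fps_mult_one_minus_nth using Suc
        by (simp add: G_def mult.left_commute del: binomial_Suc_Suc)
      moreover have "fps_nth (fps_X * G n) m = of_nat (Suc k choose Suc n) * a ^ (k - n)"
        using Suc by (simp add: G_def del: binomial_Suc_Suc)
      ultimately show ?thesis
        by (simp only: binomial_Suc_Suc[of "Suc k" "Suc n"] of_nat_add) (simp add: distrib_right del: binomial_Suc_Suc)
    qed (simp add: fps_mult_one_minus_nth G_def)
  qed
  have H: "Abs_fps (\<lambda>m. a ^ m) * ?L = 1"
    by (rule fps_ext) (auto simp: fps_mult_one_minus_nth power_eq_if)
  have "G 0 * ?L = Abs_fps (\<lambda>m. a ^ m)"
    by (rule fps_ext) (auto simp: fps_mult_one_minus_nth G_def power_eq_if algebra_simps)
  with H have G0: "G 0 * ?L ^ 2 = 1"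
    by (simp add: power2_eq_square mult.assoc[symmetric])
  have "G n * ?L ^ (n + 2) = fps_X ^ n"
  proof (induction n)
    case (Suc n)
    have "G (Suc n) * ?L ^ (Suc n + 2) = (G (Suc n) * ?L) * ?L ^ (n + 2)"
      by (simp add: mult.assoc)
    also have "\<dots> = fps_X ^ Suc n"
      using Suc by (simp add: step mult.assoc)
    finally show ?case .
  qed (use G0 in \<open>simp add: power2_eq_square\<close>)
  note G_L = this
  have "fps_nth (?L ^ (n + 2)) 0 = 1"
    by (simp add: fps_power_zeroth power2_eq_square)
  then have "?L ^ (n + 2) \<noteq> 0"
    by (metis fps_zero_nth one_neq_zero)
  then have G: "fps_X ^ n / ?L ^ (n + 2) = G n"
    unfolding G_L[symmetric] by (rule nonzero_mult_div_cancel_right)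
  have "(\<lambda>t. t ^ n / (1 - a * t) ^ (n + 2)) has_fps_expansion fps_X ^ n / ?L ^ (n + 2)"
    by (intro fps_expansion_intros) (simp add: fps_power_zeroth)
  then have "(deriv ^^ m) (\<lambda>t. t ^ n / (1 - a * t) ^ (n + 2)) 0 = fact m * fps_nth (G n) m"
    unfolding G by (simp add: fps_nth_fps_expansion)
  then show ?thesis by (simp add: G_def del: binomial_Suc_Suc)
qed

lemma jet_bform_Some_Some:
  assumes "a \<noteq> b"
  shows "jet m (Some b) (bform (Some a) n) = - ((-1) ^ m * fact (n + m + 1) / (b - a) ^ (n + m + 2))"
proof -
  have "jet m (Some b) (bform (Some a) n) = (deriv ^^ m) (\<lambda>t. - (fact (n + 1) / ((b - a) + t) ^ (n + 1 + 1))) 0"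
    by (simp add: jet_def loc_form_bform_Some_Some[abs_def])
  also have "\<dots> = - ((deriv ^^ m) (\<lambda>t. (fact (n + 1) / ((b - a) + t) ^ (n + 1 + 1))) 0)"
    using assms by (intro higher_deriv_uminus_at analytic_intros) auto
  also have "\<dots> = - ((-1) ^ m * fact (n + 1 + m) / (b - a) ^ (n + 1 + 1 + m))"
    using assms by (subst higher_deriv_inverse_power) auto
  finally show ?thesis by (simp add: add_ac)
qed

lemma jet_bform_Some_None:
  "jet m None (bform (Some a) n) = of_nat (fact (n + 1) * fact m * (Suc m choose Suc n)) * a ^ (m - n)"
proof -
  have "jet m None (bform (Some a) n) = (deriv ^^ m) (\<lambda>t. fact (n + 1) * (t ^ n / (1 - a * t) ^ (n + 2))) 0"
    by (simp add: jet_def loc_form_bform_Some_None[abs_def])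
  also have "\<dots> = fact (n + 1) * (deriv ^^ m) (\<lambda>t. t ^ n / (1 - a * t) ^ (n + 2)) 0"
    by (intro higher_deriv_cmult' analytic_intros) auto
  finally show ?thesis
    unfolding higher_deriv_mobius_power by (simp only: of_nat_mult of_nat_fact mult.assoc)
qed

lemma jet_bform_None_Some:
  "jet m (Some b) (bform None n) = of_nat (fact (n + 1) * fact m * (n choose m)) * b ^ (n - m)"
proof -
  have "jet m (Some b) (bform None n) = (deriv ^^ m) (\<lambda>t. fact (n + 1) * (t + b) ^ n) 0"
    by (simp add: jet_def loc_form_bform_None_Some[abs_def])
  also have "\<dots> = fact (n + 1) * (deriv ^^ m) (\<lambda>t. (t + b) ^ n) 0"
    by (intro higher_deriv_cmult' analytic_intros)
  finally show ?thesis
    unfolding higher_deriv_shifted_power by (simp only: of_nat_mult of_nat_fact mult.assoc)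
qed

text \<open>
  Both sides are the same mixed derivative of the kernel. The case of a finite point and infinity comes
  down to \<open>(n + 1) (m + 1 choose n + 1) = (m + 1) (m choose n)\<close>.
\<close>

theorem jet_bform_sym:
  assumes "z \<noteq> z'"
  shows "jet m z' (bform z n) = jet n z (bform z' m)"
proof -
  have mixed: "jet m None (bform (Some a) n) = jet n (Some a) (bform None m)" for a m n
  proof -
    have "fact (n + 1) * fact m * (Suc m choose Suc n) = fact m * fact n * (Suc n * (Suc m choose Suc n))"
      by (simp add: algebra_simps del: binomial_Suc_Suc)
    also have "\<dots> = fact (m + 1) * fact n * (m choose n)"
      by (simp only: Suc_times_binomial) (simp add: algebra_simps)
    finally show ?thesis
      unfolding jet_bform_Some_None jet_bform_None_Some by (simp only:)
  qed
  show ?thesis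
  proof (cases z; cases z')
    fix a b assume ab: "z = Some a" "z' = Some b"
    have "(-1) ^ m / (b - a) ^ (n + m + 2) = (-1) ^ n / (a - b) ^ (n + m + 2)"
    proof -
      have "(a - b) ^ (n + m + 2) = (-1) ^ (n + m + 2) * (b - a) ^ (n + m + 2)"
        by (metis minus_diff_eq power_minus)
      then show ?thesis by (simp add: power_add divide_simps)
    qed
    then have eq: "c * ((-1) ^ m / (b - a) ^ (n + m + 2)) = c * ((-1) ^ n / (a - b) ^ (n + m + 2))" for c
      by simp
    show ?thesis
      using assms ab eq[of "fact (n + m + 1)"]
      by (simp add: jet_bform_Some_Some add_ac mult.commute)
  qed (use assms mixed in auto)
qed

lemma jet_kern:
  assumes "z \<noteq> v"
  shows "jet n z (\<lambda>q. kern q v) = bform z n v"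
  using jet_bform_sym[OF assms, of 0 n] by (simp add: bform_0 kern_sym[of _ v])

section \<open>Normal forms of meromorphic sections\<close>

lemma nicely_meromorphic_cong_nhds:
  assumes "\<forall>\<^sub>F t in nhds z. f t = g t"
  shows "f nicely_meromorphic_on {z} \<longleftrightarrow> g nicely_meromorphic_on {z}"
proof -
  have *: "\<forall>\<^sub>F t in at z. f t = g t"
    using assms by (simp add: eventually_nhds_conv_at)
  have fg: "f z = g z" using assms by (rule eventually_nhds_x_imp_x)
  have "f meromorphic_on {z} \<longleftrightarrow> g meromorphic_on {z}"
    by (rule meromorphic_on_cong) (use * in auto)
  moreover have "is_pole f z \<longleftrightarrow> is_pole g z"
    by (rule is_pole_cong[OF * refl])
  moreover have "f \<midarrow>z\<rightarrow> f z \<longleftrightarrow> g \<midarrow>z\<rightarrow> g z"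
    unfolding fg by (rule tendsto_cong[OF *])
  ultimately show ?thesis by (simp add: nicely_meromorphic_on_def fg)
qed

text \<open>
  Meromorphic sections whose values at single points are arbitrary, for instance pointwise sums of
  meromorphic forms. Their normal forms are meromorphic forms.
\<close>

definition local_mero :: "(proj_line \<Rightarrow> complex) \<Rightarrow> bool" where
  "local_mero s \<longleftrightarrow> (\<forall>p. loc_form s p meromorphic_on {0})"

lemma mero_form_local_mero: "mero_form \<alpha> \<Longrightarrow> local_mero \<alpha>"
  by (simp add: mero_form_def local_mero_def nicely_meromorphic_on_def)

lemma local_mero_punctured:
  assumes "local_mero s"
  shows "\<forall>\<^sub>F t in at 0. sec_analytic s (param p t)"
proof -
  have "isolated_singularity_at (loc_form s p) 0"
    using assms by (auto simp: local_mero_def meromorphic_at_iff)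
  then obtain r where r: "r > 0" "loc_form s p analytic_on ball 0 r - {0}"
    by (auto simp: isolated_singularity_at_def)
  have "\<forall>\<^sub>F t in at 0. t \<in> ball 0 r - {0}"
    using r(1) by (intro eventually_at_in_open) auto
  then show ?thesis
  proof eventually_elim
    case (elim t)
    then show ?case
      using r(2) by (intro loc_form_analytic_param) (auto intro: analytic_on_subset)
  qed
qed

lemma normal_form_analytic: "sec_analytic s p \<Longrightarrow> normal_form s p = s p"
  by (simp add: normal_form_def sec_analytic_def)

lemma normal_form_punctured:
  "local_mero s \<Longrightarrow> \<forall>\<^sub>F t in at 0. normal_form s (param p t) = s (param p t)"
  by (drule local_mero_punctured[of s p], erule eventually_mono) (rule normal_form_analytic)

lemma loc_form_normal_form_punctured:
  "local_mero s \<Longrightarrow> \<forall>\<^sub>F t in at 0. loc_form (normal_form s) p t = loc_form s p t"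
  by (drule normal_form_punctured[of s p], erule eventually_mono) (simp add: loc_form_def)

lemma loc_form_normal_form:
  assumes "local_mero s"
  shows "\<forall>\<^sub>F t in nhds 0. loc_form (normal_form s) p t = remove_sings (loc_form s p) t"
proof -
  have "isolated_singularity_at (loc_form s p) 0"
    using assms by (auto simp: local_mero_def meromorphic_at_iff)
  from eventually_remove_sings_eq_at[OF this] loc_form_normal_form_punctured[OF assms, of p]
  have "\<forall>\<^sub>F t in at 0. loc_form (normal_form s) p t = remove_sings (loc_form s p) t"
    by eventually_elim simp
  then show ?thesis
    by (simp add: eventually_nhds_conv_at) (simp add: normal_form_def)
qed

lemma mero_form_normal_form:
  assumes "local_mero s"
  shows "mero_form (normal_form s)"
  unfolding mero_form_def
proof
  fix p
  have "remove_sings (loc_form s p) nicely_meromorphic_on {0}"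
    using assms by (intro remove_sings_nicely_meromorphic) (auto simp: local_mero_def)
  then show "loc_form (normal_form s) p nicely_meromorphic_on {0}"
    using nicely_meromorphic_cong_nhds[OF loc_form_normal_form[OF assms]] by simp
qed

lemma is_pole_normal_form:
  "local_mero s \<Longrightarrow> is_pole (loc_form (normal_form s) p) 0 \<longleftrightarrow> is_pole (loc_form s p) 0"
  by (rule is_pole_cong[OF loc_form_normal_form_punctured refl])

lemma residue_normal_form:
  "local_mero s \<Longrightarrow> residue (loc_form (normal_form s) p) 0 = residue (loc_form s p) 0"
  by (rule residue_cong[OF loc_form_normal_form_punctured refl])

lemma normal_form_eqI:
  assumes "mero_form \<alpha>" "\<And>p. \<forall>\<^sub>F t in at 0. s (param p t) = \<alpha> (param p t)"
  shows "normal_form s = \<alpha>"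
proof
  fix p
  have ev: "\<forall>\<^sub>F t in at 0. loc_form s p t = loc_form \<alpha> p t"
    using assms(2)[of p] by eventually_elim (simp add: loc_form_def)
  have "(is_pole (loc_form \<alpha> p) 0 \<and> loc_form \<alpha> p 0 = 0) \<or> loc_form \<alpha> p \<midarrow>0\<rightarrow> loc_form \<alpha> p 0"
    using assms(1) by (auto simp: mero_form_def nicely_meromorphic_on_def)
  then have "remove_sings (loc_form s p) 0 = loc_form \<alpha> p 0"
  proof
    assume "is_pole (loc_form \<alpha> p) 0 \<and> loc_form \<alpha> p 0 = 0"
    then show ?thesis using is_pole_cong[OF ev refl] by simp
  next
    assume "loc_form \<alpha> p \<midarrow>0\<rightarrow> loc_form \<alpha> p 0"
    then show ?thesis using tendsto_cong[OF ev] by (intro remove_sings_eqI) simp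
  qed
  then show "normal_form s p = \<alpha> p" by (simp add: normal_form_def)
qed

lemma mero_form_no_pole_analytic:
  "mero_form \<alpha> \<Longrightarrow> \<not> is_pole (loc_form \<alpha> p) 0 \<Longrightarrow> sec_analytic \<alpha> p"
  unfolding mero_form_def sec_analytic_def
  by (blast intro: nicely_meromorphic_on_imp_analytic_at)

lemma sec_analytic_no_pole: "sec_analytic \<alpha> p \<Longrightarrow> \<not> is_pole (loc_form \<alpha> p) 0"
  unfolding sec_analytic_def
  using analytic_at_imp_no_pole by blast

lemma forms_in_analytic: "\<alpha> \<in> forms_in D \<Longrightarrow> p \<notin> D \<Longrightarrow> sec_analytic \<alpha> p"
  by (auto simp: forms_in_def intro: mero_form_no_pole_analytic)

section \<open>The vector space of residue-free forms\<close>

lemma loc_form_add: "loc_form (\<lambda>p. \<alpha> p + \<beta> p) p = (\<lambda>t. loc_form \<alpha> p t + loc_form \<beta> p t)"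
  by (simp add: loc_form_def distrib_left fun_eq_iff)

lemma loc_form_scale: "loc_form (\<lambda>p. c * \<alpha> p) p = (\<lambda>t. c * loc_form \<alpha> p t)"
  by (simp add: loc_form_def fun_eq_iff)

lemma meromorphic_laurent_0:
  assumes "f meromorphic_on {0}"
  obtains F where "f has_laurent_expansion F"
  using assms by (auto simp: meromorphic_on_def)

lemma local_mero_add: "local_mero \<alpha> \<Longrightarrow> local_mero \<beta> \<Longrightarrow> local_mero (\<lambda>p. \<alpha> p + \<beta> p)"
  by (simp add: local_mero_def loc_form_add meromorphic_on_add)

lemma form_add_closed:
  assumes "\<alpha> \<in> forms_in D" "\<beta> \<in> forms_in D"
  shows "form_add \<alpha> \<beta> \<in> forms_in D"
proof -
  let ?s = "\<lambda>p. \<alpha> p + \<beta> p"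
  have lm: "local_mero \<alpha>" "local_mero \<beta>"
    using assms by (auto simp: forms_in_def intro: mero_form_local_mero)
  note s = local_mero_add[OF lm]
  have "residue (loc_form ?s p) 0 = 0" for p
  proof -
    obtain F G where FG: "loc_form \<alpha> p has_laurent_expansion F" "loc_form \<beta> p has_laurent_expansion G"
      using lm unfolding local_mero_def by (meson meromorphic_laurent_0)
    have "residue (loc_form ?s p) 0 = fls_residue (F + G)"
      unfolding loc_form_add by (intro has_laurent_expansion_residue_0 has_laurent_expansion_add FG)
    also have "\<dots> = fls_residue F + fls_residue G" by simp
    also have "\<dots> = 0"
      using assms has_laurent_expansion_residue_0[OF FG(1)] has_laurent_expansion_residue_0[OF FG(2)]
      by (simp add: forms_in_def)
    finally show ?thesis .
  qed
  moreover have "\<not> is_pole (loc_form ?s p) 0" if "p \<notin> D" for p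
    by (intro sec_analytic_no_pole sec_analytic_add forms_in_analytic[OF _ that] assms)
  ultimately show ?thesis
    unfolding form_add_def forms_in_def
    using mero_form_normal_form[OF s] is_pole_normal_form[OF s] residue_normal_form[OF s] by auto
qed

lemma form_add_value:
  assumes "\<alpha> \<in> forms_in D" "\<beta> \<in> forms_in D" "p \<notin> D"
  shows "form_add \<alpha> \<beta> p = \<alpha> p + \<beta> p"
  unfolding form_add_def
  by (intro normal_form_analytic sec_analytic_add forms_in_analytic[of _ D] assms)

lemma form_scale_closed:
  assumes "\<alpha> \<in> forms_in D"
  shows "form_scale c \<alpha> \<in> forms_in D"
proof -
  have "mero_form (form_scale c \<alpha>)"
    using assms by (auto simp: forms_in_def mero_form_def form_scale_def loc_form_scale)
  moreover have "residue (loc_form (form_scale c \<alpha>) p) 0 = 0" for p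
  proof -
    obtain F where F: "loc_form \<alpha> p has_laurent_expansion F"
      using assms meromorphic_laurent_0
      by (auto simp: forms_in_def mero_form_def nicely_meromorphic_on_def)
    have "residue (loc_form (form_scale c \<alpha>) p) 0 = fls_residue (fls_const c * F)"
      unfolding form_scale_def loc_form_scale
      by (intro has_laurent_expansion_residue_0 has_laurent_expansion_mult F has_laurent_expansion_const)
    also have "\<dots> = c * fls_residue F" by simp
    also have "\<dots> = 0"
      using assms has_laurent_expansion_residue_0[OF F] by (simp add: forms_in_def)
    finally show ?thesis .
  qed
  moreover have "\<not> is_pole (loc_form (form_scale c \<alpha>) p) 0" if "p \<notin> D" for p
    unfolding form_scale_def
    by (intro sec_analytic_no_pole sec_analytic_scale forms_in_analytic[OF _ that] assms)
  ultimately show ?thesis by (auto simp: forms_in_def)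
qed

section \<open>The basic forms have no residues\<close>

lemma loc_form_bform_self_fun: "loc_form (bform z n) z = (\<lambda>t. - fact (n + 1) / t ^ (n + 2))"
  by (rule ext) (rule loc_form_bform_self)

lemma is_pole_bform_self: "is_pole (loc_form (bform z n) z) 0"
proof -
  have "is_pole (\<lambda>t::complex. - fact (n + 1) / (t - 0) ^ (n + 2)) 0"
    by (rule is_pole_basic[of _ UNIV]) (auto simp del: fact_Suc intro!: holomorphic_intros)
  then show ?thesis by (simp only: loc_form_bform_self_fun diff_zero)
qed

lemma mero_form_bform: "mero_form (bform z n)"
  unfolding mero_form_def
proof
  fix p
  show "loc_form (bform z n) p nicely_meromorphic_on {0}"
  proof (cases "p = z")
    case True
    have "loc_form (bform z n) z meromorphic_on {0}"
      unfolding loc_form_bform_self_fun by (intro meromorphic_intros)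
    then show ?thesis
      using True is_pole_bform_self[of z n] loc_form_bform_self[of z n 0]
      by (simp add: nicely_meromorphic_on_def)
  next
    case False
    then show ?thesis
      using sec_analytic_bform[of z p n] by (simp add: sec_analytic_def analytic_on_imp_nicely_meromorphic_on)
  qed
qed

lemma bform_in_forms:
  assumes "z \<in> D"
  shows "bform z n \<in> forms_in D"
proof -
  have "residue (loc_form (bform z n) p) 0 = 0" for p
  proof (cases "p = z")
    case True
    have "residue (\<lambda>t. - fact (n + 1) / t ^ Suc (n + 1)) 0 = (deriv ^^ (n + 1)) (\<lambda>_. - fact (n + 1)) (0::complex) / fact (n + 1)"
      by (rule residue_holomorphic_over_power'[of UNIV]) auto
    also have "\<dots> = 0" by (simp only: higher_deriv_const) simp
    finally show ?thesis unfolding True loc_form_bform_self_fun by (simp only: add_Suc_right numeral_2_eq_2 One_nat_def add_0_right)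
  next
    case False
    then obtain S where "open S" "0 \<in> S" "loc_form (bform z n) p holomorphic_on S"
      using sec_analytic_bform[of z p n] by (auto simp: sec_analytic_def analytic_at)
    then show ?thesis by (rule residue_holo)
  qed
  moreover have "p \<in> D" if "is_pole (loc_form (bform z n) p) 0" for p
    using that sec_analytic_bform[of z p n] sec_analytic_no_pole assms by metis
  ultimately show ?thesis using mero_form_bform by (auto simp: forms_in_def)
qed

section \<open>Liouville's theorem and the identity theorem for forms\<close>

lemma loc_form_Some: "loc_form \<alpha> (Some a) = (\<lambda>t. \<alpha> (Some (a + t)))"
  by (simp add: loc_form_def param_def jac_def fun_eq_iff)

lemma nicely_meromorphic_on_UNIV_shift:
  assumes "\<And>a. (\<lambda>t. f (a + t)) nicely_meromorphic_on {0}"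
  shows "f nicely_meromorphic_on UNIV"
  unfolding nicely_meromorphic_on_def
proof (intro conjI ballI)
  show "f meromorphic_on UNIV"
    using assms by (auto simp: nicely_meromorphic_on_def meromorphic_on_def)
  fix a
  show "is_pole f a \<and> f a = 0 \<or> f \<midarrow>a\<rightarrow> f a"
    using assms[of a] unfolding nicely_meromorphic_on_def
    by (simp add: is_pole_shift_0[of f a] LIM_offset_zero_iff[of a f])
qed

lemma mero_form_affine:
  assumes "mero_form \<alpha>"
  shows "(\<lambda>x. \<alpha> (Some x)) nicely_meromorphic_on UNIV"
  using assms
  by (intro nicely_meromorphic_on_UNIV_shift) (simp add: mero_form_def flip: loc_form_Some)

lemma affine_zero_imp_zero:
  assumes "mero_form \<alpha>" "\<And>x. \<alpha> (Some x) = 0"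
  shows "\<alpha> p = 0"
proof (cases p)
  case None
  let ?f = "loc_form \<alpha> None"
  have f0: "?f t = 0" if "t \<noteq> 0" for t
    using that assms(2) by (simp add: loc_form_def param_def)
  have "(is_pole ?f 0 \<and> ?f 0 = 0) \<or> ?f \<midarrow>0\<rightarrow> ?f 0"
    using assms(1) by (auto simp: mero_form_def nicely_meromorphic_on_def)
  moreover have "?f \<midarrow>0\<rightarrow> 0"
    by (rule tendsto_eventually) (auto simp: eventually_at_filter f0)
  ultimately have "?f 0 = 0" using LIM_unique by blast
  then show ?thesis using None by simp
qed (use assms in simp)

lemma eventually_param_None_Some: "\<forall>\<^sub>F t in at 0. \<exists>x. param p t = Some x"
  by (auto simp: eventually_at_filter param_def split: option.splits)

lemma mero_form_no_poles_zero:
  assumes "mero_form \<alpha>" "\<And>p. \<not> is_pole (loc_form \<alpha> p) 0"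
  shows "\<alpha> p = 0"
proof -
  let ?f = "\<lambda>x. \<alpha> (Some x)"
  have an: "sec_analytic \<alpha> p" for p
    using assms by (intro mero_form_no_pole_analytic)
  have "?f analytic_on UNIV"
  proof (rule nicely_meromorphic_without_singularities[OF mero_form_affine[OF assms(1)]], intro ballI)
    fix a show "\<not> is_pole ?f a"
      using assms(2)[of "Some a"] by (simp add: loc_form_Some is_pole_shift_0[of ?f a])
  qed
  then have hol: "?f holomorphic_on UNIV" by (simp add: analytic_on_open)
  have lim: "(?f \<longlongrightarrow> 0) at_infinity"
  proof -
    have cont: "loc_form \<alpha> None \<midarrow>0\<rightarrow> loc_form \<alpha> None 0"
      using an[of None] analytic_at_imp_isCont unfolding sec_analytic_def isCont_def by blast
    have "((\<lambda>t. - t\<^sup>2 * loc_form \<alpha> None t) \<longlongrightarrow> - 0\<^sup>2 * loc_form \<alpha> None 0) (at 0)"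
      by (intro tendsto_intros cont)
    then have lim0: "((\<lambda>t. - t\<^sup>2 * loc_form \<alpha> None t) \<longlongrightarrow> 0) (at 0)" by simp
    have ev: "\<forall>\<^sub>F t in at 0. - t\<^sup>2 * loc_form \<alpha> None t = ?f (inverse t)"
      by (auto simp: eventually_at_filter loc_form_def param_def jac_def divide_inverse)
    have "((\<lambda>t. ?f (inverse t)) \<longlongrightarrow> 0) (at 0)"
      using tendsto_cong[OF ev] lim0 by simp
    then show ?thesis
      by (rule lim_at_infinity_0[THEN iffD2, unfolded o_def])
  qed
  have "?f x = 0" for x
    by (rule Liouville_weak[OF hol lim])
  then show ?thesis by (rule affine_zero_imp_zero[OF assms(1)])
qed

lemma mero_form_identity:
  assumes "mero_form \<alpha>" "\<forall>\<^sub>F t in nhds 0. \<alpha> (param p t) = 0"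
  shows "\<alpha> q = 0"
proof -
  let ?f = "\<lambda>x. \<alpha> (Some x)"
  have "\<forall>\<^sub>F t in at 0. \<forall>\<^sub>F r in nhds 0. \<alpha> (param (param p t) r) = 0"
    using eventually_param_eventually[of "\<lambda>q. \<alpha> q = 0", OF assms(2)]
    by (simp add: eventually_nhds_conv_at)
  from eventually_conj[OF this eventually_param_None_Some[of p]]
  have "\<forall>\<^sub>F t in at (0::complex). \<exists>b. \<forall>\<^sub>F r in nhds 0. \<alpha> (param (Some b) r) = 0"
    by (rule eventually_mono) metis
  then obtain b where "\<forall>\<^sub>F r in nhds 0. \<alpha> (param (Some b) r) = 0"
    using eventually_happens'[OF at_neq_bot] by blast
  then have "\<forall>\<^sub>F r in at 0. ?f (b + r) = 0"
    by (simp add: param_def eventually_nhds_conv_at)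
  then have zero: "\<forall>\<^sub>F x in at b. ?f x = 0"
    by (simp add: at_to_0' eventually_filtermap add.commute)
  have "(\<forall>x\<in>UNIV. ?f x = 0) \<or> (\<forall>\<^sub>\<approx>x\<in>UNIV. ?f x \<noteq> 0)"
    by (rule nicely_meromorphic_imp_constant_or_avoid[OF mero_form_affine[OF assms(1)]]) auto
  moreover have "\<not> (\<forall>\<^sub>\<approx>x\<in>UNIV. ?f x \<noteq> 0)"
  proof
    assume "\<forall>\<^sub>\<approx>x\<in>UNIV. ?f x \<noteq> 0"
    then have "\<forall>\<^sub>F x in at b. ?f x \<noteq> 0"
      by (auto simp: eventually_cosparse_open_eq)
    with zero have "\<forall>\<^sub>F x in at b. False" by eventually_elim simp
    then show False by simp
  qed
  ultimately show ?thesis using affine_zero_imp_zero[OF assms(1)] by blast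
qed

lemma finite_poles:
  assumes "mero_form \<alpha>"
  shows "finite {p. is_pole (loc_form \<alpha> p) 0}"
proof -
  let ?f = "\<lambda>x. \<alpha> (Some x)"
  have pole_iff: "is_pole (loc_form \<alpha> (Some a)) 0 \<longleftrightarrow> is_pole ?f a" for a
    by (simp add: loc_form_Some is_pole_shift_0[of ?f a])
  have "\<forall>\<^sub>F t in at 0. sec_analytic \<alpha> (param None t)"
    by (intro local_mero_punctured mero_form_local_mero assms)
  then obtain d where d: "d > 0" "\<And>t. t \<noteq> 0 \<Longrightarrow> norm t < d \<Longrightarrow> sec_analytic \<alpha> (param None t)"
    by (auto simp: eventually_at)
  have bd: "norm a \<le> 1 / d" if "is_pole ?f a" for a
  proof (rule ccontr)
    assume "\<not> norm a \<le> 1 / d"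
    then have a: "norm a > 1 / d" by simp
    then have "a \<noteq> 0" using d(1) by auto
    have "norm (1 / a) < d"
      using a d(1) \<open>a \<noteq> 0\<close> by (simp add: norm_divide field_simps)
    then have "sec_analytic \<alpha> (Some a)"
      using d(2)[of "1 / a"] \<open>a \<noteq> 0\<close> by (simp add: param_def)
    then show False using sec_analytic_no_pole that pole_iff by blast
  qed
  have "{a. is_pole ?f a} sparse_in UNIV"
  proof -
    have "\<forall>\<^sub>\<approx>x\<in>UNIV. \<not> is_pole ?f x"
      using mero_form_affine[OF assms]
      by (intro meromorphic_on_imp_not_pole_cosparse) (simp add: nicely_meromorphic_on_def)
    then show ?thesis by (simp add: eventually_cosparse)
  qed
  then have "{a. is_pole ?f a} sparse_in cball 0 (1 / d)"
    by (rule sparse_in_subset) simp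
  from sparse_in_compact_finite[OF this compact_cball]
  have "finite ({a. is_pole ?f a} \<inter> cball 0 (1 / d))"
    by (simp add: Int_commute)
  moreover have "{a. is_pole ?f a} \<inter> cball 0 (1 / d) = {a. is_pole ?f a}"
    using bd by auto
  ultimately have "finite (Some ` {a. is_pole ?f a})" by simp
  moreover have "{p. is_pole (loc_form \<alpha> p) 0} \<subseteq> insert None (Some ` {a. is_pole ?f a})"
  proof
    fix p assume "p \<in> {p. is_pole (loc_form \<alpha> p) 0}"
    then show "p \<in> insert None (Some ` {a. is_pole ?f a})"
      by (cases p) (simp_all add: pole_iff)
  qed
  ultimately show ?thesis by (meson finite_insert finite_subset)
qed

section \<open>Partial fractions\<close>

text \<open>
  Subtracting the principal part of a meromorphic function without residue. Each term is a multiple of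
  the local expression of some \<open>b\<^sub>z\<^sub>,\<^sub>n\<close> at \<open>z\<close>; the coefficient of \<open>1 / t\<close> is missing from the sum and is
  the residue.
\<close>

lemma principal_part:
  assumes "f has_laurent_expansion F" "fls_residue F = 0"
  shows "\<exists>c N. \<not> is_pole (\<lambda>t. f t - (\<Sum>n<N. c n * (- fact (n + 1) / t ^ (n + 2)))) 0"
proof -
  define N where "N = nat (- fls_subdegree F)"
  define c where "c = (\<lambda>n. - fls_nth F (- int (n + 2)) / fact (n + 1))"
  have eq: "c n * (- fact (n + 1) / t ^ (n + 2)) = fls_nth F (- int (n + 2)) * inverse t ^ (n + 2)" for n t
    by (simp add: c_def divide_inverse power_inverse del: fact_Suc)
  define G where "G = F - (\<Sum>n<N. fls_const (fls_nth F (- int (n + 2))) * fls_X_inv ^ (n + 2))"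
  have "(\<lambda>t. f t - (\<Sum>n<N. fls_nth F (- int (n + 2)) * inverse t ^ (n + 2))) has_laurent_expansion G"
    unfolding G_def
    by (intro has_laurent_expansion_diff assms(1) has_laurent_expansion_sum has_laurent_expansion_mult
          has_laurent_expansion_const has_laurent_expansion_power has_laurent_expansion_fls_X_inv)
  moreover have "fls_nth G k = 0" if "k < 0" for k
  proof -
    have "fls_nth G k = fls_nth F k - (\<Sum>n<N. fls_nth F (- int (n + 2)) * (if k = - int (n + 2) then 1 else 0))"
      by (simp add: G_def fls_nth_sum del: power_Suc)
    also have "\<dots> = 0"
    proof (cases "k = -1")
      case True
      then show ?thesis using assms(2) by (simp add: fls_residue_def)
    next
      case False
      define m where "m = nat (- k - 2)"
      have m: "k = - int (m + 2)"
        using that False by (simp add: m_def)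
      show ?thesis
      proof (cases "m < N")
        case True
        then show ?thesis using m
          by (simp add: if_distrib[of "\<lambda>x. _ * x"] cong: if_cong)
      next
        case False
        then have "k < fls_subdegree F" using m by (simp add: N_def)
        then have "fls_nth F k = 0" by simp
        then show ?thesis using m False by (auto intro!: sum.neutral)
      qed
    qed
    finally show ?thesis .
  qed
  then have "fls_subdegree G \<ge> 0"
    by (rule fls_subdegree_ge0I)
  ultimately have "\<not> is_pole (\<lambda>t. f t - (\<Sum>n<N. fls_nth F (- int (n + 2)) * inverse t ^ (n + 2))) 0"
    using is_pole_0_imp_neg_fls_subdegree by fastforce
  then show ?thesis by (intro exI[of _ c] exI[of _ N]) (simp only: eq not_False_eq_True)
qed

text \<open>
  The difference of \<open>\<alpha>\<close> and all its principal parts has no poles, so it is zero by Liouville's theorem.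
\<close>

lemma partial_fractions:
  assumes "\<alpha> \<in> forms_in D"
  obtains P N c where "finite P" "P \<subseteq> D"
    "\<And>q. q \<notin> D \<Longrightarrow> \<alpha> q = (\<Sum>p\<in>P. \<Sum>n<N p. c p n * bform p n q)"
proof -
  define P where "P = {p. is_pole (loc_form \<alpha> p) 0}"
  have mf: "mero_form \<alpha>" and res: "residue (loc_form \<alpha> p) 0 = 0" and PD: "P \<subseteq> D" for p
    using assms by (auto simp: forms_in_def P_def)
  have "finite P" unfolding P_def by (rule finite_poles[OF mf])
  have "\<exists>c N. \<not> is_pole (\<lambda>t. loc_form \<alpha> p t - (\<Sum>n<N. c n * loc_form (bform p n) p t)) 0" for p
  proof -
    obtain F where F: "loc_form \<alpha> p has_laurent_expansion F"
      using mero_form_local_mero[OF mf] meromorphic_laurent_0 unfolding local_mero_def by blast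
    have "fls_residue F = 0"
      using has_laurent_expansion_residue_0[OF F] res by simp
    from principal_part[OF F this] show ?thesis
      by (simp only: loc_form_bform_self)
  qed
  then obtain c N where cN:
    "\<And>p. \<not> is_pole (\<lambda>t. loc_form \<alpha> p t - (\<Sum>n<N p. c p n * loc_form (bform p n) p t)) 0"
    by metis
  define b where "b = (\<lambda>p q. \<Sum>n<N p. c p n * bform p n q)"
  define s where "s = (\<lambda>q. \<alpha> q - (\<Sum>p\<in>P. b p q))"
  have loc_b: "loc_form (b p) q t = (\<Sum>n<N p. c p n * loc_form (bform p n) q t)" for p q t
    by (simp add: b_def loc_form_def sum_distrib_left mult.left_commute)
  have loc_s: "loc_form s q t = loc_form \<alpha> q t - (\<Sum>p\<in>P. loc_form (b p) q t)" for q t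
    by (simp add: s_def loc_form_def sum_distrib_left right_diff_distrib)
  have mero_b: "loc_form (b p) q meromorphic_on {0}" for p q
    unfolding loc_b[abs_def]
    using mero_form_local_mero[OF mero_form_bform]
    by (intro meromorphic_on_sum meromorphic_on_mult meromorphic_on_const) (auto simp: local_mero_def)
  have lm: "local_mero s"
    unfolding local_mero_def loc_s[abs_def]
    using mero_form_local_mero[OF mf] mero_b
    by (auto simp: local_mero_def intro!: meromorphic_on_diff meromorphic_on_sum)
  have an_b: "sec_analytic (b p) q" if "p \<noteq> q" for p q
    unfolding b_def using sec_analytic_bform[OF that] by (intro sec_analytic_sum)
  have an_sum: "sec_analytic (\<lambda>q. \<Sum>p\<in>A. b p q) q" if "q \<notin> A" for A q
  proof -
    have "sec_analytic (b p) q" if "p \<in> A" for p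
      using that \<open>q \<notin> A\<close> by (intro an_b) auto
    from sec_analytic_sum[of A b q "\<lambda>_. 1", OF this] show ?thesis by simp
  qed
  have no_pole: "\<not> is_pole (loc_form s q) 0" for q
  proof (cases "q \<in> P")
    case True
    let ?g = "\<lambda>t. loc_form \<alpha> q t - loc_form (b q) q t"
    have g: "?g meromorphic_on {0}" "\<not> is_pole ?g 0"
      using mero_form_local_mero[OF mf] mero_b[of q q] cN[of q]
      unfolding loc_b[symmetric]
      by (simp_all add: local_mero_def meromorphic_on_diff)
    let ?h = "loc_form (\<lambda>r. \<Sum>p\<in>P - {q}. b p r) q"
    have h: "?h analytic_on {0}"
      using an_sum[of q "P - {q}"] by (simp add: sec_analytic_def)
    have "(\<Sum>p\<in>P. loc_form (b p) q t) = loc_form (b q) q t + ?h t" for t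
      using sum.remove[OF \<open>finite P\<close> True, of "\<lambda>p. loc_form (b p) q t"]
      by (simp add: loc_form_def sum_distrib_left)
    then have "loc_form s q = (\<lambda>t. ?g t - ?h t)"
      by (simp add: fun_eq_iff loc_s)
    moreover have "\<not> is_pole (\<lambda>t. ?g t - ?h t) 0"
    proof -
      have iso: "isolated_singularity_at ?g 0"
        using g(1) by (simp add: meromorphic_at_iff)
      obtain l where "?g \<midarrow>0\<rightarrow> l"
        using g unfolding meromorphic_at_iff not_essential_def by blast
      with iso have "remove_sings ?g analytic_on {0}"
        by (rule remove_sings_analytic_at)
      then have "(\<lambda>t. remove_sings ?g t - ?h t) analytic_on {0}"
        using h by (rule analytic_on_diff)
      then have "\<not> is_pole (\<lambda>t. remove_sings ?g t - ?h t) 0"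
        using analytic_at_imp_no_pole by blast
      moreover have "\<forall>\<^sub>F t in at 0. remove_sings ?g t - ?h t = ?g t - ?h t"
        using eventually_remove_sings_eq_at[OF iso] by eventually_elim simp
      note is_pole_cong[OF this refl]
      ultimately show ?thesis by blast
    qed
    ultimately show ?thesis by simp
  next
    case False
    then have "sec_analytic \<alpha> q"
      using mf by (intro mero_form_no_pole_analytic) (auto simp: P_def)
    then have "sec_analytic (\<lambda>q. \<alpha> q + (- 1) * (\<Sum>p\<in>P. b p q)) q"
      by (intro sec_analytic_add sec_analytic_scale an_sum False)
    then show ?thesis by (intro sec_analytic_no_pole) (simp add: s_def)
  qed
  have zero: "normal_form s q = 0" for q
    by (rule mero_form_no_poles_zero[OF mero_form_normal_form[OF lm]])
       (simp add: is_pole_normal_form[OF lm] no_pole)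
  show thesis
  proof (rule that[OF \<open>finite P\<close> PD])
    fix q assume "q \<notin> D"
    then have "sec_analytic \<alpha> q" by (rule forms_in_analytic[OF assms])
    then have "sec_analytic (\<lambda>q. \<alpha> q + (- 1) * (\<Sum>p\<in>P. b p q)) q"
      using \<open>q \<notin> D\<close> PD by (intro sec_analytic_add sec_analytic_scale an_sum) auto
    then have "normal_form s q = s q"
      by (intro normal_form_analytic) (simp add: s_def)
    then show "\<alpha> q = (\<Sum>p\<in>P. \<Sum>n<N p. c p n * bform p n q)"
      using zero[of q] by (simp add: s_def b_def)
  qed
qed

section \<open>Coordinates\<close>

lemma loc_fun_Some: "loc_fun u (Some a) = (\<lambda>t. u (Some (a + t)))"
  by (simp add: loc_fun_def param_def fun_eq_iff)

lemma loc_fun_None: "t \<noteq> 0 \<Longrightarrow> loc_fun u None t = u (Some (1 / t))"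
  by (simp add: loc_fun_def param_def)

lemma loc_fun_0 [simp]: "loc_fun u p 0 = u p"
  by (simp add: loc_fun_def)

lemma mero_fun_affine: "mero_fun u \<Longrightarrow> (\<lambda>x. u (Some x)) nicely_meromorphic_on UNIV"
  by (rule nicely_meromorphic_on_UNIV_shift) (simp add: mero_fun_def flip: loc_fun_Some)

lemma mero_fun_None_limit:
  assumes "mero_fun u" "\<not> is_pole (loc_fun u None) 0"
  shows "((\<lambda>x. u (Some x)) \<longlongrightarrow> u None) at_infinity"
proof -
  have "loc_fun u None analytic_on {0}"
    using assms by (intro nicely_meromorphic_on_imp_analytic_at[of _ "{0}"]) (auto simp: mero_fun_def)
  then have "loc_fun u None \<midarrow>0\<rightarrow> u None"
    using analytic_at_imp_isCont[of "loc_fun u None" 0] by (simp add: isCont_def)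
  moreover have "\<forall>\<^sub>F t in at 0. loc_fun u None t = u (Some (inverse t))"
    by (auto simp: eventually_at_filter loc_fun_None divide_inverse)
  ultimately have "((\<lambda>t. u (Some (inverse t))) \<longlongrightarrow> u None) (at 0)"
    by (rule Lim_transform_eventually)
  then show ?thesis
    by (rule lim_at_infinity_0[THEN iffD2, unfolded o_def])
qed

lemma simple_pole_limit:
  assumes "f nicely_meromorphic_on {0}" "is_pole f 0" "zorder f 0 = - 1"
  obtains c where "c \<noteq> 0" "(\<lambda>t. t * f t) \<midarrow>0\<rightarrow> c"
proof -
  obtain F where F: "f has_laurent_expansion F"
    using assms(1) meromorphic_laurent_0 by (auto simp: nicely_meromorphic_on_def)
  have "fls_subdegree F < 0"
    using is_pole_0_imp_neg_fls_subdegree[OF F assms(2)] .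
  then have "F \<noteq> 0" by auto
  then have sub: "fls_subdegree F = - 1"
    using has_laurent_expansion_zorder_0[OF F] assms(3) by simp
  have XF: "(\<lambda>t. t * f t) has_laurent_expansion fls_X * F"
    by (intro has_laurent_expansion_mult has_laurent_expansion_fps_X F)
  have "fls_subdegree (fls_X * F) \<ge> 0"
    using \<open>F \<noteq> 0\<close> sub by simp
  from has_laurent_expansion_imp_tendsto_0[OF XF this]
  have "(\<lambda>t. t * f t) \<midarrow>0\<rightarrow> fls_nth F (- 1)"
    by (simp add: fls_X_times_conv_shift)
  moreover have "fls_nth F (- 1) \<noteq> 0"
    using nth_fls_subdegree_nonzero[OF \<open>F \<noteq> 0\<close>] sub by simp
  ultimately show thesis using that by blast
qed

lemma affine_holomorphic:
  assumes "mero_fun u" "\<And>a. a \<in> S \<Longrightarrow> \<not> is_pole (loc_fun u (Some a)) 0" "open S"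
  shows "(\<lambda>x. u (Some x)) holomorphic_on S"
proof -
  let ?f = "\<lambda>x. u (Some x)"
  have "?f nicely_meromorphic_on S"
    by (rule nicely_meromorphic_on_subset[OF mero_fun_affine[OF assms(1)]]) simp
  moreover have "\<forall>a\<in>S. \<not> is_pole ?f a"
    using assms(2) by (simp add: loc_fun_Some is_pole_shift_0[of ?f])
  ultimately have "?f analytic_on S"
    by (rule nicely_meromorphic_without_singularities)
  then show ?thesis using assms(3) by (simp add: analytic_on_open)
qed

text \<open>
  Coordinates are Moebius transformations. If the pole is at infinity, the difference quotient of \<open>u\<close> at
  \<open>0\<close> is entire and has a limit at infinity, so it is constant. If the pole is at \<open>a\<close>, the same holds for
  the difference quotient at \<open>a\<close> of \<open>(x - a) u(x)\<close>.
\<close>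

lemma coordinate_cases:
  assumes "coordinate u"
  obtains (affine) A B where "A \<noteq> 0" "\<And>x. u (Some x) = A * x + B" "is_pole (loc_fun u None) 0"
  | (mobius) a A C where "C \<noteq> 0" "\<And>x. x \<noteq> a \<Longrightarrow> u (Some x) = A + C / (x - a)" "u None = A"
      "is_pole (loc_fun u (Some a)) 0"
proof -
  let ?f = "\<lambda>x. u (Some x)"
  obtain p where u: "mero_fun u" and p: "is_pole (loc_fun u p) 0" "zorder (loc_fun u p) 0 = -1"
    and only: "\<And>q. is_pole (loc_fun u q) 0 \<Longrightarrow> q = p"
    using assms unfolding coordinate_def by blast
  have nice: "loc_fun u p nicely_meromorphic_on {0}"
    using u by (simp add: mero_fun_def)
  obtain c where c: "c \<noteq> 0" "(\<lambda>t. t * loc_fun u p t) \<midarrow>0\<rightarrow> c"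
    using simple_pole_limit[OF nice p] .
  have inv0: "((\<lambda>x. c / (x - a)) \<longlongrightarrow> 0) at_infinity" for a c :: complex
  proof -
    have "((\<lambda>t. c * t / (1 - a * t)) \<longlongrightarrow> c * 0 / (1 - a * 0)) (at 0)"
      by (intro tendsto_intros) simp
    then have "((\<lambda>t. c * t / (1 - a * t)) \<longlongrightarrow> 0) (at 0)" by simp
    moreover have "\<forall>\<^sub>F t in at 0. c * t / (1 - a * t) = c / (inverse t - a)"
    proof -
      have "c * t / (1 - a * t) = c / (inverse t - a)" if "t \<noteq> 0" for t
      proof -
        have "inverse t - a = (1 - a * t) / t" using that by (simp add: field_simps)
        then show ?thesis by simp
      qed
      then show ?thesis by (simp add: eventually_at_filter)
    qed
    ultimately have "((\<lambda>t. c / (inverse t - a)) \<longlongrightarrow> 0) (at 0)"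
      by (rule Lim_transform_eventually)
    then show ?thesis
      by (rule lim_at_infinity_0[THEN iffD2, unfolded o_def])
  qed
  show thesis
  proof (cases p)
    case None
    have hol: "?f holomorphic_on UNIV"
      using only None by (intro affine_holomorphic u) auto
    let ?h = "\<lambda>x. if x = 0 then deriv ?f 0 else (?f x - ?f 0) / (x - 0)"
    have h: "?h holomorphic_on UNIV"
      by (rule pole_lemma_open[OF hol]) simp
    have "\<forall>\<^sub>F t in at 0. t * loc_fun u p t = ?f (inverse t) / inverse t"
      by (auto simp: eventually_at_filter None loc_fun_None field_simps)
    then have "((\<lambda>t. ?f (inverse t) / inverse t) \<longlongrightarrow> c) (at 0)"
      by (rule Lim_transform_eventually[OF c(2)])
    then have l1: "((\<lambda>x. ?f x / x) \<longlongrightarrow> c) at_infinity"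
      by (rule lim_at_infinity_0[THEN iffD2, unfolded o_def])
    have "((\<lambda>x. ?f x / x - ?f 0 / (x - 0)) \<longlongrightarrow> c) at_infinity"
      using tendsto_diff[OF l1 inv0[of "?f 0" 0]] by (simp only: diff_zero)
    moreover have "\<forall>\<^sub>F x in at_infinity. ?f x / x - ?f 0 / (x - 0) = ?h x"
      unfolding eventually_at_infinity by (rule exI[of _ 1]) (auto simp: diff_divide_distrib)
    ultimately have "(?h \<longlongrightarrow> c) at_infinity"
      by (rule Lim_transform_eventually)
    then have hc: "?h x = c" for x
      by (rule Liouville_weak[OF h])
    have eq: "?f x = c * x + ?f 0" for x
    proof (cases "x = 0")
      case False
      then have "(?f x - ?f 0) / x = c" using hc[of x] by simp
      then show ?thesis using False by (simp add: field_simps)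
    qed simp
    show thesis
      using p(1) None by (intro affine[OF c(1) eq]) simp
  next
    case (Some a)
    have hol: "?f holomorphic_on - {a}"
      using only Some by (intro affine_holomorphic u) auto
    let ?k = "\<lambda>x. if x = a then c else (x - a) * ?f x"
    have klim: "?k \<midarrow>a\<rightarrow> ?k a"
    proof -
      have "(\<lambda>t. (a + t - a) * ?f (a + t)) \<midarrow>0\<rightarrow> c"
        using c(2) by (simp add: Some loc_fun_Some)
      then have "(\<lambda>x. (x - a) * ?f x) \<midarrow>a\<rightarrow> c"
        by (rule LIM_offset_zero_cancel)
      moreover have "\<forall>\<^sub>F x in at a. (x - a) * ?f x = ?k x"
        by (auto simp: eventually_at_filter)
      ultimately have "?k \<midarrow>a\<rightarrow> c" by (rule Lim_transform_eventually)
      then show ?thesis by (simp only: if_True simp_thms)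
    qed
    have k': "?k holomorphic_on UNIV - {a}"
    proof (rule holomorphic_transform)
      show "(\<lambda>x. (x - a) * ?f x) holomorphic_on UNIV - {a}"
        using hol by (intro holomorphic_intros) (simp add: Compl_eq_Diff_UNIV)
    qed auto
    have k: "?k holomorphic_on UNIV"
    proof (rule no_isolated_singularity'[OF _ k' open_UNIV])
      fix z assume "z \<in> {a}"
      then have "z = a" by simp
      then show "(?k \<longlongrightarrow> ?k z) (at z)"
        by (simp only: klim)
    qed simp
    let ?h = "\<lambda>x. if x = a then deriv ?k a else (?k x - ?k a) / (x - a)"
    have h: "?h holomorphic_on UNIV"
      by (rule pole_lemma_open[OF k]) simp
    have h_eq: "?h x = ?f x - c / (x - a)" if "x \<noteq> a" for x
      using that by (simp add: diff_divide_distrib)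
    have "\<not> is_pole (loc_fun u None) 0" using only Some by blast
    from tendsto_diff[OF mero_fun_None_limit[OF u this] inv0[of c a]]
    have "((\<lambda>x. ?f x - c / (x - a)) \<longlongrightarrow> u None) at_infinity"
      by (simp only: diff_zero)
    moreover have "\<forall>\<^sub>F x in at_infinity. ?f x - c / (x - a) = ?h x"
      unfolding eventually_at_infinity
    proof (rule exI[of _ "norm a + 1"], intro allI impI)
      fix x :: complex assume "norm a + 1 \<le> norm x"
      then have "x \<noteq> a" by auto
      then show "?f x - c / (x - a) = ?h x" by (rule h_eq[symmetric])
    qed
    ultimately have "(?h \<longlongrightarrow> u None) at_infinity"
      by (rule Lim_transform_eventually)
    then have hN: "?h x = u None" for x
      by (rule Liouville_weak[OF h])
    have eq: "?f x = u None + c / (x - a)" if "x \<noteq> a" for x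
      by (rule diff_eq_eq[THEN iffD1, OF trans[OF sym[OF h_eq[OF that]] hN]])
    show thesis
      using p(1) Some by (intro mobius[OF c(1) eq refl]) simp_all
  qed
qed

text \<open>
  Near every point, punctured, there are only finite points outside a given finite set. So two sections
  that agree at all but finitely many points have the same normal form.
\<close>

lemma eventually_param_avoids:
  assumes "finite S"
  shows "\<forall>\<^sub>F t in at 0. \<exists>b. b \<notin> S \<and> param p t = Some b"
proof -
  have "\<forall>\<^sub>F t in at 0. param p t \<noteq> Some b" for b
  proof (cases p)
    case None
    have "\<forall>\<^sub>F t in at 0. t \<noteq> 0 \<and> t \<noteq> inverse b"
      by (intro eventually_conj eventually_neq_at_within)
    then show ?thesis
      by eventually_elim (auto simp: None param_def inverse_eq_divide)
  next
    case (Some a)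
    have "\<forall>\<^sub>F t in at 0. t \<noteq> b - a"
      by (rule eventually_neq_at_within)
    then show ?thesis
      by eventually_elim (auto simp: Some param_def)
  qed
  then have "\<forall>\<^sub>F t in at 0. \<forall>b\<in>S. param p t \<noteq> Some b"
    using assms by (intro eventually_ball_finite) auto
  with eventually_param_None_Some[of p] show ?thesis
    by eventually_elim force
qed

lemma normal_form_coordinate:
  assumes "coordinate u" "\<not> is_pole (loc_fun u z) 0"
  shows "normal_form (\<lambda>v. - differential u v / (u v - u z)\<^sup>2 * differential u z) = kern z"
proof -
  let ?e = "\<lambda>v. - differential u v / (u v - u z)\<^sup>2 * differential u z"
  have "\<exists>S. finite S \<and> (\<forall>b. b \<notin> S \<longrightarrow> ?e (Some b) = kern z (Some b))"
    using assms(1)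
  proof (cases rule: coordinate_cases)
    case (affine A B)
    obtain w where z: "z = Some w"
      using assms(2) affine(3) by (cases z) auto
    have d: "differential u (Some b) = A" for b
      unfolding differential_def loc_fun_Some affine(2)
      by (rule DERIV_imp_deriv) (auto intro!: derivative_eq_intros)
    have "?e (Some b) = kern z (Some b)" if "b \<noteq> w" for b
    proof -
      have "A * b + B - (A * w + B) = A * (b - w)" by (simp add: algebra_simps)
      then show ?thesis
        using affine(1) that by (simp add: z d affine(2) kern_def power_mult_distrib power2_eq_square)
    qed
    then show ?thesis by (intro exI[of _ "{w}"]) auto
  next
    case (mobius a A C)
    have d: "differential u (Some b) = - C / (b - a)\<^sup>2" if "b \<noteq> a" for b
    proof -
      have "\<forall>\<^sub>F t in nhds 0. b + t \<noteq> a"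
      proof -
        have "((\<lambda>t. b + t) \<longlongrightarrow> b + 0) (nhds 0)"
          by (intro tendsto_intros filterlim_ident)
        then show ?thesis using that by (intro tendsto_imp_eventually_ne) auto
      qed
      then have "\<forall>\<^sub>F t in nhds 0. u (Some (b + t)) = A + C / (b + t - a)"
        by eventually_elim (rule mobius(2))
      then have "differential u (Some b) = deriv (\<lambda>t. A + C / (b + t - a)) 0"
        unfolding differential_def loc_fun_Some by (rule deriv_cong_ev) simp
      also have "\<dots> = - C / (b - a)\<^sup>2"
        by (rule DERIV_imp_deriv)
           (rule derivative_eq_intros refl | use that in \<open>simp add: power2_eq_square\<close>)+
      finally show ?thesis .
    qed
    show ?thesis
    proof (cases z)
      case None
      have "\<forall>\<^sub>F t in nhds 0. 1 + (- a) * t \<noteq> 0"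
        using eventually_trans_ok[of "- a"] by (simp add: mult.commute)
      then have "\<forall>\<^sub>F t in nhds 0. loc_fun u None t = A + C * t / (1 - a * t)"
      proof eventually_elim
        case (elim t)
        show ?case
        proof (cases "t = 0")
          case False
          have "1 / t - a = (1 - a * t) / t" using False by (simp add: field_simps)
          moreover have "1 / t \<noteq> a" using False elim by (auto simp: field_simps)
          ultimately show ?thesis
            using False elim by (simp add: loc_fun_None mobius(2))
        qed (simp add: mobius(3))
      qed
      then have "differential u None = deriv (\<lambda>t. A + C * t / (1 - a * t)) 0"
        unfolding differential_def by (rule deriv_cong_ev) simp
      also have "\<dots> = C"
        by (rule DERIV_imp_deriv) (rule derivative_eq_intros refl | simp)+
      finally have dN: "differential u None = C" .
      have "?e (Some b) = kern z (Some b)" if "b \<noteq> a" for b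
        using that mobius(1) by (simp add: None d dN mobius(2,3) kern_def power_divide power2_eq_square)
      then show ?thesis by (intro exI[of _ "{a}"]) auto
    next
      case (Some w)
      then have wa: "w \<noteq> a" using assms(2) mobius(4) by auto
      have "?e (Some b) = kern z (Some b)" if "b \<noteq> a" "b \<noteq> w" for b
      proof -
        have "A + C / (b - a) - (A + C / (w - a)) = C * (w - b) / ((b - a) * (w - a))"
          using that wa by (simp add: field_simps)
        moreover have "- (- C / (b - a)\<^sup>2) / (C * (w - b) / ((b - a) * (w - a)))\<^sup>2 * (- C / (w - a)\<^sup>2) = - 1 / (b - w)\<^sup>2"
          using that wa mobius(1) by (simp add: power_divide power_mult_distrib power2_eq_square divide_simps) (simp add: algebra_simps)
        ultimately show ?thesis
          using that wa by (simp add: Some d mobius(2) kern_def)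
      qed
      then show ?thesis by (intro exI[of _ "{a, w}"]) auto
    qed
  qed
  then obtain S where S: "finite S" "\<And>b. b \<notin> S \<Longrightarrow> ?e (Some b) = kern z (Some b)" by blast
  show ?thesis
  proof (rule normal_form_eqI)
    show "mero_form (kern z)" using mero_form_bform[of z 0] by (simp add: bform_0)
    fix p
    show "\<forall>\<^sub>F t in at 0. ?e (param p t) = kern z (param p t)"
      using eventually_param_avoids[OF S(1), of p] by eventually_elim (use S(2) in auto)
  qed
qed

lemma coordinate_inverse_pole:
  "loc_fun u p = (\<lambda>t. 1 / t) \<Longrightarrow>
    is_pole (loc_fun u p) 0 \<and> zorder (loc_fun u p) 0 = -1 \<and> loc_fun u p nicely_meromorphic_on {0}"
proof -
  assume u: "loc_fun u p = (\<lambda>t. 1 / t)"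
  have "(\<lambda>t::complex. 1 / t) has_laurent_expansion fls_X_inv"
    using has_laurent_expansion_fls_X_inv by (simp add: divide_inverse[abs_def])
  then have "zorder (\<lambda>t::complex. 1 / t) 0 = -1"
    by (subst has_laurent_expansion_zorder_0) auto
  moreover have "is_pole (\<lambda>t::complex. 1 / (t - 0)) 0"
    using is_pole_basic[of "\<lambda>_. 1" UNIV 0 1] by simp
  moreover have "(\<lambda>t::complex. 1 / t) meromorphic_on {0}"
    by (intro meromorphic_intros)
  ultimately show ?thesis by (simp add: u nicely_meromorphic_on_def)
qed

lemma coordinateI:
  assumes "loc_fun u p = (\<lambda>t. 1 / t)" "\<And>q. q \<noteq> p \<Longrightarrow> loc_fun u q analytic_on {0}"
  shows "coordinate u"
proof -
  note pole = coordinate_inverse_pole[OF assms(1)]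
  have "mero_fun u"
    unfolding mero_fun_def
  proof
    fix q show "loc_fun u q nicely_meromorphic_on {0}"
      using pole assms(2) by (cases "q = p") (auto intro: analytic_on_imp_nicely_meromorphic_on)
  qed
  moreover have "q = p" if "is_pole (loc_fun u q) 0" for q
    using that assms(2) analytic_at_imp_no_pole by blast
  ultimately show ?thesis using pole unfolding coordinate_def by blast
qed

lemma coordinate_exists:
  obtains u where "coordinate u" "\<not> is_pole (loc_fun u z) 0"
proof (cases z)
  case None
  let ?u = "\<lambda>p :: proj_line. case p of Some x \<Rightarrow> 1 / x | None \<Rightarrow> (0 :: complex)"
  have an: "loc_fun ?u q analytic_on {0}" if "q \<noteq> Some 0" for q
  proof (cases q)
    case None
    have "loc_fun ?u None = (\<lambda>t. t)" by (auto simp: loc_fun_def param_def fun_eq_iff)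
    then show ?thesis using None by simp
  next
    case (Some b)
    then show ?thesis
      using that unfolding Some loc_fun_Some by (auto intro!: analytic_intros)
  qed
  have "coordinate ?u"
    by (rule coordinateI[of _ "Some 0"]) (simp_all add: loc_fun_Some an)
  then show thesis
    using that an[of z] analytic_at_imp_no_pole None by blast
next
  case (Some w)
  let ?u = "\<lambda>p :: proj_line. case p of Some x \<Rightarrow> x | None \<Rightarrow> (0 :: complex)"
  have an: "loc_fun ?u q analytic_on {0}" if "q \<noteq> None" for q
    using that by (cases q) (auto simp: loc_fun_Some intro!: analytic_intros)
  have "coordinate ?u"
    by (rule coordinateI[of _ None]) (auto simp: loc_fun_def param_def fun_eq_iff an)
  then show thesis
    using that an[of z] analytic_at_imp_no_pole Some by blast
qed

theorem e_form_eq_kern: "e_form z = kern z"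
  unfolding e_form_def
proof (rule the_equality)
  show "\<forall>u. coordinate u \<and> \<not> is_pole (loc_fun u z) 0 \<longrightarrow>
      kern z = normal_form (\<lambda>v. - differential u v / (u v - u z)\<^sup>2 * differential u z)"
    using normal_form_coordinate by simp
next
  fix \<alpha>
  assume "\<forall>u. coordinate u \<and> \<not> is_pole (loc_fun u z) 0 \<longrightarrow>
      \<alpha> = normal_form (\<lambda>v. - differential u v / (u v - u z)\<^sup>2 * differential u z)"
  then show "\<alpha> = kern z"
    using coordinate_exists[of z] normal_form_coordinate by metis
qed

section \<open>The two domains\<close>

text \<open>
  Openness, expressed in the charts.
\<close>

definition chart_open :: "proj_line set \<Rightarrow> bool" where
  "chart_open D \<longleftrightarrow> (\<forall>p\<in>D. \<forall>\<^sub>F t in nhds 0. param p t \<in> D)"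

lemma open_recip:
  assumes "open V"
  shows "open {t \<in> - {0::complex}. 1 / t \<in> V}"
proof -
  have "continuous_on (- {0}) (\<lambda>t::complex. 1 / t)"
    by (intro continuous_intros) auto
  then have "open (- {0} \<inter> (\<lambda>t::complex. 1 / t) -` V)"
    using assms by (intro continuous_open_preimage) auto
  moreover have "- {0} \<inter> (\<lambda>t::complex. 1 / t) -` V = {t \<in> - {0}. 1 / t \<in> V}" by auto
  ultimately show ?thesis by simp
qed

lemma continuous_param: "continuous_map euclidean proj_top (param p)"
proof (cases p)
  case (Some a)
  have "continuous_map euclidean proj_top (Some \<circ> (\<lambda>t. a + t))"
    unfolding proj_top_def
    by (rule continuous_map_compose[OF _ continuous_map_Some]) (auto intro!: continuous_intros)
  then show ?thesis by (simp add: Some param_def[abs_def] o_def)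
next
  case None
  show ?thesis
    unfolding continuous_map_def
  proof (intro conjI allI impI)
    show "param p \<in> topspace euclidean \<rightarrow> topspace proj_top"
      by (auto simp: proj_top_def) (metis not_None_eq rangeI)
    fix U assume "openin proj_top U"
    then consider V where "open V" "U = Some ` V"
      | C where "compact C" "U = insert None (Some ` (- C))"
      unfolding proj_top_def openin_Alexandroff_compactification
      by (auto simp: Compl_eq_Diff_UNIV)
    then have "open {t. param p t \<in> U}"
    proof cases
      case 1
      have "{t. param p t \<in> U} = {t \<in> - {0}. 1 / t \<in> V}"
        using 1 by (auto simp: None param_def)
      moreover have "open {t \<in> - {0::complex}. 1 / t \<in> V}"
        by (rule open_recip[OF 1(1)])
      ultimately show ?thesis by simp
    next
      case 2
      obtain M where M: "M > 0" "\<And>x. x \<in> C \<Longrightarrow> norm x < M"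
        using compact_imp_bounded[OF 2(1)] by (metis bounded_pos_less)
      have "{t. param p t \<in> U} = {t \<in> - {0}. 1 / t \<in> - C} \<union> ball 0 (1 / M)"
      proof (rule subset_antisym[symmetric]; rule subsetI)
        fix t assume "t \<in> {t \<in> - {0}. 1 / t \<in> - C} \<union> ball 0 (1 / M)"
        moreover have "1 / t \<notin> C" if "t \<noteq> 0" "norm t < 1 / M"
        proof
          assume "1 / t \<in> C"
          then have "norm (1 / t) < M" by (rule M)
          then show False using that M(1) by (simp add: norm_divide field_simps)
        qed
        ultimately show "t \<in> {t. param p t \<in> U}"
          using 2 by (auto simp: None param_def)
      next
        fix t assume "t \<in> {t. param p t \<in> U}"
        then show "t \<in> {t \<in> - {0}. 1 / t \<in> - C} \<union> ball 0 (1 / M)"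
          using 2 M(1) by (auto simp: None param_def split: if_splits)
      qed
      moreover have "open {t \<in> - {0::complex}. 1 / t \<in> - C}"
        using compact_imp_closed[OF 2(1)] by (intro open_recip) auto
      ultimately show ?thesis by (simp add: open_Un)
    qed
    then show "openin euclidean {t \<in> topspace euclidean. param p t \<in> U}" by simp
  qed
qed

lemma closedin_range:
  assumes "smooth_simple_closed_curve \<gamma>"
  shows "closedin proj_top (range \<gamma>)"
proof -
  have cont: "continuous_map euclideanreal proj_top \<gamma>"
    and per: "\<And>s t. \<gamma> s = \<gamma> t \<longleftrightarrow> s - t \<in> \<int>"
    using assms by (auto simp: smooth_simple_closed_curve_def)
  have "\<gamma> s \<in> \<gamma> ` {0..1}" for s
  proof -
    have "\<gamma> s = \<gamma> (frac s)" by (simp add: per frac_def)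
    then show ?thesis using frac_ge_0[of s] frac_lt_1[of s] by auto
  qed
  then have "range \<gamma> = \<gamma> ` {0..1}" by auto
  moreover have "compactin proj_top (\<gamma> ` {0..1})"
    by (rule image_compactin[OF _ cont]) simp
  moreover have "Hausdorff_space proj_top"
    unfolding proj_top_def
    by (simp add: Hausdorff_space_Alexandroff_compactification locally_compact_space_euclidean)
  ultimately show ?thesis by (simp add: compactin_imp_closedin)
qed

lemma topspace_proj_top [simp]: "topspace proj_top = UNIV"
  by (auto simp: proj_top_def) (metis not_None_eq rangeI)

text \<open>
  Small discs in a chart are connected, so one that avoids the curve stays in the component of its centre.
\<close>

lemma component_chart_open:
  assumes "smooth_simple_closed_curve \<gamma>"
    and D: "D \<in> connected_components_of (subtopology proj_top (- range \<gamma>))"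
  shows "chart_open D"
  unfolding chart_open_def
proof
  fix p assume p: "p \<in> D"
  have D_sub: "D \<subseteq> - range \<gamma>"
    using connected_components_of_subset[OF D] by auto
  have "openin proj_top (- range \<gamma>)"
    using closedin_range[OF assms(1)] by (simp add: closedin_def Compl_eq_Diff_UNIV)
  then have "open {t. param p t \<in> - range \<gamma>}"
    using continuous_param[of p] by (auto simp: continuous_map_def)
  moreover have "0 \<in> {t. param p t \<in> - range \<gamma>}" using p D_sub by auto
  ultimately obtain r where r: "r > 0" "ball 0 r \<subseteq> {t. param p t \<in> - range \<gamma>}"
    by (rule openE)
  have "connectedin proj_top (param p ` ball 0 r)"
    by (rule connectedin_continuous_map_image[OF continuous_param]) simp
  then have "connectedin (subtopology proj_top (- range \<gamma>)) (param p ` ball 0 r)"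
    using r(2) by (auto simp: connectedin_subtopology)
  moreover have "\<not> disjnt D (param p ` ball 0 r)"
  proof -
    have "param p 0 \<in> param p ` ball 0 r" using r(1) by (intro imageI) simp
    then show ?thesis using p by (auto simp: disjnt_def)
  qed
  ultimately have sub: "param p ` ball 0 r \<subseteq> D"
    using connected_components_of_maximal[OF D] by blast
  have "\<forall>\<^sub>F t in nhds 0. t \<in> ball (0::complex) r"
    using r(1) by (intro eventually_nhds_in_open) auto
  then show "\<forall>\<^sub>F t in nhds 0. param p t \<in> D"
    by (rule eventually_mono) (use sub in blast)
qed

lemma separated_domains:
  assumes "smooth_simple_closed_curve \<gamma>" "separates_into \<gamma> D D'"
  shows "chart_open D" "chart_open D'" "D \<inter> D' = {}" "D \<noteq> {}" "D' \<noteq> {}"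
proof -
  let ?C = "connected_components_of (subtopology proj_top (- range \<gamma>))"
  have D: "D \<in> ?C" "D' \<in> ?C" "D \<noteq> D'"
    using assms(2) by (auto simp: separates_into_def)
  show "chart_open D" "chart_open D'"
    using component_chart_open[OF assms(1)] D by auto
  show "D \<inter> D' = {}"
    using connected_components_of_disjoint[OF D(1,2)] D(3) by (simp add: disjnt_def)
  show "D \<noteq> {}" "D' \<noteq> {}"
    using nonempty_connected_components_of D by auto
qed

section \<open>Classes of polynomials in forms\<close>

interpretation K: sym_base "forms_in D" form_add form_scale for D
  by unfold_locales (simp_all add: form_add_closed form_scale_closed)

text \<open>
  Polynomials in the forms with poles in \<open>D\<close>, the representatives of the vectors of \<open>\<^sub>D\<^bold>W\<close>.
\<close>

abbreviation fpolys :: "proj_line set \<Rightarrow> (proj_line \<Rightarrow> complex) pol set" where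
  "fpolys D \<equiv> polys (forms_in D)"

lemma cls_eq_cl: "cls D p = K.cl D p"
  by (simp add: cls_def K.cl_def)

lemma carrier_W: "carrier (W D) = cls D ` fpolys D"
  by (auto simp: W_def K.carrier_S cls_eq_cl)

lemma cls_carrier [simp]: "p \<in> fpolys D \<Longrightarrow> cls D p \<in> carrier (W D)"
  by (simp add: carrier_W)

lemma cls_add: "p \<in> fpolys D \<Longrightarrow> q \<in> fpolys D \<Longrightarrow> cls D p \<oplus>\<^bsub>W D\<^esub> cls D q = cls D (p + q)"
  by (simp add: W_def K.cl_add cls_eq_cl)

lemma cls_mult: "p \<in> fpolys D \<Longrightarrow> q \<in> fpolys D \<Longrightarrow> cls D p \<otimes>\<^bsub>W D\<^esub> cls D q = cls D (p * q)"
  by (simp add: W_def K.cl_mult cls_eq_cl)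

lemma vacuum_eq: "vacuum D = cls D 1"
  by (simp add: vacuum_def W_def K.cl_one cls_eq_cl)

lemma zero_W: "\<zero>\<^bsub>W D\<^esub> = cls D 0"
  by (simp add: W_def K.cl_zero cls_eq_cl)

lemma cls_eq_iff: "p \<in> fpolys D \<Longrightarrow> q \<in> fpolys D \<Longrightarrow> cls D p = cls D q \<longleftrightarrow> K.eqv D p q"
  by (simp add: cls_eq_cl K.cl_eq)

lemma cls_eqI: "K.eqv D p q \<Longrightarrow> cls D p = cls D q"
  by (simp add: cls_eq_cl K.cl_eqI)

lemma mem_cls: "p \<in> fpolys D \<Longrightarrow> q \<in> cls D p \<longleftrightarrow> K.eqv D q p"
  by (simp add: cls_eq_cl K.mem_cl)

lemma scalar_mult: "p \<in> fpolys D \<Longrightarrow> scalar D c \<otimes>\<^bsub>W D\<^esub> cls D p = cls D (const c * p)"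
  by (simp add: scalar_def cls_mult)

text \<open>
  A polynomial that represents a given vector of \<open>\<^sub>D\<^bold>W\<close>.
\<close>

definition class_rep :: "proj_line set \<Rightarrow> fock_vec \<Rightarrow> (proj_line \<Rightarrow> complex) pol" where
  "class_rep D x = (SOME p. p \<in> fpolys D \<and> x = cls D p)"

lemma class_rep:
  assumes "x \<in> carrier (W D)"
  shows "class_rep D x \<in> fpolys D" "cls D (class_rep D x) = x"
proof -
  have "\<exists>p. p \<in> fpolys D \<and> x = cls D p" using assms by (auto simp: carrier_W)
  from someI_ex[OF this] show "class_rep D x \<in> fpolys D" "cls D (class_rep D x) = x"
    by (auto simp: class_rep_def)
qed

lemma class_rep_eqv: "p \<in> fpolys D \<Longrightarrow> K.eqv D (class_rep D (cls D p)) p"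
  using class_rep[of "cls D p" D] by (simp add: cls_eq_iff)

section \<open>Linear functionals on forms: values and derivatives\<close>

text \<open>
  The functional \<open>\<alpha> \<mapsto> - \<alpha>(z)\<close>, whose derivation is \<open>i(z)\<close>.
\<close>

abbreviation (input) neg_ev :: "proj_line \<Rightarrow> (proj_line \<Rightarrow> complex) \<Rightarrow> complex" where
  "neg_ev z \<equiv> \<lambda>\<alpha>. - \<alpha> z"

lemma functional_ev: "z \<notin> D \<Longrightarrow> K.functional D (neg_ev z)"
  by (simp add: K.functional_def form_add_value) (simp add: form_scale_def)

lemma K_eqv_der: "K.functional D l \<Longrightarrow> K.eqv D p q \<Longrightarrow> K.eqv D (der l p) (der l q)"
  using K.I_der[of D l "p - q"] by (simp add: K.eqv_def der_diff)

lemma chart_open_near: "chart_open D \<Longrightarrow> z \<in> D \<Longrightarrow> \<forall>\<^sub>F t in nhds 0. param z t \<in> D"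
  by (simp add: chart_open_def)

lemma functional_jet:
  assumes "chart_open D'" "D \<inter> D' = {}" "z \<in> D'"
  shows "K.functional D (jet n z)"
proof -
  have near: "\<forall>\<^sub>F t in nhds 0. param z t \<notin> D"
    by (rule eventually_mono[OF chart_open_near[OF assms(1,3)]]) (use assms(2) in blast)
  have z: "z \<notin> D" using assms by auto
  have "jet n z (form_add v w) = jet n z v + jet n z w" if "v \<in> forms_in D" "w \<in> forms_in D" for v w
  proof -
    have "jet n z (form_add v w) = jet n z (\<lambda>q. v q + w q)"
      using near by (intro jet_cong) (erule eventually_mono, rule form_add_value[OF that])
    then show ?thesis using that z by (simp add: jet_add forms_in_analytic)
  qed
  moreover have "jet n z (form_scale c v) = c * jet n z v" if "v \<in> forms_in D" for c v
    using that z by (simp add: form_scale_def jet_scale forms_in_analytic)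
  ultimately show ?thesis by (simp add: K.functional_def)
qed

lemma functional_lin_comb:
  assumes "\<And>i. i \<in> A \<Longrightarrow> K.functional D (l i)" "\<And>v. v \<in> forms_in D \<Longrightarrow> m v = (\<Sum>i\<in>A. c i * l i v)"
  shows "K.functional D m"
  using assms
  by (simp add: K.functional_def form_add_closed form_scale_closed distrib_left sum.distrib
        sum_distrib_left mult.left_commute)

section \<open>The operators on classes of polynomials\<close>

lemma cls_linear_op:
  assumes "\<And>p. p \<in> fpolys D \<Longrightarrow> T (cls D p) = cls D (t p)"
    "\<And>p. p \<in> fpolys D \<Longrightarrow> t p \<in> fpolys D"
    "\<And>p q. t (p + q) = t p + t q" "\<And>c p. t (const c * p) = const c * t p"
  shows "linear_op D T"
  unfolding linear_op_def carrier_W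
  using assms by (auto simp: cls_add scalar_mult)

lemma i_op_cls:
  assumes "z \<notin> D" "p \<in> fpolys D"
  shows "i_op D z (cls D p) = cls D (der (neg_ev z) p)"
proof -
  let ?\<Phi> = "\<lambda>T. T \<in> carrier (W D) \<rightarrow>\<^sub>E carrier (W D) \<and> derivation_op D T \<and>
      T (vacuum D) = \<zero>\<^bsub>W D\<^esub> \<and> (\<forall>\<alpha>\<in>forms_in D. T (emb D \<alpha>) = scalar D (- \<alpha> z))"
  define T where "T = (\<lambda>x\<in>carrier (W D). cls D (der (neg_ev z) (class_rep D x)))"
  have T_cls: "T (cls D p) = cls D (der (neg_ev z) p)" if "p \<in> fpolys D" for p
    using that by (simp add: T_def cls_eqI K_eqv_der functional_ev assms(1) class_rep_eqv)
  have "linear_op D T"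
    by (rule cls_linear_op[where t = "der (neg_ev z)"]) (simp_all add: T_cls der_add der_const_mult)
  moreover have "T (x \<otimes>\<^bsub>W D\<^esub> y) = (T x \<otimes>\<^bsub>W D\<^esub> y) \<oplus>\<^bsub>W D\<^esub> (x \<otimes>\<^bsub>W D\<^esub> T y)"
    if xy: "x \<in> carrier (W D)" "y \<in> carrier (W D)" for x y
  proof -
    obtain p q where pq: "p \<in> fpolys D" "q \<in> fpolys D" "x = cls D p" "y = cls D q"
      using xy by (auto simp: carrier_W)
    then show ?thesis by (simp add: cls_mult cls_add T_cls der_mult)
  qed
  moreover have "T \<in> carrier (W D) \<rightarrow>\<^sub>E carrier (W D)"
    by (auto simp: T_def class_rep)
  ultimately have "?\<Phi> T"
    by (simp add: derivation_op_def vacuum_eq zero_W emb_def scalar_def T_cls)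
  moreover have "T' = T" if T': "?\<Phi> T'" for T'
  proof -
    have ext: "T' \<in> carrier (W D) \<rightarrow>\<^sub>E carrier (W D)" and der: "derivation_op D T'"
      and vac: "T' (vacuum D) = \<zero>\<^bsub>W D\<^esub>" and emb: "\<And>\<alpha>. \<alpha> \<in> forms_in D \<Longrightarrow> T' (emb D \<alpha>) = scalar D (- \<alpha> z)"
      using T' by auto
    have lin: "T' (x \<oplus>\<^bsub>W D\<^esub> y) = T' x \<oplus>\<^bsub>W D\<^esub> T' y" "T' (scalar D c \<otimes>\<^bsub>W D\<^esub> x) = scalar D c \<otimes>\<^bsub>W D\<^esub> T' x"
      "T' (x \<otimes>\<^bsub>W D\<^esub> y) = (T' x \<otimes>\<^bsub>W D\<^esub> y) \<oplus>\<^bsub>W D\<^esub> (x \<otimes>\<^bsub>W D\<^esub> T' y)"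
      if "x \<in> carrier (W D)" "y \<in> carrier (W D)" for x y c
      using der that by (auto simp: derivation_op_def linear_op_def)
    have "T' (cls D p) = cls D (der (neg_ev z) p)" if "p \<in> fpolys D" for p
      using that
    proof (induction rule: polys_induct)
      case (const c)
      have "T' (cls D (const c)) = T' (scalar D c \<otimes>\<^bsub>W D\<^esub> cls D 1)"
        by (simp add: scalar_mult)
      also have "\<dots> = scalar D c \<otimes>\<^bsub>W D\<^esub> cls D 0"
        using lin(2)[of "cls D 1" "cls D 1" c] vac by (simp add: vacuum_eq zero_W)
      finally show ?case by (simp add: scalar_mult)
    next
      case (gen v p)
      have "T' (cls D (gen v * p)) = T' (emb D v \<otimes>\<^bsub>W D\<^esub> cls D p)"
        using gen by (simp add: emb_def cls_mult)
      also have "\<dots> = (scalar D (- v z) \<otimes>\<^bsub>W D\<^esub> cls D p) \<oplus>\<^bsub>W D\<^esub> (cls D (gen v) \<otimes>\<^bsub>W D\<^esub> cls D (der (neg_ev z) p))"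
        using lin(3)[of "emb D v" "cls D p"] gen emb by (simp add: emb_def)
      also have "\<dots> = cls D (der (neg_ev z) (gen v * p))"
        using gen by (simp add: scalar_mult cls_mult cls_add der_mult)
      finally show ?case .
    next
      case (add p q)
      have "T' (cls D (p + q)) = T' (cls D p \<oplus>\<^bsub>W D\<^esub> cls D q)"
        using add by (simp add: cls_add)
      then show ?case
        using lin(1)[of "cls D p" "cls D q"] add by (simp add: cls_add der_add)
    qed
    then have "T' x = T x" if "x \<in> carrier (W D)" for x
      using that T_cls by (auto simp: carrier_W)
    then show "T' = T"
      using ext \<open>?\<Phi> T\<close> by (intro PiE_ext[of T' _ _ T]) auto
  qed
  ultimately have "i_op D z = T"
    unfolding i_op_def by (rule the_equality)
  then show ?thesis using T_cls assms(2) by simp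
qed

lemma vacuum_coeff_cls:
  assumes "p \<in> fpolys D"
  shows "vacuum_coeff (cls D p) = ccoeff p"
  unfolding vacuum_coeff_def
proof (rule the_equality)
  show "\<forall>q\<in>cls D p. Poly_Mapping.lookup q {#} = ccoeff p"
  proof
    fix q assume "q \<in> cls D p"
    then have "q - p \<in> K.I D" using assms by (simp add: mem_cls K.eqv_def)
    then have "ccoeff (q - p) = 0" by (rule K.I_ccoeff)
    then show "Poly_Mapping.lookup q {#} = ccoeff p" by (simp add: ccoeff_def lookup_minus)
  qed
  fix c assume "\<forall>q\<in>cls D p. Poly_Mapping.lookup q {#} = c"
  then show "c = ccoeff p" using assms by (auto simp: mem_cls ccoeff_def)
qed

lemma value_at_cls:
  assumes "set zs \<subseteq> - D" "p \<in> fpolys D"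
  shows "value_at D zs (cls D p) = ccoeff (ders (map neg_ev zs) p)"
proof -
  have "foldr (i_op D) zs (cls D p) = cls D (ders (map neg_ev zs) p)"
    using assms(1) by (induction zs) (simp_all add: i_op_cls assms(2))
  then show ?thesis using assms by (simp add: value_at_def vacuum_coeff_cls)
qed

lemma kern_in_forms: "z \<in> D \<Longrightarrow> kern z \<in> forms_in D"
  using bform_in_forms[of z D 0] by (simp add: bform_0)

lemma e_op_cls:
  assumes "z \<in> D" "p \<in> fpolys D"
  shows "e_op D z (cls D p) = cls D (gen (kern z) * p)"
  using assms by (simp add: e_op_def e_form_eq_kern emb_def cls_mult kern_in_forms)

section \<open>Values separate Fock vectors\<close>

text \<open>
  The topological properties of the two domains that enter the argument.
\<close>

definition domains :: "proj_line set \<Rightarrow> proj_line set \<Rightarrow> bool" where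
  "domains D D' \<longleftrightarrow> chart_open D \<and> chart_open D' \<and> D \<inter> D' = {} \<and> D \<noteq> {} \<and> D' \<noteq> {}"

lemma domains_sym: "domains D D' \<Longrightarrow> domains D' D"
  by (auto simp: domains_def)

text \<open>
  A form that vanishes on \<open>D'\<close> is zero, by the identity theorem.
\<close>

lemma form_eq_scale_0:
  assumes "domains D D'" "\<alpha> \<in> forms_in D" "\<And>z. z \<in> D' \<Longrightarrow> \<alpha> z = 0"
  shows "form_scale 0 \<alpha> = \<alpha>"
proof -
  obtain p where p: "p \<in> D'" using assms(1) by (auto simp: domains_def)
  have "\<forall>\<^sub>F t in nhds 0. param p t \<in> D'"
    using assms(1) p by (auto simp: domains_def chart_open_def)
  then have "\<forall>\<^sub>F t in nhds 0. \<alpha> (param p t) = 0"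
    by eventually_elim (rule assms(3))
  then have "\<alpha> q = 0" for q
    using assms(2) by (intro mero_form_identity[of \<alpha> p q]) (auto simp: forms_in_def)
  then show ?thesis by (simp add: form_scale_def fun_eq_iff)
qed

lemma separation_ev:
  assumes dom: "domains D D'" and p: "p \<in> fpolys D" "q \<in> fpolys D"
    and eq: "\<And>zs. set zs \<subseteq> - D \<Longrightarrow> ccoeff (ders (map neg_ev zs) p) = ccoeff (ders (map neg_ev zs) q)"
  shows "K.eqv D p q"
proof -
  interpret sep: sym_sep "forms_in D" form_add form_scale "neg_ev ` (- D)"
  proof unfold_locales
    show "K.functional D l" if "l \<in> neg_ev ` (- D)" for l
      using that functional_ev by auto
    show "form_scale 0 v = v" if "v \<in> forms_in D" "\<And>l. l \<in> neg_ev ` (- D) \<Longrightarrow> l v = 0" for v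
    proof (rule form_eq_scale_0[OF dom that(1)])
      fix z assume "z \<in> D'"
      then have "neg_ev z \<in> neg_ev ` (- D)" using dom by (auto simp: domains_def)
      from that(2)[OF this] show "v z = 0" by simp
    qed
  qed
  have "p - q \<in> K.I D"
  proof (rule sep.separation)
    fix ls assume "set ls \<subseteq> neg_ev ` (- D)"
    then have "\<exists>zs. set zs \<subseteq> - D \<and> ls = map neg_ev zs"
    proof (induction ls)
      case (Cons l ls)
      then obtain z zs where "z \<in> - D" "l = neg_ev z" "set zs \<subseteq> - D" "ls = map neg_ev zs"
        by fastforce
      then show ?case by (intro exI[of _ "z # zs"]) simp
    qed simp
    then obtain zs where zs: "set zs \<subseteq> - D" "ls = map neg_ev zs" by blast
    show "ccoeff (ders ls (p - q)) = 0"
      using eq[OF zs(1)] by (simp add: zs(2) ders_diff ccoeff_diff)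
  qed (use p in simp)
  then show ?thesis using p by (simp add: K.eqv_def)
qed

text \<open>
  Two linear combinations of forms that agree at all points outside \<open>D\<close> define the same vector: the first
  derivative along a value is constant, so only these values have to be compared.
\<close>

lemma linear_eqv:
  assumes dom: "domains D D'"
    and b: "\<And>k. k \<in> A \<Longrightarrow> b k \<in> forms_in D" "\<And>k. k \<in> A' \<Longrightarrow> b' k \<in> forms_in D"
    and eq: "\<And>z. z \<notin> D \<Longrightarrow> (\<Sum>k\<in>A. c k * b k z) = (\<Sum>k\<in>A'. c' k * b' k z)"
  shows "K.eqv D (\<Sum>k\<in>A. const (c k) * gen (b k)) (\<Sum>k\<in>A'. const (c' k) * gen (b' k))"
proof (rule separation_ev[OF dom])
  fix zs assume zs: "set zs \<subseteq> - D"
  let ?p = "\<Sum>k\<in>A. const (c k) * gen (b k)" and ?q = "\<Sum>k\<in>A'. const (c' k) * gen (b' k)"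
  show "ccoeff (ders (map neg_ev zs) ?p) = ccoeff (ders (map neg_ev zs) ?q)"
  proof (cases zs rule: rev_cases)
    case Nil
    then show ?thesis by (simp add: ccoeff_sum ccoeff_mult)
  next
    case (snoc ys z)
    have "der (neg_ev z) ?p = der (neg_ev z) ?q"
      using eq[of z] zs snoc by (simp add: der_sum der_const_mult flip: const_mult const_sum) (simp add: sum_negf)
    then show ?thesis by (simp add: snoc ders_append)
  qed
qed (use b in \<open>auto intro!: polys_sum\<close>)

section \<open>Lie derivatives of the operators \<open>e\<close> and \<open>i\<close>\<close>

lemma lie_iter_sum:
  assumes "regular_field X" "\<And>i. i \<in> A \<Longrightarrow> sec_analytic (s i) p"
  shows "(lie X ^^ N) (\<lambda>q. \<Sum>i\<in>A. c i * s i q) p = (\<Sum>i\<in>A. c i * (lie X ^^ N) (s i) p)"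
proof -
  have "(lie X ^^ N) (\<lambda>q. \<Sum>i\<in>A. c i * s i q) p
      = (\<Sum>n\<le>N. lie_coeff X p N n * (\<Sum>i\<in>A. c i * jet n p (s i)))"
    using assms by (simp add: lie_iter_jets sec_analytic_sum jet_sum)
  also have "\<dots> = (\<Sum>i\<in>A. c i * (\<Sum>n\<le>N. lie_coeff X p N n * jet n p (s i)))"
    by (simp add: sum_distrib_left mult.left_commute sum.swap[of _ A])
  also have "\<dots> = (\<Sum>i\<in>A. c i * (lie X ^^ N) (s i) p)"
    using assms by (simp add: lie_iter_jets)
  finally show ?thesis .
qed

lemma lie_sum:
  assumes "regular_field X" "\<And>i. i \<in> A \<Longrightarrow> sec_analytic (s i) p"
  shows "lie X (\<lambda>q. \<Sum>i\<in>A. c i * s i q) p = (\<Sum>i\<in>A. c i * lie X (s i) p)"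
  using lie_iter_sum[OF assms, where N = 1] by simp

text \<open>
  To identify the Lie derivative of a section of vectors given by polynomials \<open>Q q\<close>, it suffices to write
  all values of \<open>Q q\<close> as regular sections in \<open>q\<close> and to take their Lie derivatives.
\<close>

lemma lie_op_cls:
  assumes dom: "domains D D'" and Y: "Y \<in> fpolys D"
    and Q: "\<forall>\<^sub>F t in nhds 0. Q (param p t) \<in> fpolys D \<and> A (param p t) \<psi> = cls D (Q (param p t))"
    and vals: "\<And>zs. set zs \<subseteq> - D \<Longrightarrow> \<exists>s. sec_analytic s p \<and>
      (\<forall>\<^sub>F t in nhds 0. ccoeff (ders (map neg_ev zs) (Q (param p t))) = s (param p t)) \<and>
      ccoeff (ders (map neg_ev zs) Y) = lie X s p"
  shows "lie_op D X A p \<psi> = cls D Y"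
proof -
  have key: "loc_form (\<lambda>q. value_at D zs (A q \<psi>)) p field_differentiable at 0 \<and>
      value_at D zs (cls D Y) = lie X (\<lambda>q. value_at D zs (A q \<psi>)) p" if zs: "set zs \<subseteq> - D" for zs
  proof -
    obtain s where s: "sec_analytic s p"
      "\<forall>\<^sub>F t in nhds 0. ccoeff (ders (map neg_ev zs) (Q (param p t))) = s (param p t)"
      "ccoeff (ders (map neg_ev zs) Y) = lie X s p"
      using vals[OF zs] by blast
    have near: "\<forall>\<^sub>F t in nhds 0. value_at D zs (A (param p t) \<psi>) = s (param p t)"
      using eventually_conj[OF Q s(2)]
      by (rule eventually_mono) (use value_at_cls[OF zs] in auto)
    have "sec_analytic (\<lambda>q. value_at D zs (A q \<psi>)) p"
      using sec_analytic_cong[of "\<lambda>q. value_at D zs (A q \<psi>)" p s] near s(1) by simp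
    then have "loc_form (\<lambda>q. value_at D zs (A q \<psi>)) p field_differentiable at 0"
      unfolding sec_analytic_def by (rule analytic_on_imp_differentiable_at) simp
    moreover have "value_at D zs (cls D Y) = lie X (\<lambda>q. value_at D zs (A q \<psi>)) p"
      using value_at_cls[OF zs Y] s(3) lie_cong[of "\<lambda>q. value_at D zs (A q \<psi>)" p s X] near by simp
    ultimately show ?thesis by blast
  qed
  show ?thesis
    unfolding lie_op_def
  proof (rule the_equality)
    show "cls D Y \<in> carrier (W D) \<and> (\<forall>zs. set zs \<subseteq> - D \<longrightarrow>
        loc_form (\<lambda>q. value_at D zs (A q \<psi>)) p field_differentiable at 0 \<and>
        value_at D zs (cls D Y) = lie X (\<lambda>q. value_at D zs (A q \<psi>)) p)"
      using key Y by simp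
  next
    fix y assume y: "y \<in> carrier (W D) \<and> (\<forall>zs. set zs \<subseteq> - D \<longrightarrow>
        loc_form (\<lambda>q. value_at D zs (A q \<psi>)) p field_differentiable at 0 \<and>
        value_at D zs y = lie X (\<lambda>q. value_at D zs (A q \<psi>)) p)"
    then obtain y' where y': "y' \<in> fpolys D" "y = cls D y'" by (auto simp: carrier_W)
    have "ccoeff (ders (map neg_ev zs) y') = ccoeff (ders (map neg_ev zs) Y)" if zs: "set zs \<subseteq> - D" for zs
      using y key[OF zs] zs y' Y by (simp add: value_at_cls)
    then show "y = cls D Y"
      unfolding y'(2) by (intro cls_eqI separation_ev[OF dom y'(1) Y])
  qed
qed

text \<open>
  The polynomial \<open>(L\<^sub>X\<^sup>N e\<^sub>z) p\<close>. The form \<open>L\<^sub>X\<^sup>N e\<^sub>z\<close> is kept as a linear combination of the generators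
  \<open>b\<^sub>z\<^sub>,\<^sub>n\<close>; its value at \<open>v\<close> is \<open>L\<^sub>X\<^sup>N\<close> of the kernel, as \<open>b\<^sub>z\<^sub>,\<^sub>n(v)\<close> is the \<open>n\<close>-th derivative of the kernel.
\<close>

definition e_poly :: "(proj_line \<Rightarrow> complex) \<Rightarrow> nat \<Rightarrow> (proj_line \<Rightarrow> complex) pol \<Rightarrow> proj_line \<Rightarrow> (proj_line \<Rightarrow> complex) pol" where
  "e_poly X N p z = (\<Sum>n\<le>N. const (lie_coeff X z N n) * (gen (bform z n) * p))"

lemma e_poly_in: "z \<in> D \<Longrightarrow> p \<in> fpolys D \<Longrightarrow> e_poly X N p z \<in> fpolys D"
  unfolding e_poly_def by (intro polys_sum polys_mult polys_const polys_gen bform_in_forms)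

lemma lie_coeff_0:
  assumes "regular_field X"
  shows "lie_coeff X z 0 0 = 1"
proof -
  \<comment> \<open>a section that is regular and nonzero at \<open>z\<close> is provided by the kernel\<close>
  obtain v :: proj_line where v: "z \<noteq> v" by (cases z) auto
  have "kern z v \<noteq> 0"
    using v by (auto simp: kern_def split: option.splits)
  then show ?thesis
    using lie_iter_jets[OF assms sec_analytic_kern[OF v], of 0] by simp
qed

lemma e_poly_values:
  assumes "regular_field X" "set zs \<subseteq> - D"
  obtains k where "\<And>z N. z \<in> D \<Longrightarrow> ccoeff (ders (map neg_ev zs) (e_poly X N p z))
      = (\<Sum>i<length zs. k i * (lie X ^^ N) (\<lambda>q. kern q (zs ! i)) z)"
proof -
  obtain r where r: "\<And>v. ders (map neg_ev zs) (gen v * p) = gen v * ders (map neg_ev zs) p +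
      (\<Sum>i<length (map neg_ev zs). const ((map neg_ev zs ! i) v) * r i)"
    using ders_gen_mult[where ls = "map neg_ev zs" and p = p] by blast
  have val: "ccoeff (ders (map neg_ev zs) (gen v * p)) = (\<Sum>i<length zs. - ccoeff (r i) * v (zs ! i))" for v
    by (simp add: r ccoeff_add ccoeff_mult ccoeff_sum) (simp only: mult.commute)
  show thesis
  proof (rule that[of "\<lambda>i. - ccoeff (r i)"])
    fix z N assume z: "z \<in> D"
    have "ccoeff (ders (map neg_ev zs) (e_poly X N p z))
        = (\<Sum>n\<le>N. lie_coeff X z N n * (\<Sum>i<length zs. - ccoeff (r i) * bform z n (zs ! i)))"
      unfolding e_poly_def by (simp add: ders_sum ders_const_mult ccoeff_sum ccoeff_mult val)
    also have "\<dots> = (\<Sum>i<length zs. - ccoeff (r i) * (\<Sum>n\<le>N. lie_coeff X z N n * bform z n (zs ! i)))"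
      unfolding sum_distrib_left by (subst sum.swap) (simp only: mult.left_commute)
    also have "\<dots> = (\<Sum>i<length zs. - ccoeff (r i) * (lie X ^^ N) (\<lambda>q. kern q (zs ! i)) z)"
    proof (intro sum.cong refl arg_cong2[of _ _ _ _ "(*)"])
      fix i assume "i \<in> {..<length zs}"
      then have "zs ! i \<in> - D" using assms(2) by (auto dest!: nth_mem)
      then have "z \<noteq> zs ! i" using z by auto
      then show "(\<Sum>n\<le>N. lie_coeff X z N n * bform z n (zs ! i)) = (lie X ^^ N) (\<lambda>q. kern q (zs ! i)) z"
        by (simp add: lie_iter_jets assms(1) sec_analytic_kern jet_kern)
    qed
    finally show "ccoeff (ders (map neg_ev zs) (e_poly X N p z))
        = (\<Sum>i<length zs. - ccoeff (r i) * (lie X ^^ N) (\<lambda>q. kern q (zs ! i)) z)" .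
  qed
qed

theorem lie_op_e_op:
  assumes dom: "domains D D'" and X: "regular_field X" and p: "p \<in> fpolys D"
  shows "z \<in> D \<Longrightarrow> (lie_op D X ^^ N) (e_op D) z (cls D p) = cls D (e_poly X N p z)"
proof (induction N arbitrary: z)
  case 0
  then show ?case by (simp add: e_op_cls p e_poly_def lie_coeff_0 X bform_0)
next
  case (Suc N)
  have "lie_op D X ((lie_op D X ^^ N) (e_op D)) z (cls D p) = cls D (e_poly X (Suc N) p z)"
  proof (rule lie_op_cls[OF dom e_poly_in[OF Suc.prems p], where Q = "e_poly X N p"])
    have near: "\<forall>\<^sub>F t in nhds 0. param z t \<in> D"
      using dom Suc.prems by (intro chart_open_near) (auto simp: domains_def)
    then show "\<forall>\<^sub>F t in nhds 0. e_poly X N p (param z t) \<in> fpolys D \<and>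
        (lie_op D X ^^ N) (e_op D) (param z t) (cls D p) = cls D (e_poly X N p (param z t))"
      by (rule eventually_mono) (simp add: e_poly_in p Suc.IH)
    fix zs assume zs: "set zs \<subseteq> - D"
    obtain k where k: "\<And>z N. z \<in> D \<Longrightarrow> ccoeff (ders (map neg_ev zs) (e_poly X N p z))
      = (\<Sum>i<length zs. k i * (lie X ^^ N) (\<lambda>q. kern q (zs ! i)) z)"
      using e_poly_values[OF X zs, where p = p] by blast
    let ?s = "\<lambda>z. \<Sum>i<length zs. k i * (lie X ^^ N) (\<lambda>q. kern q (zs ! i)) z"
    have an: "sec_analytic ((lie X ^^ N) (\<lambda>q. kern q (zs ! i))) z" if "i \<in> {..<length zs}" for i
    proof -
      have "zs ! i \<in> - D" using zs that by (auto dest!: nth_mem)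
      then have "z \<noteq> zs ! i" using Suc.prems by auto
      then show ?thesis by (intro sec_analytic_lie_iter X sec_analytic_kern)
    qed
    have "lie X ?s z = (\<Sum>i<length zs. k i * lie X ((lie X ^^ N) (\<lambda>q. kern q (zs ! i))) z)"
      by (rule lie_sum[OF X an])
    then have "lie X ?s z = ccoeff (ders (map neg_ev zs) (e_poly X (Suc N) p z))"
      by (simp only: k[OF Suc.prems] funpow.simps o_apply)
    moreover have "\<forall>\<^sub>F t in nhds 0. ccoeff (ders (map neg_ev zs) (e_poly X N p (param z t))) = ?s (param z t)"
      using near by (rule eventually_mono) (rule k)
    moreover have "sec_analytic ?s z" using an by (rule sec_analytic_sum)
    ultimately show "\<exists>s. sec_analytic s z \<and>
      (\<forall>\<^sub>F t in nhds 0. ccoeff (ders (map neg_ev zs) (e_poly X N p (param z t))) = s (param z t)) \<and>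
      ccoeff (ders (map neg_ev zs) (e_poly X (Suc N) p z)) = lie X s z"
      by (intro exI[of _ ?s] conjI) (assumption | simp only:)+
  qed
  then show ?case by simp
qed

theorem lie_op_i_op:
  assumes dom: "domains D D'" and X: "regular_field X" and p: "p \<in> fpolys D"
  shows "z \<in> D' \<Longrightarrow> (lie_op D X ^^ N) (i_op D) z (cls D p) = cls D (der (\<lambda>\<alpha>. - (lie X ^^ N) \<alpha> z) p)"
proof (induction N arbitrary: z)
  case 0
  then have "z \<notin> D" using dom by (auto simp: domains_def)
  then show ?case by (simp add: i_op_cls p)
next
  case (Suc N)
  let ?Q = "\<lambda>N z. der (\<lambda>\<alpha>. - (lie X ^^ N) \<alpha> z) p"
  have "lie_op D X ((lie_op D X ^^ N) (i_op D)) z (cls D p) = cls D (?Q (Suc N) z)"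
  proof (rule lie_op_cls[OF dom, where Q = "?Q N"])
    have near: "\<forall>\<^sub>F t in nhds 0. param z t \<in> D'"
      using dom Suc.prems by (intro chart_open_near) (auto simp: domains_def)
    then show "\<forall>\<^sub>F t in nhds 0. ?Q N (param z t) \<in> fpolys D \<and>
        (lie_op D X ^^ N) (i_op D) (param z t) (cls D p) = cls D (?Q N (param z t))"
      by (rule eventually_mono) (simp add: p Suc.IH)
    fix zs assume zs: "set zs \<subseteq> - D"
    obtain S where S: "finite S" "S \<subseteq> forms_in D"
      "\<And>l. der l p = (\<Sum>v\<in>S. const (l v) * der (\<lambda>w. if w = v then 1 else 0) p)"
      using der_expand[OF p] by blast
    define k where "k = (\<lambda>v. - ccoeff (ders (map neg_ev zs) (der (\<lambda>w. if w = v then 1 else 0) p)))"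
    have k: "ccoeff (ders (map neg_ev zs) (?Q N z)) = (\<Sum>v\<in>S. k v * (lie X ^^ N) v z)" for N z
      by (subst S(3)) (simp add: ders_sum ders_const_mult ccoeff_sum ccoeff_mult k_def, simp only: mult.commute)
    let ?s = "\<lambda>z. \<Sum>v\<in>S. k v * (lie X ^^ N) v z"
    have an: "sec_analytic ((lie X ^^ N) v) z" if "v \<in> S" for v
    proof -
      have "z \<notin> D" using dom Suc.prems by (auto simp: domains_def)
      then show ?thesis using that S(2) by (intro sec_analytic_lie_iter X forms_in_analytic[of v D]) auto
    qed
    have "lie X ?s z = (\<Sum>v\<in>S. k v * lie X ((lie X ^^ N) v) z)"
      by (rule lie_sum[OF X an])
    then have "lie X ?s z = ccoeff (ders (map neg_ev zs) (?Q (Suc N) z))"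
      using k[where N = "Suc N" and z = z] by (simp only: funpow.simps o_apply)
    moreover have "\<forall>\<^sub>F t in nhds 0. ccoeff (ders (map neg_ev zs) (?Q N (param z t))) = ?s (param z t)"
      by (simp only: k) simp
    moreover have "sec_analytic ?s z" using an by (rule sec_analytic_sum)
    ultimately show "\<exists>s. sec_analytic s z \<and>
      (\<forall>\<^sub>F t in nhds 0. ccoeff (ders (map neg_ev zs) (?Q N (param z t))) = s (param z t)) \<and>
      ccoeff (ders (map neg_ev zs) (?Q (Suc N) z)) = lie X s z"
      by (intro exI[of _ ?s] conjI) (assumption | simp only:)+
  qed (simp add: p)
  then show ?case by simp
qed

section \<open>The pairing of two forms\<close>

text \<open>
  A decomposition of \<open>\<alpha>\<close> into basic forms with poles in \<open>D\<close>, indexed by a finite set of pairs \<open>(z, n)\<close>. It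
  is only required at points outside \<open>D\<close>, where sums of forms are pointwise.
\<close>

definition form_rep :: "proj_line set \<Rightarrow> (proj_line \<times> nat) set \<Rightarrow> (proj_line \<times> nat \<Rightarrow> complex) \<Rightarrow>
    (proj_line \<Rightarrow> complex) \<Rightarrow> bool" where
  "form_rep D K c \<alpha> \<longleftrightarrow> finite K \<and> fst ` K \<subseteq> D \<and>
     (\<forall>q. q \<notin> D \<longrightarrow> \<alpha> q = (\<Sum>k\<in>K. c k * bform (fst k) (snd k) q))"

lemma form_rep_exists:
  assumes "\<alpha> \<in> forms_in D"
  obtains K c where "form_rep D K c \<alpha>"
proof (rule partial_fractions[OF assms])
  fix P :: "proj_line set" and N c
  assume P: "finite P" "P \<subseteq> D"
    "\<And>q. q \<notin> D \<Longrightarrow> \<alpha> q = (\<Sum>p\<in>P. \<Sum>n<N p. c p n * bform p n q)"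
  have "form_rep D (SIGMA p:P. {..<N p}) (\<lambda>(p, n). c p n) \<alpha>"
    unfolding form_rep_def
  proof (intro conjI allI impI)
    show "finite (SIGMA p:P. {..<N p})" using P(1) by simp
    show "fst ` (SIGMA p:P. {..<N p}) \<subseteq> D" using P(2) by auto
    fix q assume "q \<notin> D"
    then have "\<alpha> q = (\<Sum>p\<in>P. \<Sum>n<N p. c p n * bform p n q)" by (rule P(3))
    also have "\<dots> = (\<Sum>(p, n)\<in>(SIGMA p:P. {..<N p}). c p n * bform p n q)"
      using P(1) by (simp add: sum.Sigma)
    finally show "\<alpha> q = (\<Sum>k\<in>(SIGMA p:P. {..<N p}).
        (case k of (p, n) \<Rightarrow> c p n) * bform (fst k) (snd k) q)"
      by (simp add: split_beta)
  qed
  then show thesis by (rule that)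
qed

lemma form_rep_bform: "z \<in> D \<Longrightarrow> form_rep D {(z, n)} (\<lambda>_. 1) (bform z n)"
  by (simp add: form_rep_def)

lemma jet_form_rep:
  assumes dom: "domains D D'" and rep: "form_rep D K c \<alpha>" and z: "z \<in> D'"
  shows "jet n z \<alpha> = (\<Sum>k\<in>K. c k * jet n z (bform (fst k) (snd k)))"
proof -
  have near: "\<forall>\<^sub>F t in nhds 0. param z t \<in> D'"
    using dom z by (intro chart_open_near) (auto simp: domains_def)
  then have "jet n z \<alpha> = jet n z (\<lambda>q. \<Sum>k\<in>K. c k * bform (fst k) (snd k) q)"
    using dom rep by (intro jet_cong) (erule eventually_mono, auto simp: domains_def form_rep_def)
  also have "\<dots> = (\<Sum>k\<in>K. c k * jet n z (bform (fst k) (snd k)))"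
    using dom rep z
    by (intro jet_sum sec_analytic_bform) (auto simp: domains_def form_rep_def)
  finally show ?thesis .
qed

text \<open>
  Expanding both forms, each side is the sum of the mixed derivatives of the kernel with coefficients
  \<open>c k * c' k'\<close>.
\<close>

lemma form_rep_symmetry:
  assumes dom: "domains D D'" and rep: "form_rep D K c \<alpha>" and rep': "form_rep D' K' c' \<alpha>'"
  shows "(\<Sum>k\<in>K. c k * jet (snd k) (fst k) \<alpha>') = (\<Sum>k\<in>K'. c' k * jet (snd k) (fst k) \<alpha>)"
proof -
  have "(\<Sum>k\<in>K. c k * jet (snd k) (fst k) \<alpha>')
      = (\<Sum>k\<in>K. c k * (\<Sum>k'\<in>K'. c' k' * jet (snd k) (fst k) (bform (fst k') (snd k'))))"
    using rep by (intro sum.cong refl) (auto simp: form_rep_def jet_form_rep[OF domains_sym[OF dom] rep'])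
  also have "\<dots> = (\<Sum>k\<in>K. c k * (\<Sum>k'\<in>K'. c' k' * jet (snd k') (fst k') (bform (fst k) (snd k))))"
  proof (intro sum.cong refl arg_cong2[of _ _ _ _ "(*)"])
    fix k k' assume "k \<in> K" "k' \<in> K'"
    then have "fst k \<in> D" "fst k' \<in> D'"
      using rep rep' unfolding form_rep_def by blast+
    then have "fst k' \<noteq> fst k"
      using dom unfolding domains_def by (metis disjoint_iff)
    then show "jet (snd k) (fst k) (bform (fst k') (snd k')) = jet (snd k') (fst k') (bform (fst k) (snd k))"
      by (rule jet_bform_sym)
  qed
  also have "\<dots> = (\<Sum>k'\<in>K'. c' k' * (\<Sum>k\<in>K. c k * jet (snd k') (fst k') (bform (fst k) (snd k))))"
    unfolding sum_distrib_left by (subst sum.swap) (simp only: mult.left_commute)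
  also have "\<dots> = (\<Sum>k\<in>K'. c' k * jet (snd k) (fst k) \<alpha>)"
    using rep' by (intro sum.cong refl) (auto simp: form_rep_def jet_form_rep[OF dom rep])
  finally show ?thesis .
qed

text \<open>
  The pairing of a form \<open>\<alpha>'\<close> with poles in \<open>D'\<close> and a form \<open>\<alpha>\<close> with poles in \<open>D\<close>, read off from some
  decomposition of \<open>\<alpha>\<close>; by \<open>form_rep_symmetry\<close> the choice does not matter.
\<close>

definition form_pair :: "proj_line set \<Rightarrow> (proj_line \<Rightarrow> complex) \<Rightarrow> (proj_line \<Rightarrow> complex) \<Rightarrow> complex" where
  "form_pair D \<alpha>' \<alpha> =
     (case SOME (K, c). form_rep D K c \<alpha> of (K, c) \<Rightarrow> \<Sum>k\<in>K. c k * jet (snd k) (fst k) \<alpha>')"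

lemma form_pair_some_rep:
  assumes "\<alpha> \<in> forms_in D"
  obtains K c where "form_rep D K c \<alpha>" "\<And>\<alpha>'. form_pair D \<alpha>' \<alpha> = (\<Sum>k\<in>K. c k * jet (snd k) (fst k) \<alpha>')"
proof -
  obtain K c where *: "(SOME (K, c). form_rep D K c \<alpha>) = (K, c)" by (meson surj_pair)
  have "\<exists>x. case x of (K, c) \<Rightarrow> form_rep D K c \<alpha>"
    by (rule form_rep_exists[OF assms]) auto
  from someI_ex[OF this] have "form_rep D K c \<alpha>" by (simp add: *)
  then show thesis using that * by (simp add: form_pair_def)
qed

lemma form_pair_eq':
  assumes "domains D D'" "\<alpha> \<in> forms_in D" "form_rep D' K' c' \<alpha>'"
  shows "form_pair D \<alpha>' \<alpha> = (\<Sum>k\<in>K'. c' k * jet (snd k) (fst k) \<alpha>)"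
proof -
  obtain K c where "form_rep D K c \<alpha>" "form_pair D \<alpha>' \<alpha> = (\<Sum>k\<in>K. c k * jet (snd k) (fst k) \<alpha>')"
    using form_pair_some_rep[OF assms(2)] by metis
  then show ?thesis using form_rep_symmetry[OF assms(1) _ assms(3)] by simp
qed

lemma form_pair_eq:
  assumes "domains D D'" "\<alpha> \<in> forms_in D" "\<alpha>' \<in> forms_in D'" "form_rep D K c \<alpha>"
  shows "form_pair D \<alpha>' \<alpha> = (\<Sum>k\<in>K. c k * jet (snd k) (fst k) \<alpha>')"
proof -
  obtain K' c' where "form_rep D' K' c' \<alpha>'" using form_rep_exists[OF assms(3)] .
  then show ?thesis
    using form_pair_eq'[OF assms(1,2)] form_rep_symmetry[OF assms(1,4)] by simp
qed

lemma form_pair_bform: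
  assumes "domains D D'" "z \<in> D" "\<alpha>' \<in> forms_in D'"
  shows "form_pair D \<alpha>' (bform z n) = jet n z \<alpha>'"
  using form_pair_eq[OF assms(1) bform_in_forms[OF assms(2)] assms(3) form_rep_bform[OF assms(2)]]
  by simp

lemma form_pair_bform':
  assumes "domains D D'" "z' \<in> D'" "\<alpha> \<in> forms_in D"
  shows "form_pair D (bform z' n) \<alpha> = jet n z' \<alpha>"
  using form_pair_eq'[OF assms(1,3) form_rep_bform[OF assms(2)]] by simp

lemma form_pair_functional:
  assumes "domains D D'" "\<alpha>' \<in> forms_in D'"
  shows "K.functional D (form_pair D \<alpha>')"
proof -
  obtain K' c' where rep: "form_rep D' K' c' \<alpha>'" using form_rep_exists[OF assms(2)] .
  show ?thesis
  proof (rule functional_lin_comb)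
    show "K.functional D (jet (snd k) (fst k))" if "k \<in> K'" for k
      using that rep assms(1) by (intro functional_jet[of D']) (auto simp: domains_def form_rep_def)
    show "form_pair D \<alpha>' v = (\<Sum>k\<in>K'. c' k * jet (snd k) (fst k) v)" if "v \<in> forms_in D" for v
      using form_pair_eq'[OF assms(1) that rep] .
  qed
qed

lemma form_pair_functional':
  assumes "domains D D'" "\<alpha> \<in> forms_in D"
  shows "K.functional D' (\<lambda>\<alpha>'. form_pair D \<alpha>' \<alpha>)"
proof -
  obtain K c where rep: "form_rep D K c \<alpha>" using form_rep_exists[OF assms(2)] .
  show ?thesis
  proof (rule functional_lin_comb)
    show "K.functional D' (jet (snd k) (fst k))" if "k \<in> K" for k
      using that rep assms(1) by (intro functional_jet[of D]) (auto simp: domains_def form_rep_def)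
    show "form_pair D v \<alpha> = (\<Sum>k\<in>K. c k * jet (snd k) (fst k) v)" if "v \<in> forms_in D'" for v
      using form_pair_eq[OF assms that rep] .
  qed
qed

section \<open>Adjointness and its derivatives\<close>

text \<open>
  Bilinearity over the constants of a function of two polynomials.
\<close>

definition bilinear_form :: "('u pol \<Rightarrow> 'v pol \<Rightarrow> complex) \<Rightarrow> bool" where
  "bilinear_form \<beta> \<longleftrightarrow>
     (\<forall>p q r. \<beta> (p + q) r = \<beta> p r + \<beta> q r) \<and> (\<forall>c p r. \<beta> (const c * p) r = c * \<beta> p r) \<and>
     (\<forall>p q r. \<beta> r (p + q) = \<beta> r p + \<beta> r q) \<and> (\<forall>c p r. \<beta> r (const c * p) = c * \<beta> r p)"

lemma bilinear_form_sum:
  assumes "bilinear_form \<beta>"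
  shows "\<beta> (\<Sum>i\<in>A. const (c i) * f i) r = (\<Sum>i\<in>A. c i * \<beta> (f i) r)"
    and "\<beta> r' (\<Sum>i\<in>A. const (c i) * g i) = (\<Sum>i\<in>A. c i * \<beta> r' (g i))"
proof -
  have b: "\<beta> (p + q) r = \<beta> p r + \<beta> q r" "\<beta> (const c * p) r = c * \<beta> p r"
    "\<beta> s (p' + q') = \<beta> s p' + \<beta> s q'" "\<beta> s (const c * p') = c * \<beta> s p'" for p q r c s p' q'
    using assms by (auto simp: bilinear_form_def)
  have "\<beta> 0 r = 0" "\<beta> s 0 = 0" for r s using b(2)[of 0 0] b(4)[of _ 0 0] by simp_all
  then show "\<beta> (\<Sum>i\<in>A. const (c i) * f i) r = (\<Sum>i\<in>A. c i * \<beta> (f i) r)"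
    "\<beta> r' (\<Sum>i\<in>A. const (c i) * g i) = (\<Sum>i\<in>A. c i * \<beta> r' (g i))"
    by (induction A rule: infinite_finite_induct) (simp_all add: b)
qed

text \<open>
  The identities at points of \<open>D\<close>, for any bilinear form on polynomials that induces \<open>B\<close> and is adjoint as
  in \<open>adj\<close>. This generality allows both arguments to be exchanged, which gives the identities at points of
  \<open>D'\<close>.
\<close>

lemma lie_chain:
  assumes dom: "domains D D'" and X: "regular_field X"
    and p: "p \<in> fpolys D" and p': "p' \<in> fpolys D'" and z: "z \<in> D"
    and \<beta>: "bilinear_form \<beta>"
    and B: "\<And>q q'. q \<in> fpolys D \<Longrightarrow> q' \<in> fpolys D' \<Longrightarrow> B (cls D' q') (cls D q) = \<beta> q' q"
    and adj: "\<And>z n q q'. z \<in> D \<Longrightarrow> q' \<in> fpolys D' \<Longrightarrow> \<beta> q' (gen (bform z n) * q) = \<beta> (der (jet n z) q') q"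
  shows "B (cls D' p') ((lie_op D X ^^ N) (e_op D) z (cls D p))
      = (lie X ^^ N) (\<lambda>z. B (cls D' p') (e_op D z (cls D p))) z" (is ?A)
    and "(lie X ^^ N) (\<lambda>z. B (cls D' p') (e_op D z (cls D p))) z
      = - (lie X ^^ N) (\<lambda>z. B (i_op D' z (cls D' p')) (cls D p)) z" (is ?B)
    and "(lie X ^^ N) (\<lambda>z. B (i_op D' z (cls D' p')) (cls D p)) z
      = B ((lie_op D' X ^^ N) (i_op D') z (cls D' p')) (cls D p)" (is ?C)
proof -
  obtain S where S: "finite S" "S \<subseteq> forms_in D'"
    "\<And>l. der l p' = (\<Sum>v\<in>S. const (l v) * der (\<lambda>w. if w = v then 1 else 0) p')"
    using der_expand[OF p'] by blast
  define k where "k = (\<lambda>v. \<beta> (der (\<lambda>w. if w = v then 1 else 0) p') p)"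
  have k: "\<beta> (der l p') p = (\<Sum>v\<in>S. k v * l v)" for l
    by (subst S(3)) (simp add: bilinear_form_sum[OF \<beta>] k_def, simp only: mult.commute)
  have notin: "q \<notin> D'" if "q \<in> D" for q using dom that by (auto simp: domains_def)
  have an: "sec_analytic v q" if "v \<in> S" "q \<in> D" for v q
    using that S(2) notin by (intro forms_in_analytic[of v D']) auto
  have near: "\<forall>\<^sub>F t in nhds 0. param z t \<in> D"
    using dom z by (intro chart_open_near) (auto simp: domains_def)
  have e: "B (cls D' p') ((lie_op D X ^^ N) (e_op D) q (cls D p)) = (\<Sum>v\<in>S. k v * (lie X ^^ N) v q)"
    if q: "q \<in> D" for q N
  proof -
    have "B (cls D' p') ((lie_op D X ^^ N) (e_op D) q (cls D p)) = \<beta> p' (e_poly X N p q)"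
      using q by (simp add: lie_op_e_op[OF dom X p] B e_poly_in p p')
    also have "\<dots> = (\<Sum>n\<le>N. lie_coeff X q N n * (\<Sum>v\<in>S. k v * jet n q v))"
      unfolding e_poly_def by (simp add: bilinear_form_sum[OF \<beta>] adj q p' k)
    also have "\<dots> = (\<Sum>v\<in>S. k v * (\<Sum>n\<le>N. lie_coeff X q N n * jet n q v))"
      unfolding sum_distrib_left by (subst sum.swap) (simp only: mult.left_commute)
    also have "\<dots> = (\<Sum>v\<in>S. k v * (lie X ^^ N) v q)"
      by (intro sum.cong refl) (simp add: lie_iter_jets[OF X an[OF _ q]])
    finally show ?thesis .
  qed
  have i: "B ((lie_op D' X ^^ N) (i_op D') q (cls D' p')) (cls D p) = (\<Sum>v\<in>S. - k v * (lie X ^^ N) v q)"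
    if q: "q \<in> D" for q N
    using q by (simp add: lie_op_i_op[OF domains_sym[OF dom] X p'] B p p' k)
  have le: "(lie X ^^ N) (\<lambda>z. B (cls D' p') (e_op D z (cls D p))) z = (\<Sum>v\<in>S. k v * (lie X ^^ N) v z)"
  proof -
    have "(lie X ^^ N) (\<lambda>z. B (cls D' p') (e_op D z (cls D p))) z = (lie X ^^ N) (\<lambda>z. \<Sum>v\<in>S. k v * v z) z"
      by (rule lie_iter_cong, rule eventually_mono[OF near]) (use e[where N = 0] in simp)
    then show ?thesis using lie_iter_sum[OF X an[OF _ z]] by simp
  qed
  have li: "(lie X ^^ N) (\<lambda>z. B (i_op D' z (cls D' p')) (cls D p)) z = (\<Sum>v\<in>S. - k v * (lie X ^^ N) v z)"
  proof -
    have "(lie X ^^ N) (\<lambda>z. B (i_op D' z (cls D' p')) (cls D p)) z = (lie X ^^ N) (\<lambda>z. \<Sum>v\<in>S. - k v * v z) z"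
      by (rule lie_iter_cong, rule eventually_mono[OF near]) (use i[where N = 0] in simp)
    then show ?thesis using lie_iter_sum[OF X an[OF _ z], where c = "\<lambda>v. - k v"] by simp
  qed
  show ?A using e[OF z] le by simp
  show ?B using le li by (simp add: sum_negf)
  show ?C using i[OF z] li by simp
qed

section \<open>The pairing of Fock vectors\<close>

lemma bilinear_form_poly_pair: "bilinear_form (poly_pair pr)"
  and bilinear_form_poly_pair_flip: "bilinear_form (\<lambda>p p'. poly_pair pr p' p)"
  by (simp_all add: bilinear_form_def poly_pair_add poly_pair_const_mult)

lemma form_poly_pair_cong:
  assumes dom: "domains D D'" and "K.eqv D' p' q'" "K.eqv D p q"
  shows "poly_pair (form_pair D) p' p = poly_pair (form_pair D) q' q"
proof -
  interpret P: sym_pair "forms_in D'" form_add form_scale "forms_in D" form_add form_scale "form_pair D"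
    by unfold_locales (simp_all add: form_pair_functional[OF dom] form_pair_functional'[OF dom])
  show ?thesis using assms(2,3) by (rule P.poly_pair_cong)
qed

lemma poly_pair_adjoint:
  assumes "domains D D'" "z \<in> D" "q' \<in> fpolys D'"
  shows "poly_pair (form_pair D) q' (gen (bform z n) * q) = poly_pair (form_pair D) (der (jet n z) q') q"
proof -
  have "der (\<lambda>a. form_pair D a (bform z n)) q' = der (jet n z) q'"
    by (rule der_cong[OF assms(3)]) (rule form_pair_bform[OF assms(1,2)])
  then show ?thesis by (simp add: poly_pair_gen_mult)
qed

lemma poly_pair_adjoint':
  assumes "domains D D'" "z \<in> D'" "q \<in> fpolys D"
  shows "poly_pair (form_pair D) (gen (bform z n) * q') q = poly_pair (form_pair D) q' (der (jet n z) q)"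
proof -
  have "der (form_pair D (bform z n)) q = der (jet n z) q"
    by (rule der_cong[OF assms(3)]) (rule form_pair_bform'[OF assms(1,2)])
  then show ?thesis by (simp add: poly_pair_gen_mult')
qed

text \<open>
  The pairing of the theorem, computed on representatives and extensional in both arguments.
\<close>

definition fock_pair :: "proj_line set \<Rightarrow> proj_line set \<Rightarrow> fock_vec \<Rightarrow> fock_vec \<Rightarrow> complex" where
  "fock_pair D' D = (\<lambda>x\<in>carrier (W D'). \<lambda>y\<in>carrier (W D).
     poly_pair (form_pair D) (class_rep D' x) (class_rep D y))"

lemma fock_pair_cls:
  assumes "domains D D'" "p' \<in> fpolys D'" "p \<in> fpolys D"
  shows "fock_pair D' D (cls D' p') (cls D p) = poly_pair (form_pair D) p' p"
  using assms by (simp add: fock_pair_def form_poly_pair_cong class_rep_eqv)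

lemma bilinear_pairing_fock_pair:
  assumes "domains D D'"
  shows "bilinear_pairing D' D (fock_pair D' D)"
proof -
  have "fock_pair D' D \<in> carrier (W D') \<rightarrow>\<^sub>E (carrier (W D) \<rightarrow>\<^sub>E UNIV)"
    by (auto simp: fock_pair_def)
  then show ?thesis
    unfolding bilinear_pairing_def carrier_W
    using assms by (auto simp: cls_add scalar_mult fock_pair_cls poly_pair_add poly_pair_const_mult)
qed

section \<open>Uniqueness of the pairing\<close>

text \<open>
  For the field \<open>\<partial>\<^sub>t\<close>, the form \<open>L\<^sub>X\<^sup>N e\<^sub>z\<close> is \<open>b\<^sub>z\<^sub>,\<^sub>N\<close>.
\<close>

lemma e_poly_unit_field:
  assumes dom: "domains D D'" and z: "z \<in> D" and p: "p \<in> fpolys D"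
  shows "K.eqv D (e_poly (unit_field z) N p z) (gen (bform z N) * p)"
proof -
  let ?c = "lie_coeff (unit_field z) z N"
  have "K.eqv D (\<Sum>n\<in>{..N}. const (?c n) * gen (bform z n)) (\<Sum>k\<in>{()}. const 1 * gen (bform z N))"
  proof (rule linear_eqv[OF dom])
    fix q assume "q \<notin> D"
    then have q: "z \<noteq> q" using z by auto
    have "(\<Sum>n\<le>N. ?c n * bform z n q) = (lie (unit_field z) ^^ N) (\<lambda>r. kern r q) z"
      using q by (simp add: lie_iter_jets regular_unit_field sec_analytic_kern jet_kern)
    also have "\<dots> = bform z N q"
      using q by (simp add: lie_iter_unit_field regular_unit_field loc_field_unit_field sec_analytic_kern jet_kern)
    finally show "(\<Sum>n\<in>{..N}. ?c n * bform z n q) = (\<Sum>k\<in>{()}. 1 * bform z N q)" by simp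
  qed (simp_all add: bform_in_forms z)
  from K.eqv_mult[OF this K.eqv_refl[OF p]] show ?thesis
    by (simp add: e_poly_def sum_distrib_right mult.assoc)
qed

lemma gen_spanned:
  assumes dom: "domains D D'" and rep: "form_rep D K c v" and v: "v \<in> forms_in D" and p: "p \<in> fpolys D"
  shows "K.eqv D (gen v * p) (\<Sum>k\<in>K. const (c k) * (gen (bform (fst k) (snd k)) * p))"
proof -
  have "K.eqv D (\<Sum>k\<in>{()}. const 1 * gen v) (\<Sum>k\<in>K. const (c k) * gen (bform (fst k) (snd k)))"
  proof (rule linear_eqv[OF dom])
    show "bform (fst k) (snd k) \<in> forms_in D" if "k \<in> K" for k
      using rep that by (intro bform_in_forms) (auto simp: form_rep_def)
    show "(\<Sum>k\<in>{()}. 1 * v z) = (\<Sum>k\<in>K. c k * bform (fst k) (snd k) z)" if "z \<notin> D" for z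
      using rep that by (simp add: form_rep_def)
  qed (rule v)
  from K.eqv_mult[OF this K.eqv_refl[OF p]] show ?thesis
    by (simp add: sum_distrib_right mult.assoc)
qed

lemma bilinear_pairing_sum:
  assumes B: "bilinear_pairing D' D B"
  shows "p' \<in> fpolys D' \<Longrightarrow> (\<And>k. k \<in> A \<Longrightarrow> f k \<in> fpolys D) \<Longrightarrow>
      B (cls D' p') (cls D (\<Sum>k\<in>A. const (c k) * f k)) = (\<Sum>k\<in>A. c k * B (cls D' p') (cls D (f k)))"
    and "p \<in> fpolys D \<Longrightarrow> (\<And>k. k \<in> A \<Longrightarrow> g k \<in> fpolys D') \<Longrightarrow>
      B (cls D' (\<Sum>k\<in>A. const (c k) * g k)) (cls D p) = (\<Sum>k\<in>A. c k * B (cls D' (g k)) (cls D p))"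
proof -
  have add: "B (cls D' p') (cls D (p + q)) = B (cls D' p') (cls D p) + B (cls D' p') (cls D q)"
    and scale: "B (cls D' p') (cls D (const c * p)) = c * B (cls D' p') (cls D p)"
    if "p' \<in> fpolys D'" "p \<in> fpolys D" "q \<in> fpolys D" for p' p q c
    using B that unfolding bilinear_pairing_def
    by (metis cls_add cls_carrier, metis scalar_mult cls_carrier)
  have add': "B (cls D' (p' + q')) (cls D p) = B (cls D' p') (cls D p) + B (cls D' q') (cls D p)"
    and scale': "B (cls D' (const c * p')) (cls D p) = c * B (cls D' p') (cls D p)"
    if "p' \<in> fpolys D'" "q' \<in> fpolys D'" "p \<in> fpolys D" for p' q' p c
    using B that unfolding bilinear_pairing_def
    by (metis cls_add cls_carrier, metis scalar_mult cls_carrier)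
  have zero: "B (cls D' p') (cls D 0) = 0" "B (cls D' 0) (cls D p) = 0"
    if "p' \<in> fpolys D'" "p \<in> fpolys D" for p' p
    using scale[OF that polys_zero, of 0] scale'[OF that(1) polys_zero that(2), of 0] by simp_all
  show "p' \<in> fpolys D' \<Longrightarrow> (\<And>k. k \<in> A \<Longrightarrow> f k \<in> fpolys D) \<Longrightarrow>
      B (cls D' p') (cls D (\<Sum>k\<in>A. const (c k) * f k)) = (\<Sum>k\<in>A. c k * B (cls D' p') (cls D (f k)))"
    by (induction A rule: infinite_finite_induct)
       (simp_all add: zero[OF _ polys_zero] add scale[OF _ _ polys_zero])
  show "p \<in> fpolys D \<Longrightarrow> (\<And>k. k \<in> A \<Longrightarrow> g k \<in> fpolys D') \<Longrightarrow>
      B (cls D' (\<Sum>k\<in>A. const (c k) * g k)) (cls D p) = (\<Sum>k\<in>A. c k * B (cls D' (g k)) (cls D p))"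
    by (induction A rule: infinite_finite_induct)
       (simp_all add: zero[OF polys_zero] add' scale'[OF _ polys_zero])
qed

text \<open>
  Only the outer terms of (iii) are needed, and only for the fields \<open>\<partial>\<^sub>t\<close>. Factors \<open>b\<^sub>z\<^sub>,\<^sub>n\<close> are first removed
  from the right argument (\<open>step\<close>). Then the right argument is the vacuum, which is annihilated by all
  derivations, so removing a factor from the left argument gives zero (\<open>step'\<close>).
\<close>

lemma pairing_unique:
  assumes dom: "domains D D'" and B: "bilinear_pairing D' D B" and vac: "B (vacuum D') (vacuum D) = 1"
    and e: "\<And>X N z \<psi> \<psi>'. regular_field X \<Longrightarrow> z \<in> D \<Longrightarrow> \<psi> \<in> carrier (W D) \<Longrightarrow> \<psi>' \<in> carrier (W D') \<Longrightarrow>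
      B \<psi>' ((lie_op D X ^^ N) (e_op D) z \<psi>) = - B ((lie_op D' X ^^ N) (i_op D') z \<psi>') \<psi>"
    and e': "\<And>X N z \<psi> \<psi>'. regular_field X \<Longrightarrow> z \<in> D' \<Longrightarrow> \<psi> \<in> carrier (W D) \<Longrightarrow> \<psi>' \<in> carrier (W D') \<Longrightarrow>
      B ((lie_op D' X ^^ N) (e_op D') z \<psi>') \<psi> = - B \<psi>' ((lie_op D X ^^ N) (i_op D) z \<psi>)"
  shows "B = fock_pair D' D"
proof -
  note dom' = domains_sym[OF dom]
  note sumB = bilinear_pairing_sum[OF B]
  have unit: "(lie (unit_field z) ^^ n) \<alpha> z = jet n z \<alpha>" if "\<alpha> \<in> forms_in E" "z \<notin> E" for \<alpha> E z n
    using that by (intro lie_iter_unit_field regular_unit_field forms_in_analytic[of _ E])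
                  (simp_all add: loc_field_unit_field)
  have i_unit: "(lie_op D' (unit_field z) ^^ n) (i_op D') z (cls D' p') = cls D' (- der (jet n z) p')"
    if dom: "domains D D'" and z: "z \<in> D" and p': "p' \<in> fpolys D'" for D D' z n p'
  proof -
    have "z \<notin> D'" using dom z by (auto simp: domains_def)
    then have "der (\<lambda>\<alpha>. - (lie (unit_field z) ^^ n) \<alpha> z) p' = der (\<lambda>\<alpha>. (- 1) * jet n z \<alpha>) p'"
      by (intro der_cong[OF p']) (simp add: unit)
    also have "\<dots> = - der (jet n z) p'"
      unfolding der_fun_scale by (simp add: const_uminus)
    finally show ?thesis
      by (simp only: lie_op_i_op[OF domains_sym[OF dom] regular_unit_field p' z])
  qed
  have step: "B (cls D' p') (cls D (gen (bform z n) * p)) = B (cls D' (der (jet n z) p')) (cls D p)"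
    if "z \<in> D" "p \<in> fpolys D" "p' \<in> fpolys D'" for z n p p'
  proof -
    have "B (cls D' p') (cls D (gen (bform z n) * p))
        = B (cls D' p') ((lie_op D (unit_field z) ^^ n) (e_op D) z (cls D p))"
      using that cls_eqI[OF e_poly_unit_field[OF dom, of z p n]]
      by (simp add: lie_op_e_op[OF dom regular_unit_field])
    also have "\<dots> = - B (cls D' (\<Sum>k\<in>{()}. const (- 1) * der (jet n z) p')) (cls D p)"
      using that by (simp add: e regular_unit_field i_unit[OF dom] const_uminus)
    also have "\<dots> = B (cls D' (der (jet n z) p')) (cls D p)"
      using that by (subst sumB(2)) simp_all
    finally show ?thesis .
  qed
  have step': "B (cls D' (gen (bform z n) * p')) (cls D 1) = 0"
    if "z \<in> D'" "p' \<in> fpolys D'" for z n p'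
  proof -
    have "B (cls D' (gen (bform z n) * p')) (cls D 1)
        = B ((lie_op D' (unit_field z) ^^ n) (e_op D') z (cls D' p')) (cls D 1)"
      using that cls_eqI[OF e_poly_unit_field[OF dom', of z p' n]]
      by (simp add: lie_op_e_op[OF dom' regular_unit_field])
    \<comment> \<open>derivations annihilate the vacuum; the empty sum is a form of \<open>0\<close> to which linearity applies\<close>
    also have "\<dots> = - B (cls D' p') (cls D (\<Sum>k\<in>({} :: unit set). const 0 * 0))"
      using that by (simp add: e' regular_unit_field i_unit[OF dom'])
    also have "\<dots> = 0" using that by (subst sumB(1)) simp_all
    finally show ?thesis .
  qed
  have vac': "B (cls D' p') (cls D 1) = poly_pair (form_pair D) p' 1" if "p' \<in> fpolys D'" for p'
    using that
  proof (induction rule: polys_induct)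
    case (const c)
    have "B (cls D' (\<Sum>k\<in>{()}. const c * 1)) (cls D 1) = c"
      using vac by (subst sumB(2)) (simp_all add: vacuum_eq)
    then show ?case using poly_pair_const_mult(2)[of "form_pair D" c 1 1] by simp
  next
    case (gen v p')
    obtain K c where rep: "form_rep D' K c v" using form_rep_exists[OF gen(1)] .
    have K: "fst k \<in> D'" if "k \<in> K" for k using rep that by (auto simp: form_rep_def)
    have "B (cls D' (gen v * p')) (cls D 1)
        = B (cls D' (\<Sum>k\<in>K. const (c k) * (gen (bform (fst k) (snd k)) * p'))) (cls D 1)"
      using cls_eqI[OF gen_spanned[OF dom' rep gen(1,2)]] by simp
    also have "\<dots> = 0"
      using gen K by (subst sumB(2)) (simp_all add: step' bform_in_forms)
    also have "\<dots> = poly_pair (form_pair D) (gen v * p') 1"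
      by (simp add: poly_pair_gen_mult')
    finally show ?case .
  next
    case (add p' q')
    have "B (cls D' (\<Sum>k\<in>{True, False}. const 1 * (if k then p' else q'))) (cls D 1)
        = B (cls D' p') (cls D 1) + B (cls D' q') (cls D 1)"
      using add by (subst sumB(2)) simp_all
    then show ?case using add by (simp add: poly_pair_add)
  qed
  have eq: "B (cls D' p') (cls D p) = poly_pair (form_pair D) p' p"
    if "p \<in> fpolys D" "p' \<in> fpolys D'" for p p'
    using that
  proof (induction arbitrary: p' rule: polys_induct)
    case (const c)
    have "B (cls D' p') (cls D (\<Sum>k\<in>{()}. const c * 1)) = c * poly_pair (form_pair D) p' 1"
      using const by (subst sumB(1)) (simp_all add: vac')
    then show ?case using poly_pair_const_mult(1)[of "form_pair D" p' c 1] by simp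
  next
    case (gen v p)
    obtain K c where rep: "form_rep D K c v" using form_rep_exists[OF gen(1)] .
    have K: "fst k \<in> D" if "k \<in> K" for k using rep that by (auto simp: form_rep_def)
    note span = gen_spanned[OF dom rep gen(1,2)]
    have "B (cls D' p') (cls D (gen v * p))
        = B (cls D' p') (cls D (\<Sum>k\<in>K. const (c k) * (gen (bform (fst k) (snd k)) * p)))"
      using cls_eqI[OF span] by simp
    also have "\<dots> = (\<Sum>k\<in>K. c k * B (cls D' p') (cls D (gen (bform (fst k) (snd k)) * p)))"
      using gen K by (subst sumB(1)) (simp_all add: bform_in_forms)
    also have "\<dots> = (\<Sum>k\<in>K. c k * poly_pair (form_pair D) p' (gen (bform (fst k) (snd k)) * p))"
      using gen K by (intro sum.cong refl) (simp add: step poly_pair_adjoint[OF dom])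
    also have "\<dots> = poly_pair (form_pair D) p' (\<Sum>k\<in>K. const (c k) * (gen (bform (fst k) (snd k)) * p))"
      by (simp add: bilinear_form_sum[OF bilinear_form_poly_pair])
    also have "\<dots> = poly_pair (form_pair D) p' (gen v * p)"
      using form_poly_pair_cong[OF dom K.eqv_refl[OF gen.prems] span] by simp
    finally show ?case .
  next
    case (add p q)
    have "B (cls D' p') (cls D (\<Sum>k\<in>{True, False}. const 1 * (if k then p else q)))
        = B (cls D' p') (cls D p) + B (cls D' p') (cls D q)"
      using add by (subst sumB(1)) simp_all
    then show ?case using add by (simp add: poly_pair_add)
  qed
  have PiE: "B \<in> carrier (W D') \<rightarrow>\<^sub>E (carrier (W D) \<rightarrow>\<^sub>E UNIV)"
    "fock_pair D' D \<in> carrier (W D') \<rightarrow>\<^sub>E (carrier (W D) \<rightarrow>\<^sub>E UNIV)"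
    using B bilinear_pairing_fock_pair[OF dom] by (auto simp: bilinear_pairing_def)
  show ?thesis
  proof (rule PiE_ext[OF PiE])
    fix x assume x: "x \<in> carrier (W D')"
    show "B x = fock_pair D' D x"
    proof (rule PiE_ext[OF PiE_mem[OF PiE(1) x] PiE_mem[OF PiE(2) x]])
      fix y assume "y \<in> carrier (W D)"
      then show "B x y = fock_pair D' D x y"
        using x by (auto simp: carrier_W eq fock_pair_cls[OF dom])
    qed
  qed
qed

theorem proposition7p1:
  fixes \<gamma> :: "real \<Rightarrow> proj_line" and D D' :: "proj_line set"
  assumes "smooth_simple_closed_curve \<gamma>"
    and "separates_into \<gamma> D D'"
  shows "\<exists>!B :: fock_vec \<Rightarrow> fock_vec \<Rightarrow> complex.
    bilinear_pairing D' D B \<and>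
    B (vacuum D') (vacuum D) = 1 \<and>
    (\<forall>\<psi>\<in>carrier (W D). \<forall>\<psi>'\<in>carrier (W D').
      (\<forall>z\<in>D. B \<psi>' (e_op D z \<psi>) = - B (i_op D' z \<psi>') \<psi>) \<and>
      (\<forall>z'\<in>D'. B (e_op D' z' \<psi>') \<psi> = - B \<psi>' (i_op D z' \<psi>)) \<and>
      (\<forall>X N. regular_field X \<longrightarrow>
        (\<forall>z\<in>D.
           B \<psi>' ((lie_op D X ^^ N) (e_op D) z \<psi>) = (lie X ^^ N) (\<lambda>z. B \<psi>' (e_op D z \<psi>)) z \<and>
           (lie X ^^ N) (\<lambda>z. B \<psi>' (e_op D z \<psi>)) z
             = - (lie X ^^ N) (\<lambda>z. B (i_op D' z \<psi>') \<psi>) z \<and>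
           - (lie X ^^ N) (\<lambda>z. B (i_op D' z \<psi>') \<psi>) z
             = - B ((lie_op D' X ^^ N) (i_op D') z \<psi>') \<psi>) \<and>
        (\<forall>z'\<in>D'.
           B ((lie_op D' X ^^ N) (e_op D') z' \<psi>') \<psi> = (lie X ^^ N) (\<lambda>z. B (e_op D' z \<psi>') \<psi>) z' \<and>
           (lie X ^^ N) (\<lambda>z. B (e_op D' z \<psi>') \<psi>) z'
             = - (lie X ^^ N) (\<lambda>z. B \<psi>' (i_op D z \<psi>)) z' \<and>
           - (lie X ^^ N) (\<lambda>z. B \<psi>' (i_op D z \<psi>)) z'
             = - B \<psi>' ((lie_op D X ^^ N) (i_op D) z' \<psi>))))"
proof -
  have dom: "domains D D'"
    using separated_domains[OF assms] by (simp add: domains_def)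
  note dom' = domains_sym[OF dom]
  let ?B = "fock_pair D' D"
  note chain = lie_chain[OF dom _ _ _ _ bilinear_form_poly_pair, where B = ?B,
    OF _ _ _ _ fock_pair_cls[OF dom] poly_pair_adjoint[OF dom]]
  note chain' = lie_chain[OF dom' _ _ _ _ bilinear_form_poly_pair_flip, where B = "\<lambda>x y. ?B y x",
    OF _ _ _ _ fock_pair_cls[OF dom] poly_pair_adjoint'[OF dom]]
  show ?thesis
  proof (rule ex1I[of _ ?B], goal_cases)
    case 1
    show ?case
    proof (intro conjI ballI allI impI)
      show "bilinear_pairing D' D ?B" by (rule bilinear_pairing_fock_pair[OF dom])
      show "?B (vacuum D') (vacuum D) = 1" by (simp add: vacuum_eq fock_pair_cls[OF dom])
    next
      fix \<psi> \<psi>' assume "\<psi> \<in> carrier (W D)" "\<psi>' \<in> carrier (W D')"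
      then obtain p p' where p: "p \<in> fpolys D" "\<psi> = cls D p" "p' \<in> fpolys D'" "\<psi>' = cls D' p'"
        by (auto simp: carrier_W)
      show "?B \<psi>' (e_op D z \<psi>) = - ?B (i_op D' z \<psi>') \<psi>" if "z \<in> D" for z
        using chain(2)[OF regular_unit_field p(1,3) that, where N = 0] by (simp add: p)
      show "?B (e_op D' z \<psi>') \<psi> = - ?B \<psi>' (i_op D z \<psi>)" if "z \<in> D'" for z
        using chain'(2)[OF regular_unit_field p(3,1) that, where N = 0] by (simp add: p)
      fix X N assume X: "regular_field X"
      {
        fix z assume z: "z \<in> D"
        note c = chain[OF X p(1,3) z]
        show "?B \<psi>' ((lie_op D X ^^ N) (e_op D) z \<psi>) = (lie X ^^ N) (\<lambda>z. ?B \<psi>' (e_op D z \<psi>)) z"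
          unfolding p by (rule c(1))
        show "(lie X ^^ N) (\<lambda>z. ?B \<psi>' (e_op D z \<psi>)) z = - (lie X ^^ N) (\<lambda>z. ?B (i_op D' z \<psi>') \<psi>) z"
          unfolding p by (rule c(2))
        show "- (lie X ^^ N) (\<lambda>z. ?B (i_op D' z \<psi>') \<psi>) z = - ?B ((lie_op D' X ^^ N) (i_op D') z \<psi>') \<psi>"
          unfolding p by (rule arg_cong[OF c(3)])
      next
        fix z assume z: "z \<in> D'"
        note c = chain'[OF X p(3,1) z]
        show "?B ((lie_op D' X ^^ N) (e_op D') z \<psi>') \<psi> = (lie X ^^ N) (\<lambda>z. ?B (e_op D' z \<psi>') \<psi>) z"
          unfolding p by (rule c(1))
        show "(lie X ^^ N) (\<lambda>z. ?B (e_op D' z \<psi>') \<psi>) z = - (lie X ^^ N) (\<lambda>z. ?B \<psi>' (i_op D z \<psi>)) z"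
          unfolding p by (rule c(2))
        show "- (lie X ^^ N) (\<lambda>z. ?B \<psi>' (i_op D z \<psi>)) z = - ?B \<psi>' ((lie_op D X ^^ N) (i_op D) z \<psi>)"
          unfolding p by (rule arg_cong[OF c(3)])
      }
    qed
  next
    case (2 B)
    show "B = ?B"
    proof (rule pairing_unique[OF dom])
      show "bilinear_pairing D' D B" "B (vacuum D') (vacuum D) = 1" using 2 by blast+
      fix X N z \<psi> \<psi>'
      assume X: "regular_field X" and \<psi>: "\<psi> \<in> carrier (W D)" "\<psi>' \<in> carrier (W D')"
      show "B \<psi>' ((lie_op D X ^^ N) (e_op D) z \<psi>) = - B ((lie_op D' X ^^ N) (i_op D') z \<psi>') \<psi>" if "z \<in> D"
        using 2 X \<psi> that by simp
      show "B ((lie_op D' X ^^ N) (e_op D') z \<psi>') \<psi> = - B \<psi>' ((lie_op D X ^^ N) (i_op D) z \<psi>)" if "z \<in> D'"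
        using 2 X \<psi> that by simp
    qed
  qed
qed

end
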